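(* Let $\mathcal V=\mathrm{Jord}^{(2)}$ be the variety of Jordan metabelian algebras over a field $F$ of characteristic $0$, i.e. the variety defined by $xy=yx$, $(x^2,y,x)=0$, $(xy)(zt)=0$. Then the supervarieties $\mathcal V_{r,s}$ satisfy the following relations, where $\subset$ denotes strict inclusion: (1) $\mathcal V_{r,0}\subset\mathcal V_{r+1,0}$ and $\mathcal V_{r,0}\subset\mathcal V_{r,1}$ for all $r\geqslant1$; (2) $\mathcal V_{r,1}\subset\mathcal V_{r+1,1}$ and $\mathcal V_{r,1}\subset\mathcal V_{r,2}$ for all $r\geqslant0$; (3) $\mathcal V_{r,s}=\mathcal V_{r+1,s}$ and $\mathcal V_{r,s}=\mathcal V_{r,s+1}$ for all $r\geqslant0$, $s\geqslant2$.
   Context: All algebras are over a field $F$ of characteristic $0$ and are not assumed associative or unital. $(x,y,z)=(xy)z-x(yz)$ is the associator. A superalgebra is a $\mathbb Z_2$-graded algebra $\mathcal A=\mathcal A_0+\mathcal A_1$, $\mathcal A_i\mathcal A_j\subseteq\mathcal A_{i+j \bmod 2}$. $\mathrm G=\mathrm G_0+\mathrm G_1$ is the Grassmann algebra on countably many anticommuting generators $e_1,e_2,\dots$ ($\mathrm G_0$, $\mathrm G_1$ spanned by words of even, resp. odd, length). The Grassmann envelope of $\mathcal A$ is $\mathrm G(\mathcal A)=\mathrm G_0\otimes\mathcal A_0+\mathrm G_1\otimes\mathcal A_1\subseteq \mathrm G\otimes\mathcal A$. For a multilinear polynomial $f$, its superization $\tilde f$ is obtained by the Koszul sign rule (a sign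 $(-1)^{ij}$ whenever a variable of parity $i$ passes through one of parity $j$); $\mathcal A$ satisfies the superidentity $\tilde f=0$ if and only if $\mathrm G(\mathcal A)$ satisfies $f=0$. For a variety $\mathcal V$, a $\mathcal V$-superalgebra is a superalgebra $\mathcal A$ with $\mathrm G(\mathcal A)\in\mathcal V$. The supervariety generated by a superalgebra $\mathcal B$ is the class of all superalgebras satisfying every superidentity $\tilde f=0$ ($f$ multilinear) satisfied by $\mathcal B$. For nonnegative integers $(r,s)\ne(0,0)$, $\mathcal V_{r,s}$ is the supervariety generated by the free $\mathcal V$-superalgebra on $r$ even and $s$ odd generators. *)

theory Defs
  imports "HOL-Algebra.Module" "HOL-Algebra.QuotRing" "HOL-Library.Z2" "HOL-Library.FSet"
begin

section \<open>Nonassociative algebras and superalgebras\<close>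

text \<open>The ground field is a type of class \<^class>\<open>field_char_0\<close>; this is the same field as a
  record, as required by the locale \<^locale>\<open>module\<close>.\<close>

definition scalars :: "'f::field_char_0 ring" where
  "scalars = \<lparr>carrier = UNIV, mult = (*), one = 1, zero = 0, add = (+)\<rparr>"

text \<open>Algebras reuse the record type \<^type>\<open>module\<close>. Its unit field \<^const>\<open>one\<close> is never
  referred to: algebras are neither associative nor unital.\<close>

locale nonassoc_algebra = module "scalars :: 'f::field_char_0 ring" A
  for A :: "('f::field_char_0, 'a, 'm) module_scheme" (structure) +
  assumes mult_closed: "\<lbrakk>x \<in> carrier A; y \<in> carrier A\<rbrakk> \<Longrightarrow> x \<otimes> y \<in> carrier A"
    and distrib_right: "\<lbrakk>x \<in> carrier A; y \<in> carrier A; z \<in> carrier A\<rbrakk>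
      \<Longrightarrow> (x \<oplus> y) \<otimes> z = x \<otimes> z \<oplus> y \<otimes> z"
    and distrib_left: "\<lbrakk>x \<in> carrier A; y \<in> carrier A; z \<in> carrier A\<rbrakk>
      \<Longrightarrow> x \<otimes> (y \<oplus> z) = x \<otimes> y \<oplus> x \<otimes> z"
    and smult_mult_left: "\<lbrakk>x \<in> carrier A; y \<in> carrier A\<rbrakk> \<Longrightarrow> (c \<odot> x) \<otimes> y = c \<odot> (x \<otimes> y)"
    and smult_mult_right: "\<lbrakk>x \<in> carrier A; y \<in> carrier A\<rbrakk> \<Longrightarrow> x \<otimes> (c \<odot> y) = c \<odot> (x \<otimes> y)"

record ('f, 'a) superalgebra = "('f, 'a) module" +
  grade :: "bit \<Rightarrow> 'a set"

locale superalgebra = nonassoc_algebra A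
  for A :: "('f::field_char_0, 'a, 'm) superalgebra_scheme" (structure) +
  assumes grade_submodule: "submodule (grade A i) (scalars :: 'f::field_char_0 ring) A"
    and grade_sum: "carrier A = grade A 0 <+> grade A 1"
    and grade_direct: "grade A 0 \<inter> grade A 1 = {\<zero>}"
    and grade_mult: "\<lbrakk>x \<in> grade A i; y \<in> grade A j\<rbrakk> \<Longrightarrow> x \<otimes> y \<in> grade A (i + j)"

section \<open>Grassmann envelope\<close>

text \<open>For finite sets \<open>S\<close> and \<open>T\<close> of indices let \<open>e\<^sub>S\<close> be the product of the generators \<open>e\<^sub>i\<close>,
  \<open>i \<in> S\<close>, in increasing order. The \<open>e\<^sub>S\<close> form a basis of the Grassmann algebra, and
  \<open>e\<^sub>S e\<^sub>T = grassmann_sign S T \<cdot> e\<^sub>S\<^sub>\<union>\<^sub>T\<close> if \<open>S\<close> and \<open>T\<close> are disjoint, while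
  \<open>e\<^sub>S e\<^sub>T = 0\<close> otherwise.\<close>

definition grassmann_sign :: "nat fset \<Rightarrow> nat fset \<Rightarrow> 'f::field_char_0" where
  "grassmann_sign S T = (-1) ^ card {(i, j). i |\<in>| S \<and> j |\<in>| T \<and> j < i}"

text \<open>An element \<open>\<Sum>\<^sub>S e\<^sub>S \<otimes> g\<^sub>S\<close> of the tensor product of the Grassmann algebra with \<open>A\<close> is
  represented by its finitely supported family of coordinates \<open>S \<mapsto> g\<^sub>S \<in> A\<close>; it lies in the
  envelope iff each \<open>g\<^sub>S\<close> is homogeneous of the parity of \<open>|S|\<close>.\<close>

definition grassmann_envelope ::
  "('f::field_char_0, 'a, 'm) superalgebra_scheme \<Rightarrow> ('f, nat fset \<Rightarrow> 'a) module" where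
  "grassmann_envelope A =
    \<lparr>carrier = {g. finite {S. g S \<noteq> \<zero>\<^bsub>A\<^esub>} \<and> (\<forall>S. g S \<in> grade A (of_nat (fcard S)))},
     mult = (\<lambda>g h U. \<Oplus>\<^bsub>A\<^esub>S\<in>{S. S |\<subseteq>| U}.
               grassmann_sign S (U |-| S) \<odot>\<^bsub>A\<^esub> (g S \<otimes>\<^bsub>A\<^esub> h (U |-| S))),
     one = undefined,
     zero = (\<lambda>S. \<zero>\<^bsub>A\<^esub>),
     add = (\<lambda>g h S. g S \<oplus>\<^bsub>A\<^esub> h S),
     smult = (\<lambda>c g S. c \<odot>\<^bsub>A\<^esub> g S)\<rparr>"

section \<open>Jordan metabelian algebras\<close>

definition associator :: "('a, 'm) ring_scheme \<Rightarrow> 'a \<Rightarrow> 'a \<Rightarrow> 'a \<Rightarrow> 'a" where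
  "associator A x y z = (x \<otimes>\<^bsub>A\<^esub> y) \<otimes>\<^bsub>A\<^esub> z \<ominus>\<^bsub>A\<^esub> x \<otimes>\<^bsub>A\<^esub> (y \<otimes>\<^bsub>A\<^esub> z)"

locale jordan_metabelian = nonassoc_algebra A
  for A :: "('f::field_char_0, 'a, 'm) module_scheme" (structure) +
  assumes commutative: "\<lbrakk>x \<in> carrier A; y \<in> carrier A\<rbrakk> \<Longrightarrow> x \<otimes> y = y \<otimes> x"
    and jordan: "\<lbrakk>x \<in> carrier A; y \<in> carrier A\<rbrakk> \<Longrightarrow> associator A (x \<otimes> x) y x = \<zero>"
    and metabelian: "\<lbrakk>x \<in> carrier A; y \<in> carrier A; z \<in> carrier A; t \<in> carrier A\<rbrakk>
      \<Longrightarrow> (x \<otimes> y) \<otimes> (z \<otimes> t) = \<zero>"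

definition jordan_metabelian_superalgebra ::
  "('f::field_char_0, 'a, 'm) superalgebra_scheme \<Rightarrow> bool" where
  "jordan_metabelian_superalgebra A \<longleftrightarrow>
     superalgebra A \<and> jordan_metabelian (grassmann_envelope A)"

section \<open>Nonassociative polynomials and superidentities\<close>

datatype (vars: 'v) monomial = Var 'v | Mul "'v monomial" "'v monomial"

primrec leaves :: "'v monomial \<Rightarrow> 'v list" where
  "leaves (Var v) = [v]"
| "leaves (Mul u w) = leaves u @ leaves w"

primrec eval_monomial :: "('a, 'm) ring_scheme \<Rightarrow> ('v \<Rightarrow> 'a) \<Rightarrow> 'v monomial \<Rightarrow> 'a" where
  "eval_monomial A a (Var v) = a v"
| "eval_monomial A a (Mul u w) = eval_monomial A a u \<otimes>\<^bsub>A\<^esub> eval_monomial A a w"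

text \<open>A polynomial is the finitely supported family of its coefficients.\<close>

type_synonym ('f, 'v) polynomial = "'v monomial \<Rightarrow> 'f"

definition eval_polynomial ::
  "('f::field_char_0, 'a, 'm) module_scheme \<Rightarrow> ('v \<Rightarrow> 'a) \<Rightarrow> ('f, 'v) polynomial \<Rightarrow> 'a" where
  "eval_polynomial A a f = (\<Oplus>\<^bsub>A\<^esub>w\<in>{w. f w \<noteq> 0}. f w \<odot>\<^bsub>A\<^esub> eval_monomial A a w)"

definition multilinear :: "nat \<Rightarrow> ('f::field_char_0, nat) polynomial \<Rightarrow> bool" where
  "multilinear n f \<longleftrightarrow> finite {w. f w \<noteq> 0} \<and>
     (\<forall>w. f w \<noteq> 0 \<longrightarrow> distinct (leaves w) \<and> vars w = {..<n})"

text \<open>The sign acquired when the variables of a word, listed as \<open>vs\<close> and having parities \<open>p\<close>,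
  are rearranged into increasing order: every inversion of two odd variables contributes \<open>-1\<close>.\<close>

definition koszul_sign :: "(nat \<Rightarrow> bit) \<Rightarrow> nat list \<Rightarrow> 'f::field_char_0" where
  "koszul_sign p vs = (-1) ^ card {(k, l). k < l \<and> l < length vs \<and> vs ! l < vs ! k \<and>
     p (vs ! k) * p (vs ! l) = 1}"

definition superization ::
  "(nat \<Rightarrow> bit) \<Rightarrow> ('f::field_char_0, nat) polynomial \<Rightarrow> ('f, nat) polynomial" where
  "superization p f = (\<lambda>w. koszul_sign p (leaves w) * f w)"

text \<open>The superidentity given by \<open>f\<close> comprises all choices of parities of the variables at once.\<close>

definition satisfies_superidentity ::
  "('f::field_char_0, 'a, 'm) superalgebra_scheme \<Rightarrow> ('f, nat) polynomial \<Rightarrow> bool" where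
  "satisfies_superidentity A f \<longleftrightarrow>
     (\<forall>p a. (\<forall>i. a i \<in> grade A (p i)) \<longrightarrow> eval_polynomial A a (superization p f) = \<zero>\<^bsub>A\<^esub>)"

definition supervariety_generated ::
  "('f::field_char_0, 'b) superalgebra \<Rightarrow> ('f, 'a) superalgebra set" where
  "supervariety_generated B = {A. superalgebra A \<and>
     (\<forall>n f. multilinear n f \<longrightarrow> satisfies_superidentity B f \<longrightarrow> satisfies_superidentity A f)}"

section \<open>Free Jordan metabelian superalgebras\<close>

text \<open>The generators are \<open>Inl 0, \<dots>, Inl (r - 1)\<close> (even) and \<open>Inr 0, \<dots>, Inr (s - 1)\<close> (odd).\<close>

primrec generator_parity :: "nat + nat \<Rightarrow> bit" where
  "generator_parity (Inl i) = 0"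
| "generator_parity (Inr j) = 1"

primrec monomial_parity :: "(nat + nat) monomial \<Rightarrow> bit" where
  "monomial_parity (Var x) = generator_parity x"
| "monomial_parity (Mul u w) = monomial_parity u + monomial_parity w"

definition free_nonassoc_carrier ::
  "nat \<Rightarrow> nat \<Rightarrow> ('f::field_char_0, nat + nat) polynomial set" where
  "free_nonassoc_carrier r s = {f. finite {w. f w \<noteq> 0} \<and>
     (\<forall>w. f w \<noteq> 0 \<longrightarrow> vars w \<subseteq> Inl ` {..<r} \<union> Inr ` {..<s})}"

definition free_nonassoc_superalgebra ::
  "nat \<Rightarrow> nat \<Rightarrow> ('f::field_char_0, ('f, nat + nat) polynomial) superalgebra" where
  "free_nonassoc_superalgebra r s =
    \<lparr>carrier = free_nonassoc_carrier r s,
     mult = (\<lambda>f g w. case w of Var x \<Rightarrow> 0 | Mul u v \<Rightarrow> f u * g v),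
     one = undefined,
     zero = (\<lambda>w. 0),
     add = (\<lambda>f g w. f w + g w),
     smult = (\<lambda>c f w. c * f w),
     grade = (\<lambda>i. {f \<in> free_nonassoc_carrier r s. \<forall>w. f w \<noteq> 0 \<longrightarrow> monomial_parity w = i})\<rparr>"

definition graded_ideal ::
  "('f::field_char_0, 'a, 'm) superalgebra_scheme \<Rightarrow> 'a set \<Rightarrow> bool" where
  "graded_ideal A I \<longleftrightarrow> submodule I (scalars :: 'f ring) A \<and>
     (\<forall>x\<in>carrier A. \<forall>y\<in>I. x \<otimes>\<^bsub>A\<^esub> y \<in> I \<and> y \<otimes>\<^bsub>A\<^esub> x \<in> I) \<and>
     I = (I \<inter> grade A 0) <+>\<^bsub>A\<^esub> (I \<inter> grade A 1)"

definition quotient_superalgebra ::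
  "('f::field_char_0, 'a, 'm) superalgebra_scheme \<Rightarrow> 'a set \<Rightarrow> ('f, 'a set) superalgebra" where
  "quotient_superalgebra A I =
    \<lparr>carrier = a_rcosets\<^bsub>A\<^esub> I,
     mult = rcoset_mult A I,
     one = undefined,
     zero = I,
     add = set_add A,
     smult = (\<lambda>c X. \<Union>x\<in>X. I +>\<^bsub>A\<^esub> (c \<odot>\<^bsub>A\<^esub> x)),
     grade = (\<lambda>i. (\<lambda>x. I +>\<^bsub>A\<^esub> x) ` grade A i)\<rparr>"

text \<open>The free superalgebra of the variety is the quotient of the free nonassociative superalgebra
  by the least graded ideal whose quotient is a Jordan metabelian superalgebra.\<close>

type_synonym 'f free_element = "('f, nat + nat) polynomial set"

definition free_jordan_metabelian_superalgebra ::
  "nat \<Rightarrow> nat \<Rightarrow> ('f::field_char_0, 'f free_element) superalgebra" where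
  "free_jordan_metabelian_superalgebra r s =
    quotient_superalgebra (free_nonassoc_superalgebra r s)
      (\<Inter>{I. graded_ideal (free_nonassoc_superalgebra r s) I \<and>
         jordan_metabelian_superalgebra
           (quotient_superalgebra (free_nonassoc_superalgebra r s) I)})"

text \<open>The members of a supervariety are taken with elements in an arbitrary type \<open>'a\<close>. A
  strict inclusion of classes therefore means inclusion for every \<open>'a\<close> and strictness for some
  \<open>'a\<close>; the type \<open>'f free_element\<close>, which houses the free superalgebras, serves for the latter.\<close>

definition supervariety_V ::
  "nat \<Rightarrow> nat \<Rightarrow> ('f::field_char_0, 'a) superalgebra set" where
  "supervariety_V r s =
     supervariety_generated (free_jordan_metabelian_superalgebra r s
       :: ('f, 'f free_element) superalgebra)"

end

theory Submission
  imports Defs "HOL-Library.Multiset"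
begin

text \<open>
  For a multilinear polynomial \<open>f\<close>, evaluating the superization of \<open>f\<close> in a superalgebra amounts to
  evaluating \<open>f\<close> in the Grassmann envelope (\<open>envelope_eval_polynomial\<close>), so superidentities
  can be proved in ordinary Jordan metabelian algebras. Linearizing the Jordan identity and dropping the products of products
  shows that \<open>((w a) b) c = - ((w c) b) a\<close> whenever \<open>w\<close> lies in the square of the algebra (\<open>skew\<close>). Thus in a
  word \<open>(\<dots>(((x\<^sub>i x\<^sub>j) c\<^sub>1) c\<^sub>2) \<dots>) c\<^sub>m\<close> the letters at the odd positions \<open>c\<^sub>1, c\<^sub>3, \<dots>\<close> may be permuted
  at the cost of a sign, and so may those at the even positions.

  Enlarging the set of generators enlarges the supervariety, since the free superalgebra on fewer
  generators is a homomorphic image of the free superalgebra on more (\<open>free_satisfies_mono\<close>).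

  All supervarieties with \<open>s \<ge> 2\<close> coincide. By \<open>skew\<close> and the linearized Jordan identity, a
  multilinear polynomial is a combination of normal words, each given by the set \<open>T\<close> of the letters at odd
  positions and one letter \<open>b\<close> of the initial product. In a superalgebra with two odd generators
  \<open>x\<close> and \<open>y\<close>, substitute \<open>x\<close> for the letters of \<open>T\<close>, \<open>y\<close> for the others and \<open>y x\<close> for \<open>b\<close>: repeating an odd
  letter is harmless, and every normal word except the one for \<open>(b, T)\<close> vanishes. Hence a superidentity
  of the free superalgebra on two odd generators has only zero coefficients and holds in every Jordan
  metabelian superalgebra (\<open>two_odd_generators_universal\<close>).

  The first kind of strict inclusion, for \<open>s = 0\<close>, is witnessed by a word with \<open>2 r + 1\<close> right
  multiplications. Products act on the square as zero, so only the generators matter, and \<open>r\<close> even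
  generators cannot fill the \<open>r + 1\<close> odd positions without a repetition, which vanishes by \<open>skew\<close>
  (\<open>no_odd_generator_satisfies\<close>). With one more even generator, or with an odd one, the word survives.

  For \<open>s = 1\<close> the odd generator makes long words survive, but two of its copies \<open>h, h'\<close> in the envelope
  are killed by the symmetrized pair \<open>w \<mapsto> (w h) h' + (w h') h\<close>. Each even generator can be eliminated from a
  product of such pairs at the cost of a single pair (\<open>sym_pairs_vanish\<close>), so with \<open>r\<close> even generators
  \<open>r + 1\<close> pairs vanish, whereas they survive with \<open>r + 1\<close> even generators. The inclusion of the supervariety
  for \<open>(r, 1)\<close> in that for \<open>(r, 2)\<close> is then strict because the one for \<open>(r + 1, 1)\<close> lies in between. All nonvanishing claims are checked in split null
  extensions by spaces of skew functions on words (\<open>split_jordan_metabelian\<close>).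
\<close>

section \<open>Scalars and algebras\<close>

lemma scalars_simps [simp]:
  "carrier (scalars :: 'f::field_char_0 ring) = UNIV"
  "monoid.mult (scalars :: 'f ring) = (*)" "one (scalars :: 'f ring) = 1"
  "zero (scalars :: 'f ring) = 0" "add (scalars :: 'f ring) = (+)"
  by (simp_all add: scalars_def)

lemma cring_scalars: "cring (scalars :: 'f::field_char_0 ring)"
proof (rule cringI)
  show "abelian_group (scalars :: 'f ring)"
    by (rule abelian_groupI) (auto simp: algebra_simps intro: exI[of _ "- _"] add.left_inverse)
  show "comm_monoid (scalars :: 'f ring)"
    by (rule comm_monoidI) (auto simp: algebra_simps)
qed (auto simp: algebra_simps)

text \<open>Additive inverses arise as the multiples by \<open>- 1\<close>.\<close>

lemma nonassoc_algebraI: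
  fixes A :: "('f::field_char_0, 'a, 'm) module_scheme" (structure)
  assumes add: "\<And>x y. \<lbrakk>x \<in> carrier A; y \<in> carrier A\<rbrakk> \<Longrightarrow> x \<oplus> y \<in> carrier A"
    and zero: "\<zero> \<in> carrier A"
    and assoc: "\<And>x y z. \<lbrakk>x \<in> carrier A; y \<in> carrier A; z \<in> carrier A\<rbrakk>
      \<Longrightarrow> (x \<oplus> y) \<oplus> z = x \<oplus> (y \<oplus> z)"
    and comm: "\<And>x y. \<lbrakk>x \<in> carrier A; y \<in> carrier A\<rbrakk> \<Longrightarrow> x \<oplus> y = y \<oplus> x"
    and l_zero: "\<And>x. x \<in> carrier A \<Longrightarrow> \<zero> \<oplus> x = x"
    and smult: "\<And>c x. x \<in> carrier A \<Longrightarrow> c \<odot> x \<in> carrier A"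
    and sm1: "\<And>a b x. x \<in> carrier A \<Longrightarrow> (a + b) \<odot> x = a \<odot> x \<oplus> b \<odot> x"
    and sm2: "\<And>a x y. \<lbrakk>x \<in> carrier A; y \<in> carrier A\<rbrakk> \<Longrightarrow> a \<odot> (x \<oplus> y) = a \<odot> x \<oplus> a \<odot> y"
    and sm3: "\<And>a b x. x \<in> carrier A \<Longrightarrow> (a * b) \<odot> x = a \<odot> (b \<odot> x)"
    and sm4: "\<And>x. x \<in> carrier A \<Longrightarrow> 1 \<odot> x = x"
    and sm5: "\<And>x. x \<in> carrier A \<Longrightarrow> 0 \<odot> x = \<zero>"
    and m: "\<And>x y. \<lbrakk>x \<in> carrier A; y \<in> carrier A\<rbrakk> \<Longrightarrow> x \<otimes> y \<in> carrier A"
    and m1: "\<And>x y z. \<lbrakk>x \<in> carrier A; y \<in> carrier A; z \<in> carrier A\<rbrakk>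
      \<Longrightarrow> (x \<oplus> y) \<otimes> z = x \<otimes> z \<oplus> y \<otimes> z"
    and m2: "\<And>x y z. \<lbrakk>x \<in> carrier A; y \<in> carrier A; z \<in> carrier A\<rbrakk>
      \<Longrightarrow> x \<otimes> (y \<oplus> z) = x \<otimes> y \<oplus> x \<otimes> z"
    and m3: "\<And>c x y. \<lbrakk>x \<in> carrier A; y \<in> carrier A\<rbrakk> \<Longrightarrow> (c \<odot> x) \<otimes> y = c \<odot> (x \<otimes> y)"
    and m4: "\<And>c x y. \<lbrakk>x \<in> carrier A; y \<in> carrier A\<rbrakk> \<Longrightarrow> x \<otimes> (c \<odot> y) = c \<odot> (x \<otimes> y)"
  shows "nonassoc_algebra A"
proof -
  have "abelian_group A"
  proof (rule abelian_groupI)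
    fix x assume x: "x \<in> carrier A"
    have "(- 1) \<odot> x \<oplus> x = (- 1 + 1) \<odot> x"
      using sm1[OF x, of "- 1" 1] sm4[OF x] by simp
    then show "\<exists>y\<in>carrier A. y \<oplus> x = \<zero>"
      using x smult sm5 by (intro bexI[of _ "(- 1) \<odot> x"]) auto
  qed (use assms in auto)
  then have "module scalars A"
    by (intro moduleI cring_scalars) (use assms in auto)
  then show ?thesis
    by (intro nonassoc_algebra.intro nonassoc_algebra_axioms.intro) (use assms in auto)
qed

section \<open>Linear arithmetic in an algebra\<close>

context nonassoc_algebra
begin

lemma smult_closed_alg [simp, intro]: "x \<in> carrier A \<Longrightarrow> c \<odot> x \<in> carrier A"
  using smult_closed[of c x] by simp

lemma smult_add_left: "x \<in> carrier A \<Longrightarrow> (a + b) \<odot> x = a \<odot> x \<oplus> b \<odot> x"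
  using smult_l_distr[of a b x] by simp

lemma smult_add_right:
  "\<lbrakk>x \<in> carrier A; y \<in> carrier A\<rbrakk> \<Longrightarrow> a \<odot> (x \<oplus> y) = a \<odot> x \<oplus> a \<odot> y"
  using smult_r_distr[of a x y] by simp

lemma smult_smult: "x \<in> carrier A \<Longrightarrow> a \<odot> (b \<odot> x) = (a * b) \<odot> x"
  using smult_assoc1[of a b x] by simp

lemma smult_1 [simp]: "x \<in> carrier A \<Longrightarrow> 1 \<odot> x = x"
  using smult_one[of x] by simp

lemma smult_0 [simp]: "x \<in> carrier A \<Longrightarrow> 0 \<odot> x = \<zero>"
  using smult_l_null[of x] by simp

lemma smult_zero [simp]: "c \<odot> \<zero> = \<zero>"
  using smult_r_null[of c] by simp

lemma minus_eq_smult: "x \<in> carrier A \<Longrightarrow> \<ominus> x = (- 1) \<odot> x"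
proof -
  assume x: "x \<in> carrier A"
  have "(- 1) \<odot> x \<oplus> x = (- 1 + 1) \<odot> x"
    using smult_add_left[OF x, of "- 1" 1] x by simp
  then have "(- 1) \<odot> x \<oplus> x = \<zero>" using x by simp
  then show ?thesis using x M.minus_equality by simp
qed

lemma smult_eq_zero:
  assumes "x \<in> carrier A" "c \<odot> x = \<zero>" "c \<noteq> 0" shows "x = \<zero>"
proof -
  have "(inverse c * c) \<odot> x = \<zero>" using assms smult_smult[of x "inverse c" c] by simp
  then show ?thesis using assms by simp
qed

lemma zero_mult [simp]: "x \<in> carrier A \<Longrightarrow> \<zero> \<otimes> x = \<zero>"
  using smult_mult_left[of \<zero> x 0] mult_closed[of \<zero> x] by simp

lemma mult_zero [simp]: "x \<in> carrier A \<Longrightarrow> x \<otimes> \<zero> = \<zero>"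
  using smult_mult_right[of x \<zero> 0] mult_closed[of x \<zero>] by simp

lemma minus_mult: "\<lbrakk>x \<in> carrier A; y \<in> carrier A\<rbrakk> \<Longrightarrow> (\<ominus> x) \<otimes> y = \<ominus> (x \<otimes> y)"
  by (simp add: minus_eq_smult smult_mult_left mult_closed)

lemma mult_minus: "\<lbrakk>x \<in> carrier A; y \<in> carrier A\<rbrakk> \<Longrightarrow> x \<otimes> (\<ominus> y) = \<ominus> (x \<otimes> y)"
  by (simp add: minus_eq_smult smult_mult_right mult_closed)

lemma smult_minus: "x \<in> carrier A \<Longrightarrow> c \<odot> (\<ominus> x) = \<ominus> (c \<odot> x)"
  by (simp add: minus_eq_smult smult_smult)

lemma double: "x \<in> carrier A \<Longrightarrow> x \<oplus> x = 2 \<odot> x"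
  using smult_add_left[of x 1 1] by simp

lemma finsum_smult:
  "f \<in> S \<rightarrow> carrier A \<Longrightarrow> c \<odot> (\<Oplus>i\<in>S. f i) = (\<Oplus>i\<in>S. c \<odot> f i)"
proof (cases "finite S")
  case True
  assume "f \<in> S \<rightarrow> carrier A"
  then show ?thesis using finsum_smult_ldistr[OF True, of c f] by simp
qed (simp add: finsum_infinite)

lemma finsum_mult_right:
  "\<lbrakk>f \<in> S \<rightarrow> carrier A; y \<in> carrier A\<rbrakk> \<Longrightarrow> (\<Oplus>i\<in>S. f i) \<otimes> y = (\<Oplus>i\<in>S. f i \<otimes> y)"
proof (induct S rule: infinite_finite_induct)
  case (insert x F)
  then have "f \<in> F \<rightarrow> carrier A" "f x \<in> carrier A" by auto
  with insert show ?case
    by (auto simp: distrib_right mult_closed Pi_def intro!: finsum_insert[symmetric])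
qed (auto simp: finsum_infinite)

lemma finsum_all_zero:
  "(\<And>i. i \<in> S \<Longrightarrow> f i = \<zero>) \<Longrightarrow> (\<Oplus>i\<in>S. f i) = \<zero>"
  using M.add.finprod_cong'[of S S "\<lambda>_. \<zero>" f] by (simp add: Pi_def)

lemma finsum_superset:
  assumes "finite T" "S \<subseteq> T" "\<And>i. i \<in> T - S \<Longrightarrow> f i = \<zero>" "f \<in> S \<rightarrow> carrier A"
  shows "(\<Oplus>i\<in>S. f i) = (\<Oplus>i\<in>T. f i)"
proof -
  have "(\<Oplus>i\<in>S \<union> (T - S). f i) = (\<Oplus>i\<in>S. f i) \<oplus> (\<Oplus>i\<in>T - S. f i)"
    by (rule finsum_Un_disjoint) (use assms finite_subset in auto)
  moreover have "(\<Oplus>i\<in>T - S. f i) = \<zero>" using assms(3) by (rule finsum_all_zero)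
  moreover have "S \<union> (T - S) = T" using assms(2) by auto
  ultimately show ?thesis using assms by (simp add: finsum_closed)
qed

lemma finsum_one:
  assumes "finite T" "k \<in> T" "\<And>i. \<lbrakk>i \<in> T; i \<noteq> k\<rbrakk> \<Longrightarrow> f i = \<zero>" "f k \<in> carrier A"
  shows "(\<Oplus>i\<in>T. f i) = f k"
proof -
  have "(\<Oplus>i\<in>{k}. f i) = (\<Oplus>i\<in>T. f i)"
    by (rule finsum_superset) (use assms in auto)
  then show ?thesis using assms(4) by simp
qed

lemma finsum_in:
  assumes "\<zero> \<in> H" "\<And>x y. \<lbrakk>x \<in> H; y \<in> H\<rbrakk> \<Longrightarrow> x \<oplus> y \<in> H" "H \<subseteq> carrier A"
    and "\<And>i. i \<in> S \<Longrightarrow> f i \<in> H"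
  shows "(\<Oplus>i\<in>S. f i) \<in> H"
  using assms(4)
proof (induct S rule: infinite_finite_induct)
  case (insert x F)
  then have "f \<in> F \<rightarrow> carrier A" "f x \<in> carrier A" using assms(3) by auto
  then show ?case using insert assms(2) by (simp add: Pi_def)
qed (auto simp: finsum_infinite assms(1))

end

section \<open>Homomorphisms and evaluation\<close>

definition algebra_hom ::
  "('f::field_char_0, 'a, 'm) module_scheme \<Rightarrow> ('f, 'b, 'n) module_scheme \<Rightarrow> ('a \<Rightarrow> 'b) \<Rightarrow> bool" where
  "algebra_hom A C h \<longleftrightarrow> h \<in> carrier A \<rightarrow> carrier C \<and>
     (\<forall>x\<in>carrier A. \<forall>y\<in>carrier A. h (x \<oplus>\<^bsub>A\<^esub> y) = h x \<oplus>\<^bsub>C\<^esub> h y \<and> h (x \<otimes>\<^bsub>A\<^esub> y) = h x \<otimes>\<^bsub>C\<^esub> h y) \<and>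
     (\<forall>c. \<forall>x\<in>carrier A. h (c \<odot>\<^bsub>A\<^esub> x) = c \<odot>\<^bsub>C\<^esub> h x)"

lemma algebra_homD:
  assumes "algebra_hom A C h"
  shows "x \<in> carrier A \<Longrightarrow> h x \<in> carrier C"
    "\<lbrakk>x \<in> carrier A; y \<in> carrier A\<rbrakk> \<Longrightarrow> h (x \<oplus>\<^bsub>A\<^esub> y) = h x \<oplus>\<^bsub>C\<^esub> h y"
    "\<lbrakk>x \<in> carrier A; y \<in> carrier A\<rbrakk> \<Longrightarrow> h (x \<otimes>\<^bsub>A\<^esub> y) = h x \<otimes>\<^bsub>C\<^esub> h y"
    "x \<in> carrier A \<Longrightarrow> h (c \<odot>\<^bsub>A\<^esub> x) = c \<odot>\<^bsub>C\<^esub> h x"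
  using assms unfolding algebra_hom_def by auto

lemma algebra_hom_zero:
  assumes "nonassoc_algebra A" "nonassoc_algebra C" "algebra_hom A C h"
  shows "h \<zero>\<^bsub>A\<^esub> = \<zero>\<^bsub>C\<^esub>"
proof -
  interpret A: nonassoc_algebra A by fact
  interpret C: nonassoc_algebra C by fact
  have "h (0 \<odot>\<^bsub>A\<^esub> \<zero>\<^bsub>A\<^esub>) = 0 \<odot>\<^bsub>C\<^esub> h \<zero>\<^bsub>A\<^esub>"
    using algebra_homD(4)[OF assms(3), of "\<zero>\<^bsub>A\<^esub>" 0] by simp
  then show ?thesis using algebra_homD(1)[OF assms(3), of "\<zero>\<^bsub>A\<^esub>"] by simp
qed

lemma algebra_hom_minus:
  assumes "nonassoc_algebra A" "nonassoc_algebra C" "algebra_hom A C h"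
    "x \<in> carrier A"
  shows "h (\<ominus>\<^bsub>A\<^esub> x) = \<ominus>\<^bsub>C\<^esub> h x"
  using assms algebra_homD[OF assms(3)]
  by (simp add: nonassoc_algebra.minus_eq_smult)

lemma algebra_hom_finsum:
  assumes "nonassoc_algebra A" "nonassoc_algebra C" "algebra_hom A C h"
    "g \<in> S \<rightarrow> carrier A"
  shows "h (\<Oplus>\<^bsub>A\<^esub>i\<in>S. g i) = (\<Oplus>\<^bsub>C\<^esub>i\<in>S. h (g i))"
proof -
  interpret A: nonassoc_algebra A by fact
  interpret C: nonassoc_algebra C by fact
  show ?thesis using assms(4)
  proof (induct S rule: infinite_finite_induct)
    case (insert x F)
    then have "g \<in> F \<rightarrow> carrier A" "g x \<in> carrier A" by auto
    moreover have "(\<lambda>i. h (g i)) \<in> F \<rightarrow> carrier C" "h (g x) \<in> carrier C"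
      using calculation algebra_homD(1)[OF assms(3)] by auto
    ultimately show ?case using insert algebra_homD(2)[OF assms(3)]
      by (simp add: A.finsum_closed)
  qed (auto simp: A.finsum_infinite C.finsum_infinite algebra_hom_zero[OF assms(1-3)])
qed

context nonassoc_algebra
begin

lemma eval_monomial_closed:
  "(\<And>v. v \<in> vars w \<Longrightarrow> a v \<in> carrier A) \<Longrightarrow> eval_monomial A a w \<in> carrier A"
  by (induct w) (auto intro: mult_closed)

lemma eval_polynomial_superset:
  assumes "finite T" "{w. f w \<noteq> 0} \<subseteq> T"
    "\<And>w. f w \<noteq> 0 \<Longrightarrow> eval_monomial A a w \<in> carrier A"
    "\<And>w. w \<in> T \<Longrightarrow> eval_monomial A a w \<in> carrier A"
  shows "eval_polynomial A a f = (\<Oplus>w\<in>T. f w \<odot> eval_monomial A a w)"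
  unfolding eval_polynomial_def
  by (rule finsum_superset) (use assms in auto)

lemma eval_polynomial_closed:
  assumes "\<And>w. f w \<noteq> 0 \<Longrightarrow> eval_monomial A a w \<in> carrier A"
  shows "eval_polynomial A a f \<in> carrier A"
  unfolding eval_polynomial_def by (rule finsum_closed) (use assms in auto)

end

lemma eval_monomial_cong:
  "(\<And>v. v \<in> vars w \<Longrightarrow> a v = b v) \<Longrightarrow> eval_monomial A a w = eval_monomial A b w"
  by (induct w) auto

lemma (in nonassoc_algebra) eval_polynomial_cong:
  assumes "\<And>w v. \<lbrakk>f w \<noteq> 0; v \<in> vars w\<rbrakk> \<Longrightarrow> a v = b v"
    "\<And>w v. \<lbrakk>f w \<noteq> 0; v \<in> vars w\<rbrakk> \<Longrightarrow> b v \<in> carrier A"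
  shows "eval_polynomial A a f = eval_polynomial A b f"
  unfolding eval_polynomial_def
proof (rule M.add.finprod_cong')
  show "(\<lambda>w. f w \<odot> eval_monomial A b w) \<in> {w. f w \<noteq> 0} \<rightarrow> carrier A"
    using eval_monomial_closed[of _ b] assms(2) by auto
  fix w assume "w \<in> {w. f w \<noteq> 0}"
  then show "f w \<odot> eval_monomial A a w = f w \<odot> eval_monomial A b w"
    using eval_monomial_cong[of w a b A] assms(1) by simp
qed simp

lemma algebra_hom_eval_monomial:
  assumes "nonassoc_algebra A" "algebra_hom A C h"
    "\<And>v. v \<in> vars w \<Longrightarrow> a v \<in> carrier A"
  shows "h (eval_monomial A a w) = eval_monomial C (\<lambda>v. h (a v)) w"
  using assms(3)
  by (induct w) (auto simp: algebra_homD(3)[OF assms(2)]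
      nonassoc_algebra.eval_monomial_closed[OF assms(1)])

lemma algebra_hom_eval_polynomial:
  assumes "nonassoc_algebra A" "nonassoc_algebra C" "algebra_hom A C h"
    "\<And>w v. \<lbrakk>f w \<noteq> 0; v \<in> vars w\<rbrakk> \<Longrightarrow> a v \<in> carrier A"
  shows "h (eval_polynomial A a f) = eval_polynomial C (\<lambda>v. h (a v)) f"
proof -
  interpret A: nonassoc_algebra A by fact
  interpret C: nonassoc_algebra C by fact
  have cl: "eval_monomial A a w \<in> carrier A" if "f w \<noteq> 0" for w
    using A.eval_monomial_closed assms(4)[OF that] by blast
  have "h (eval_polynomial A a f)
      = (\<Oplus>\<^bsub>C\<^esub>w\<in>{w. f w \<noteq> 0}. h (f w \<odot>\<^bsub>A\<^esub> eval_monomial A a w))"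
    unfolding eval_polynomial_def by (rule algebra_hom_finsum[OF assms(1-3)]) (use cl in auto)
  also have "\<dots> = eval_polynomial C (\<lambda>v. h (a v)) f"
    unfolding eval_polynomial_def
  proof (rule C.M.add.finprod_cong')
    fix w assume w: "w \<in> {w. f w \<noteq> 0}"
    show "h (f w \<odot>\<^bsub>A\<^esub> eval_monomial A a w) = f w \<odot>\<^bsub>C\<^esub> eval_monomial C (\<lambda>v. h (a v)) w"
      using algebra_homD(4)[OF assms(3) cl] algebra_hom_eval_monomial[OF assms(1,3), of w a] w assms(4)
      by auto
  next
    show "(\<lambda>w. f w \<odot>\<^bsub>C\<^esub> eval_monomial C (\<lambda>v. h (a v)) w) \<in> {w. f w \<noteq> 0} \<rightarrow> carrier C"
      using C.eval_monomial_closed[of _ "\<lambda>v. h (a v)"] assms(4) algebra_homD(1)[OF assms(3)]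
      by (auto intro!: C.smult_closed_alg)
  qed simp
  finally show ?thesis .
qed

text \<open>Identities are reflected by embeddings. This transports them from an algebra to the quotients by
  kernels of homomorphisms into it.\<close>

lemma jordan_metabelian_embed:
  assumes A: "nonassoc_algebra A" and C: "jordan_metabelian C" and h: "algebra_hom A C h"
    and inj: "inj_on h (carrier A)"
  shows "jordan_metabelian A"
proof -
  interpret A: nonassoc_algebra A by fact
  interpret C: jordan_metabelian C by fact
  note hom = algebra_homD[OF h]
  note h0 = algebra_hom_zero[OF A C.nonassoc_algebra_axioms h]
  note hm = algebra_hom_minus[OF A C.nonassoc_algebra_axioms h]
  show ?thesis
  proof (intro jordan_metabelian.intro jordan_metabelian_axioms.intro A)
    fix x y assume "x \<in> carrier A" "y \<in> carrier A"
    then show "x \<otimes>\<^bsub>A\<^esub> y = y \<otimes>\<^bsub>A\<^esub> x"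
      by (intro inj_onD[OF inj]) (auto simp: hom C.commutative A.mult_closed)
  next
    fix x y assume xy: "x \<in> carrier A" "y \<in> carrier A"
    have "h (associator A (x \<otimes>\<^bsub>A\<^esub> x) y x) = associator C (h x \<otimes>\<^bsub>C\<^esub> h x) (h y) (h x)"
      using xy by (simp add: associator_def a_minus_def hom hm A.mult_closed)
    also have "\<dots> = h \<zero>\<^bsub>A\<^esub>" using xy by (simp add: C.jordan hom h0)
    finally show "associator A (x \<otimes>\<^bsub>A\<^esub> x) y x = \<zero>\<^bsub>A\<^esub>"
      by (rule inj_onD[OF inj]) (use xy in \<open>auto simp: associator_def A.mult_closed\<close>)
  next
    fix x y z t assume "x \<in> carrier A" "y \<in> carrier A" "z \<in> carrier A" "t \<in> carrier A"
    then show "(x \<otimes>\<^bsub>A\<^esub> y) \<otimes>\<^bsub>A\<^esub> (z \<otimes>\<^bsub>A\<^esub> t) = \<zero>\<^bsub>A\<^esub>"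
      by (intro inj_onD[OF inj]) (auto simp: hom C.metabelian A.mult_closed h0)
  qed
qed

section \<open>Superalgebras and signs\<close>

context superalgebra
begin

lemma grade_carrier: "x \<in> grade A i \<Longrightarrow> x \<in> carrier A"
  using submoduleE(1)[OF grade_submodule] by auto

lemma grade_zero [simp]: "\<zero> \<in> grade A i"
proof -
  obtain x where "x \<in> grade A i" using submoduleE(2)[OF grade_submodule[of i]] by auto
  then have "0 \<odot> x \<in> grade A i" using submoduleE(4)[OF grade_submodule[of i], of 0 x] by simp
  then show ?thesis using grade_carrier[OF \<open>x \<in> grade A i\<close>] by simp
qed

lemma grade_add: "\<lbrakk>x \<in> grade A i; y \<in> grade A i\<rbrakk> \<Longrightarrow> x \<oplus> y \<in> grade A i"
  using submoduleE(5)[OF grade_submodule] by auto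

lemma grade_smult: "x \<in> grade A i \<Longrightarrow> c \<odot> x \<in> grade A i"
  using submoduleE(4)[OF grade_submodule, of c] by auto

lemma grade_finsum: "(\<And>i. i \<in> S \<Longrightarrow> f i \<in> grade A k) \<Longrightarrow> (\<Oplus>i\<in>S. f i) \<in> grade A k"
  by (rule finsum_in) (auto intro: grade_add grade_carrier)

lemma grade_decompose:
  assumes "x \<in> carrier A"
  obtains y z where "y \<in> grade A 0" "z \<in> grade A 1" "x = y \<oplus> z"
  using assms grade_sum by (auto simp: set_add_def')

lemma grade_both_zero: "\<lbrakk>x \<in> grade A i; x \<in> grade A j; i \<noteq> j\<rbrakk> \<Longrightarrow> x = \<zero>"
  using grade_direct by (cases i; cases j) auto

lemma grade_sum_zero:
  assumes "y \<in> grade A 0" "z \<in> grade A 1" "y \<oplus> z = \<zero>"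
  shows "y = \<zero>" "z = \<zero>"
proof -
  have c: "y \<in> carrier A" "z \<in> carrier A" using assms grade_carrier by auto
  then have "y = \<ominus> z" using assms(3) M.minus_equality by force
  then have "y \<in> grade A 1" using grade_smult[OF assms(2), of "- 1"] c by (simp add: minus_eq_smult)
  then show y: "y = \<zero>" using assms(1) grade_both_zero[of y 0 1] by simp
  then show "z = \<zero>" using assms(3) c by simp
qed

end

lemma fset_subsets: "{S. S |\<subseteq>| U} = fset (fPow U)"
  by auto

lemma finite_fset_subsets [simp]: "finite {S. S |\<subseteq>| U}"
  by (simp add: fset_subsets)

lemma finite_sign_pairs [simp]: "finite {(i, j). i |\<in>| S \<and> j |\<in>| T \<and> j < i}"
  by (rule finite_subset[of _ "fset S \<times> fset T"]) auto

lemma grassmann_sign_empty [simp]: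
  "grassmann_sign {||} T = 1" "grassmann_sign S {||} = 1"
  by (simp_all add: grassmann_sign_def)

lemma grassmann_sign_union_left:
  assumes "S |\<inter>| S' = {||}"
  shows "grassmann_sign (S |\<union>| S') T = grassmann_sign S T * grassmann_sign S' T"
proof -
  have "{(i, j). i |\<in>| S |\<union>| S' \<and> j |\<in>| T \<and> j < i}
      = {(i, j). i |\<in>| S \<and> j |\<in>| T \<and> j < i} \<union> {(i, j). i |\<in>| S' \<and> j |\<in>| T \<and> j < i}"
    by auto
  moreover have "{(i, j). i |\<in>| S \<and> j |\<in>| T \<and> j < i} \<inter> {(i, j). i |\<in>| S' \<and> j |\<in>| T \<and> j < i} = {}"
    using assms by auto
  ultimately show ?thesis
    by (simp add: grassmann_sign_def card_Un_disjoint power_add)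
qed

lemma grassmann_sign_union_right:
  assumes "T |\<inter>| T' = {||}"
  shows "grassmann_sign S (T |\<union>| T') = grassmann_sign S T * grassmann_sign S T'"
proof -
  have "{(i, j). i |\<in>| S \<and> j |\<in>| T |\<union>| T' \<and> j < i}
      = {(i, j). i |\<in>| S \<and> j |\<in>| T \<and> j < i} \<union> {(i, j). i |\<in>| S \<and> j |\<in>| T' \<and> j < i}"
    by auto
  moreover have "{(i, j). i |\<in>| S \<and> j |\<in>| T \<and> j < i} \<inter> {(i, j). i |\<in>| S \<and> j |\<in>| T' \<and> j < i} = {}"
    using assms by auto
  ultimately show ?thesis
    by (simp add: grassmann_sign_def card_Un_disjoint power_add)
qed

text \<open>Each pair in \<open>S \<times> T\<close> is an inversion of exactly one of the two concatenations \<open>S T\<close> and \<open>T S\<close>.\<close>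

lemma grassmann_sign_swap:
  assumes "S |\<inter>| T = {||}"
  shows "grassmann_sign T S = (- 1) ^ (fcard S * fcard T) * (grassmann_sign S T :: 'f::field_char_0)"
proof -
  let ?A = "{(i, j). i |\<in>| S \<and> j |\<in>| T \<and> j < i}" and ?B = "{(i, j). i |\<in>| T \<and> j |\<in>| S \<and> j < i}"
  have "fset S \<times> fset T = ?A \<union> prod.swap ` ?B"
    using assms by (auto simp: image_iff)
  moreover have "?A \<inter> prod.swap ` ?B = {}" by auto
  ultimately have "card (fset S \<times> fset T) = card ?A + card (prod.swap ` ?B)"
    by (simp only: card_Un_disjoint finite_sign_pairs finite_imageI)
  also have "card (prod.swap ` ?B) = card ?B" by (rule card_image) auto
  finally have *: "fcard S * fcard T = card ?A + card ?B"
    by (simp add: card_cartesian_product fcard.rep_eq)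
  show ?thesis
    unfolding grassmann_sign_def * power_add
    by (simp add: power_mult_distrib[symmetric] mult.assoc mult.left_commute)
qed

section \<open>The Grassmann envelope\<close>

text \<open>The element \<open>e\<^sub>S \<otimes> a\<close> of the tensor product with the Grassmann algebra, where \<open>e\<^sub>S\<close> is the product of
  the generators in \<open>S\<close> in increasing order.\<close>

definition pure_tensor ::
  "('f::field_char_0, 'a, 'm) superalgebra_scheme \<Rightarrow> nat fset \<Rightarrow> 'a \<Rightarrow> nat fset \<Rightarrow> 'a" where
  "pure_tensor A S a = (\<lambda>T. if T = S then a else \<zero>\<^bsub>A\<^esub>)"

lemma envelope_simps:
  "g \<in> carrier (grassmann_envelope A) \<longleftrightarrow>
    finite {S. g S \<noteq> \<zero>\<^bsub>A\<^esub>} \<and> (\<forall>S. g S \<in> grade A (of_nat (fcard S)))"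
  "zero (grassmann_envelope A) = (\<lambda>S. \<zero>\<^bsub>A\<^esub>)"
  "add (grassmann_envelope A) g h = (\<lambda>S. g S \<oplus>\<^bsub>A\<^esub> h S)"
  "smult (grassmann_envelope A) c g = (\<lambda>S. c \<odot>\<^bsub>A\<^esub> g S)"
  "monoid.mult (grassmann_envelope A) g h = (\<lambda>U. \<Oplus>\<^bsub>A\<^esub>S\<in>{S. S |\<subseteq>| U}.
               grassmann_sign S (U |-| S) \<odot>\<^bsub>A\<^esub> (g S \<otimes>\<^bsub>A\<^esub> h (U |-| S)))"
  by (simp_all add: grassmann_envelope_def)

lemma fcard_minus_add: "S |\<subseteq>| U \<Longrightarrow> fcard S + fcard (U |-| S) = fcard U"
  by (metis fcard_funion_disjoint fminus_disjoint inf_commute sup_commute fminus_partition)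

context superalgebra
begin

abbreviation "G \<equiv> grassmann_envelope A"

lemma envelope_coord: "g \<in> carrier G \<Longrightarrow> g S \<in> carrier A"
  by (auto simp: envelope_simps intro: grade_carrier)

lemma envelope_coord_grade: "g \<in> carrier G \<Longrightarrow> g S \<in> grade A (of_nat (fcard S))"
  by (auto simp: envelope_simps)

lemma envelope_nonassoc_algebra: "nonassoc_algebra G"
proof (rule nonassoc_algebraI)
  note c = envelope_coord
  show "x \<oplus>\<^bsub>G\<^esub> y \<in> carrier G" if "x \<in> carrier G" "y \<in> carrier G" for x y
  proof -
    have "{S. x S \<oplus> y S \<noteq> \<zero>} \<subseteq> {S. x S \<noteq> \<zero>} \<union> {S. y S \<noteq> \<zero>}" by auto
    then show ?thesis using that
      by (auto simp: envelope_simps intro: grade_add finite_subset)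
  qed
  show "\<zero>\<^bsub>G\<^esub> \<in> carrier G" by (simp add: envelope_simps)
  show "c \<odot>\<^bsub>G\<^esub> x \<in> carrier G" if "x \<in> carrier G" for c x
  proof -
    have "{S. c \<odot> x S \<noteq> \<zero>} \<subseteq> {S. x S \<noteq> \<zero>}" by auto
    then show ?thesis using that
      by (auto simp: envelope_simps intro: grade_smult finite_subset)
  qed
  show "x \<otimes>\<^bsub>G\<^esub> y \<in> carrier G" if xy: "x \<in> carrier G" "y \<in> carrier G" for x y
  proof -
    have "(x \<otimes>\<^bsub>G\<^esub> y) U \<in> grade A (of_nat (fcard U))" for U
      unfolding envelope_simps(5)
    proof (rule grade_finsum)
      fix S assume "S \<in> {S. S |\<subseteq>| U}"
      then have "(of_nat (fcard U) :: bit) = of_nat (fcard S) + of_nat (fcard (U |-| S))"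
        by (metis mem_Collect_eq fcard_minus_add of_nat_add)
      then show "grassmann_sign S (U |-| S) \<odot> (x S \<otimes> y (U |-| S)) \<in> grade A (of_nat (fcard U))"
        using grade_smult[OF grade_mult[OF envelope_coord_grade[OF xy(1)] envelope_coord_grade[OF xy(2)]]]
        by simp
    qed
    moreover have "{U. (x \<otimes>\<^bsub>G\<^esub> y) U \<noteq> \<zero>}
        \<subseteq> (\<lambda>(S, T). S |\<union>| T) ` ({S. x S \<noteq> \<zero>} \<times> {S. y S \<noteq> \<zero>})"
    proof
      fix U assume "U \<in> {U. (x \<otimes>\<^bsub>G\<^esub> y) U \<noteq> \<zero>}"
      then have "\<exists>S. S |\<subseteq>| U \<and> grassmann_sign S (U |-| S) \<odot> (x S \<otimes> y (U |-| S)) \<noteq> \<zero>"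
        using finsum_all_zero unfolding envelope_simps(5) by (metis (mono_tags, lifting) mem_Collect_eq)
      then obtain S where S: "S |\<subseteq>| U" "grassmann_sign S (U |-| S) \<odot> (x S \<otimes> y (U |-| S)) \<noteq> \<zero>" by auto
      then have "x S \<noteq> \<zero>" "y (U |-| S) \<noteq> \<zero>" using c[OF xy(1), of S] c[OF xy(2), of "U |-| S"] by auto
      then show "U \<in> (\<lambda>(S, T). S |\<union>| T) ` ({S. x S \<noteq> \<zero>} \<times> {S. y S \<noteq> \<zero>})"
        using S(1) by (intro image_eqI[of _ _ "(S, U |-| S)"]) auto
    qed
    then have "finite {U. (x \<otimes>\<^bsub>G\<^esub> y) U \<noteq> \<zero>}"
      by (rule finite_subset) (use xy in \<open>auto simp: envelope_simps\<close>)
    ultimately show ?thesis by (simp add: envelope_simps(1))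
  qed
  show "(x \<oplus>\<^bsub>G\<^esub> y) \<otimes>\<^bsub>G\<^esub> z = x \<otimes>\<^bsub>G\<^esub> z \<oplus>\<^bsub>G\<^esub> y \<otimes>\<^bsub>G\<^esub> z"
    if xyz: "x \<in> carrier G" "y \<in> carrier G" "z \<in> carrier G" for x y z
    unfolding envelope_simps(3,5)
    by (rule ext, subst finsum_addf[symmetric])
       (auto simp: c[OF xyz(1)] c[OF xyz(2)] c[OF xyz(3)] mult_closed distrib_right smult_add_right)
  show "x \<otimes>\<^bsub>G\<^esub> (y \<oplus>\<^bsub>G\<^esub> z) = x \<otimes>\<^bsub>G\<^esub> y \<oplus>\<^bsub>G\<^esub> x \<otimes>\<^bsub>G\<^esub> z"
    if xyz: "x \<in> carrier G" "y \<in> carrier G" "z \<in> carrier G" for x y z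
    unfolding envelope_simps(3,5)
    by (rule ext, subst finsum_addf[symmetric])
       (auto simp: c[OF xyz(1)] c[OF xyz(2)] c[OF xyz(3)] mult_closed distrib_left smult_add_right)
  show "(k \<odot>\<^bsub>G\<^esub> x) \<otimes>\<^bsub>G\<^esub> y = k \<odot>\<^bsub>G\<^esub> (x \<otimes>\<^bsub>G\<^esub> y)"
    if xy: "x \<in> carrier G" "y \<in> carrier G" for k x y
    unfolding envelope_simps(4,5)
    by (rule ext, subst finsum_smult)
       (auto simp: c[OF xy(1)] c[OF xy(2)] mult_closed smult_mult_left smult_smult mult.commute)
  show "x \<otimes>\<^bsub>G\<^esub> (k \<odot>\<^bsub>G\<^esub> y) = k \<odot>\<^bsub>G\<^esub> (x \<otimes>\<^bsub>G\<^esub> y)"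
    if xy: "x \<in> carrier G" "y \<in> carrier G" for k x y
    unfolding envelope_simps(4,5)
    by (rule ext, subst finsum_smult)
       (auto simp: c[OF xy(1)] c[OF xy(2)] mult_closed smult_mult_right smult_smult mult.commute)
qed (auto simp: envelope_simps(2-4) envelope_coord M.a_ac smult_add_left
      smult_add_right smult_smult)

lemma pure_closed [simp]: "a \<in> grade A (of_nat (fcard S)) \<Longrightarrow> pure_tensor A S a \<in> carrier G"
proof -
  assume a: "a \<in> grade A (of_nat (fcard S))"
  have "{T. pure_tensor A S a T \<noteq> \<zero>} \<subseteq> {S}" by (auto simp: pure_tensor_def)
  then have "finite {T. pure_tensor A S a T \<noteq> \<zero>}" by (rule finite_subset) simp
  then show ?thesis using a by (simp add: envelope_simps pure_tensor_def)
qed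

lemma pure_zero [simp]: "pure_tensor A S \<zero> = \<zero>\<^bsub>G\<^esub>"
  by (auto simp: pure_tensor_def envelope_simps)

lemma pure_add:
  "\<lbrakk>a \<in> carrier A; b \<in> carrier A\<rbrakk>
    \<Longrightarrow> pure_tensor A S (a \<oplus> b) = pure_tensor A S a \<oplus>\<^bsub>G\<^esub> pure_tensor A S b"
  by (auto simp: pure_tensor_def envelope_simps)

lemma pure_smult:
  "a \<in> carrier A \<Longrightarrow> pure_tensor A S (c \<odot> a) = c \<odot>\<^bsub>G\<^esub> pure_tensor A S a"
  by (auto simp: pure_tensor_def envelope_simps)

lemma pure_eq_zero_iff: "pure_tensor A S a = \<zero>\<^bsub>G\<^esub> \<longleftrightarrow> a = \<zero>"
  by (auto simp: pure_tensor_def envelope_simps fun_eq_iff)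

lemma pure_mult:
  assumes a: "a \<in> carrier A" and b: "b \<in> carrier A"
  shows "pure_tensor A S a \<otimes>\<^bsub>G\<^esub> pure_tensor A T b =
    (if S |\<inter>| T = {||} then pure_tensor A (S |\<union>| T) (grassmann_sign S T \<odot> (a \<otimes> b)) else \<zero>\<^bsub>G\<^esub>)"
proof
  fix U
  let ?t = "\<lambda>R. grassmann_sign R (U |-| R) \<odot> (pure_tensor A S a R \<otimes> pure_tensor A T b (U |-| R))"
  have eq: "(pure_tensor A S a \<otimes>\<^bsub>G\<^esub> pure_tensor A T b) U = (\<Oplus>R\<in>{R. R |\<subseteq>| U}. ?t R)"
    by (simp add: envelope_simps)
  show "(pure_tensor A S a \<otimes>\<^bsub>G\<^esub> pure_tensor A T b) U =
    (if S |\<inter>| T = {||} then pure_tensor A (S |\<union>| T) (grassmann_sign S T \<odot> (a \<otimes> b)) else \<zero>\<^bsub>G\<^esub>) U"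
  proof (cases "S |\<inter>| T = {||} \<and> U = S |\<union>| T")
    case True
    then have UT: "U |-| S = T" by auto
    have "(\<Oplus>R\<in>{R. R |\<subseteq>| U}. ?t R) = ?t S"
      by (rule finsum_one) (use True a b in \<open>auto simp: pure_tensor_def mult_closed\<close>)
    then show ?thesis using True eq UT by (simp add: pure_tensor_def)
  next
    case False
    have "(\<Oplus>R\<in>{R. R |\<subseteq>| U}. ?t R) = \<zero>"
    proof (rule finsum_all_zero)
      fix R assume "R \<in> {R. R |\<subseteq>| U}"
      then have "R \<noteq> S \<or> U |-| R \<noteq> T" using False by auto
      then show "?t R = \<zero>" using a b by (auto simp: pure_tensor_def)
    qed
    then show ?thesis using False eq by (auto simp: pure_tensor_def envelope_simps)
  qed
qed

lemma envelope_induct [consumes 1, case_names zero add]: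
  assumes "g \<in> carrier G"
    and "P \<zero>\<^bsub>G\<^esub>"
    and "\<And>S a h. \<lbrakk>a \<in> grade A (of_nat (fcard S)); h \<in> carrier G; P h\<rbrakk> \<Longrightarrow> P (pure_tensor A S a \<oplus>\<^bsub>G\<^esub> h)"
  shows "P g"
proof -
  have fin: "finite {S. g S \<noteq> \<zero>}" using assms(1) by (simp add: envelope_simps)
  have "\<forall>g \<in> carrier G. {S. g S \<noteq> \<zero>} = X \<longrightarrow> P g" if "finite X" for X
    using that
  proof (induct X)
    case empty
    have "g = \<zero>\<^bsub>G\<^esub>" if "{S. g S \<noteq> \<zero>} = {}" for g
      using that by (auto simp: envelope_simps)
    then show ?case using assms(2) by auto
  next
    case (insert S X)
    show ?case
    proof (intro ballI impI)
      fix g assume g: "g \<in> carrier G" "{T. g T \<noteq> \<zero>} = insert S X"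
      let ?h = "g(S := \<zero>)"
      have supp: "{T. ?h T \<noteq> \<zero>} = X" using g(2) insert(2) by auto
      have h: "?h \<in> carrier G" using g(1) supp insert(1) by (simp add: envelope_simps(1))
      have "g = pure_tensor A S (g S) \<oplus>\<^bsub>G\<^esub> ?h"
        using envelope_coord[OF g(1)] by (auto simp: pure_tensor_def envelope_simps)
      then show "P g"
        using assms(3)[OF envelope_coord_grade[OF g(1), of S] h] insert(3) h supp by metis
    qed
  qed
  then show ?thesis using assms(1) fin by blast
qed

text \<open>Pure tensors span the envelope, so a multilinear identity of the envelope can be verified on them
  by applying this rule to one argument after the other.\<close>

lemma envelope_additive_zero:
  assumes "g \<in> carrier G" "F \<zero>\<^bsub>G\<^esub> = \<zero>\<^bsub>G\<^esub>"
    and "\<And>x y. \<lbrakk>x \<in> carrier G; y \<in> carrier G\<rbrakk> \<Longrightarrow> F (x \<oplus>\<^bsub>G\<^esub> y) = F x \<oplus>\<^bsub>G\<^esub> F y"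
    and "\<And>S a. a \<in> grade A (of_nat (fcard S)) \<Longrightarrow> F (pure_tensor A S a) = \<zero>\<^bsub>G\<^esub>"
  shows "F g = \<zero>\<^bsub>G\<^esub>"
proof -
  interpret G: nonassoc_algebra G by (rule envelope_nonassoc_algebra)
  show ?thesis using assms(1) by (induct rule: envelope_induct) (simp_all add: assms(2-4))
qed

end

section \<open>Superidentities and the envelope\<close>

text \<open>The sign \<open>(-1)\<^sup>i\<^sup>j\<close> for exchanging neighbours of parities \<open>i\<close> and \<open>j\<close>.\<close>

definition koszul_factor :: "bit \<Rightarrow> bit \<Rightarrow> 'f::field_char_0" where
  "koszul_factor i j = (if i = 1 \<and> j = 1 then - 1 else 1)"

lemma of_nat_bit_eq_1: "(of_nat n :: bit) = 1 \<longleftrightarrow> odd n"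
  by (induct n) auto

lemma koszul_factor_of_nat: "(- 1) ^ (m * n) = koszul_factor (of_nat m) (of_nat n)"
  by (auto simp: koszul_factor_def of_nat_bit_eq_1)

lemma koszul_factor_square [simp]:
  "koszul_factor i j * koszul_factor i j = 1"
  "koszul_factor i j * (koszul_factor i j * x) = x"
  by (simp_all add: koszul_factor_def)

lemma fcard_singleton [simp]: "fcard {||} = 0" "fcard {|x|} = 1"
  by (simp_all add: fcard.rep_eq)

context superalgebra
begin

lemma pure_mult_chain:
  assumes "a \<in> carrier A" "b \<in> carrier A" "c \<in> carrier A" "d \<in> carrier A"
  shows "((pure_tensor A S1 a \<otimes>\<^bsub>G\<^esub> pure_tensor A S2 b) \<otimes>\<^bsub>G\<^esub> pure_tensor A T c) \<otimes>\<^bsub>G\<^esub> pure_tensor A S3 d =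
    (if S1 |\<inter>| S2 = {||} \<and> S1 |\<inter>| T = {||} \<and> S2 |\<inter>| T = {||} \<and> S1 |\<inter>| S3 = {||} \<and>
        S2 |\<inter>| S3 = {||} \<and> T |\<inter>| S3 = {||}
     then pure_tensor A (S1 |\<union>| S2 |\<union>| T |\<union>| S3)
       ((grassmann_sign S1 S2 * grassmann_sign S1 T * grassmann_sign S2 T *
         grassmann_sign S1 S3 * grassmann_sign S2 S3 * grassmann_sign T S3) \<odot> (((a \<otimes> b) \<otimes> c) \<otimes> d))
     else \<zero>\<^bsub>G\<^esub>)"
proof -
  interpret G: nonassoc_algebra G by (rule envelope_nonassoc_algebra)
  have d1: "(S1 |\<union>| S2) |\<inter>| T = {||} \<longleftrightarrow> S1 |\<inter>| T = {||} \<and> S2 |\<inter>| T = {||}"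
    and d2: "(S1 |\<union>| S2 |\<union>| T) |\<inter>| S3 = {||} \<longleftrightarrow> S1 |\<inter>| S3 = {||} \<and> S2 |\<inter>| S3 = {||} \<and> T |\<inter>| S3 = {||}"
    by auto
  have z: "\<zero>\<^bsub>G\<^esub> \<otimes>\<^bsub>G\<^esub> pure_tensor A R x = \<zero>\<^bsub>G\<^esub>" if "x \<in> carrier A" for R x
    using pure_mult[of \<zero> x R R] pure_mult[of \<zero> x "{||}" R] that by (simp add: pure_zero)
  show ?thesis
  proof (cases "S1 |\<inter>| S2 = {||} \<and> S1 |\<inter>| T = {||} \<and> S2 |\<inter>| T = {||}")
    case True
    then show ?thesis using assms
      by (auto simp: pure_mult mult_closed d1 d2 z smult_mult_left smult_smult
          grassmann_sign_union_left mult_ac)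
  next
    case False
    then show ?thesis using assms by (auto simp: pure_mult mult_closed d1 z)
  qed
qed

text \<open>The hypotheses are the superizations of commutativity, of \<open>(x y) (z t) = 0\<close>, and of the linearized
  Jordan identity. The latter has only three terms, because in \<open>(x\<^sup>2 y) x - x\<^sup>2 (y x)\<close> the second summand is a
  product of products. Putting \<open>x\<^sub>1 = x\<^sub>2 = x\<^sub>3\<close> gives back three times the Jordan identity. On pure
  tensors each rearranged word acquires the signs of the transposed Grassmann factors, and these are the
  coefficients below.\<close>

lemma envelope_jordan_metabelianI:
  assumes comm: "\<And>i j x y. \<lbrakk>x \<in> grade A i; y \<in> grade A j\<rbrakk> \<Longrightarrow> y \<otimes> x = koszul_factor i j \<odot> (x \<otimes> y)"
    and metab: "\<And>i j k l x y z t. \<lbrakk>x \<in> grade A i; y \<in> grade A j; z \<in> grade A k; t \<in> grade A l\<rbrakk>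
      \<Longrightarrow> (x \<otimes> y) \<otimes> (z \<otimes> t) = \<zero>"
    and jord: "\<And>i1 i2 i3 j x1 x2 x3 y.
      \<lbrakk>x1 \<in> grade A i1; x2 \<in> grade A i2; x3 \<in> grade A i3; y \<in> grade A j\<rbrakk> \<Longrightarrow>
      ((x1 \<otimes> x2) \<otimes> y) \<otimes> x3
      \<oplus> (koszul_factor i2 i3 * koszul_factor j i3 * koszul_factor i2 j) \<odot> (((x1 \<otimes> x3) \<otimes> y) \<otimes> x2)
      \<oplus> (koszul_factor i1 i2 * koszul_factor i1 j * koszul_factor i1 i3 * koszul_factor j i3)
          \<odot> (((x2 \<otimes> x3) \<otimes> y) \<otimes> x1) = \<zero>"
  shows "jordan_metabelian G"
proof -
  interpret G: nonassoc_algebra G by (rule envelope_nonassoc_algebra)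
  note gc = grade_carrier
  note Gc = G.mult_closed G.M.a_closed G.M.zero_closed
  have comm_G: "x \<otimes>\<^bsub>G\<^esub> y = y \<otimes>\<^bsub>G\<^esub> x" if "x \<in> carrier G" "y \<in> carrier G" for x y
    using that
  proof (induct x rule: envelope_induct)
    case (add S a h)
    from add(4) have "pure_tensor A S a \<otimes>\<^bsub>G\<^esub> y = y \<otimes>\<^bsub>G\<^esub> pure_tensor A S a"
    proof (induct y rule: envelope_induct)
      case (add T b k)
      have "pure_tensor A S a \<otimes>\<^bsub>G\<^esub> pure_tensor A T b = pure_tensor A T b \<otimes>\<^bsub>G\<^esub> pure_tensor A S a"
      proof (cases "S |\<inter>| T = {||}")
        case True
        have "b \<otimes> a = koszul_factor (of_nat (fcard S)) (of_nat (fcard T)) \<odot> (a \<otimes> b)"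
          by (rule comm) fact+
        then show ?thesis
          using True \<open>a \<in> grade A (of_nat (fcard S))\<close> add(1)
          by (auto simp: pure_mult gc Int_commute inf_commute sup_commute grassmann_sign_swap[OF True]
              koszul_factor_of_nat smult_smult mult_closed mult_ac)
      next
        case False
        then show ?thesis using \<open>a \<in> grade A (of_nat (fcard S))\<close> add(1)
          by (auto simp: pure_mult gc inf_commute)
      qed
      then show ?case using add \<open>a \<in> grade A (of_nat (fcard S))\<close>
        by (simp add: G.distrib_left G.distrib_right)
    qed (use add in simp)
    then show ?case using add by (simp add: G.distrib_left G.distrib_right)
  qed simp
  have metab_pure: "(pure_tensor A S a \<otimes>\<^bsub>G\<^esub> pure_tensor A T b) \<otimes>\<^bsub>G\<^esub> (pure_tensor A P c \<otimes>\<^bsub>G\<^esub> pure_tensor A R d) = \<zero>\<^bsub>G\<^esub>"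
    if "a \<in> grade A (of_nat (fcard S))" "b \<in> grade A (of_nat (fcard T))"
      "c \<in> grade A (of_nat (fcard P))" "d \<in> grade A (of_nat (fcard R))" for S T P R a b c d
  proof -
    have cc: "a \<in> carrier A" "b \<in> carrier A" "c \<in> carrier A" "d \<in> carrier A" using that gc by auto
    have z: "(a \<otimes> b) \<otimes> (c \<otimes> d) = \<zero>" by (rule metab) fact+
    have m: "pure_tensor A S a \<otimes>\<^bsub>G\<^esub> pure_tensor A T b \<in> carrier G"
      "pure_tensor A P c \<otimes>\<^bsub>G\<^esub> pure_tensor A R d \<in> carrier G"
      using that by (auto intro: G.mult_closed)
    show ?thesis
    proof (cases "S |\<inter>| T = {||} \<and> P |\<inter>| R = {||}")
      case True
      then show ?thesis using cc z
        by (simp add: pure_mult mult_closed smult_mult_left smult_mult_right)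
    next
      case False
      then show ?thesis using m cc
        by (auto simp: pure_mult[of a b] pure_mult[of c d])
    qed
  qed
  have metab_G: "(x \<otimes>\<^bsub>G\<^esub> y) \<otimes>\<^bsub>G\<^esub> (z \<otimes>\<^bsub>G\<^esub> t) = \<zero>\<^bsub>G\<^esub>"
    if "x \<in> carrier G" "y \<in> carrier G" "z \<in> carrier G" "t \<in> carrier G" for x y z t
  proof (rule envelope_additive_zero[OF that(1), where F = "\<lambda>x. (x \<otimes>\<^bsub>G\<^esub> y) \<otimes>\<^bsub>G\<^esub> (z \<otimes>\<^bsub>G\<^esub> t)"])
    fix S :: "nat fset" and a assume a: "a \<in> grade A (of_nat (fcard S))"
    show "(pure_tensor A S a \<otimes>\<^bsub>G\<^esub> y) \<otimes>\<^bsub>G\<^esub> (z \<otimes>\<^bsub>G\<^esub> t) = \<zero>\<^bsub>G\<^esub>"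
    proof (rule envelope_additive_zero[OF that(2), where F = "\<lambda>y. (_ \<otimes>\<^bsub>G\<^esub> y) \<otimes>\<^bsub>G\<^esub> (z \<otimes>\<^bsub>G\<^esub> t)"])
      fix T :: "nat fset" and b assume b: "b \<in> grade A (of_nat (fcard T))"
      show "(pure_tensor A S a \<otimes>\<^bsub>G\<^esub> pure_tensor A T b) \<otimes>\<^bsub>G\<^esub> (z \<otimes>\<^bsub>G\<^esub> t) = \<zero>\<^bsub>G\<^esub>"
      proof (rule envelope_additive_zero[OF that(3), where F = "\<lambda>z. _ \<otimes>\<^bsub>G\<^esub> (z \<otimes>\<^bsub>G\<^esub> t)"])
        fix P :: "nat fset" and c assume c: "c \<in> grade A (of_nat (fcard P))"
        show "(pure_tensor A S a \<otimes>\<^bsub>G\<^esub> pure_tensor A T b) \<otimes>\<^bsub>G\<^esub> (pure_tensor A P c \<otimes>\<^bsub>G\<^esub> t) = \<zero>\<^bsub>G\<^esub>"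
          by (rule envelope_additive_zero[OF that(4), where F = "\<lambda>t. _ \<otimes>\<^bsub>G\<^esub> (_ \<otimes>\<^bsub>G\<^esub> t)"])
            (use a b c metab_pure in \<open>simp_all add: G.distrib_left Gc\<close>)
      qed (use a b that in \<open>simp_all add: G.distrib_left G.distrib_right Gc\<close>)
    qed (use a that in \<open>simp_all add: G.distrib_left G.distrib_right Gc\<close>)
  qed (use that in \<open>simp_all add: G.distrib_right Gc\<close>)
  define L where "L x1 x2 x3 y = ((x1 \<otimes>\<^bsub>G\<^esub> x2) \<otimes>\<^bsub>G\<^esub> y) \<otimes>\<^bsub>G\<^esub> x3 \<oplus>\<^bsub>G\<^esub> ((x1 \<otimes>\<^bsub>G\<^esub> x3) \<otimes>\<^bsub>G\<^esub> y) \<otimes>\<^bsub>G\<^esub> x2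
    \<oplus>\<^bsub>G\<^esub> ((x2 \<otimes>\<^bsub>G\<^esub> x3) \<otimes>\<^bsub>G\<^esub> y) \<otimes>\<^bsub>G\<^esub> x1" for x1 x2 x3 y
  have L_pure: "L (pure_tensor A S1 a) (pure_tensor A S2 b) (pure_tensor A S3 d) (pure_tensor A T c) = \<zero>\<^bsub>G\<^esub>"
    if h: "a \<in> grade A (of_nat (fcard S1))" "b \<in> grade A (of_nat (fcard S2))"
      "d \<in> grade A (of_nat (fcard S3))" "c \<in> grade A (of_nat (fcard T))" for S1 S2 S3 T a b c d
  proof -
    have cc: "a \<in> carrier A" "b \<in> carrier A" "c \<in> carrier A" "d \<in> carrier A" using h gc by auto
    show ?thesis
    proof (cases "S1 |\<inter>| S2 = {||} \<and> S1 |\<inter>| T = {||} \<and> S2 |\<inter>| T = {||} \<and> S1 |\<inter>| S3 = {||} \<and>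
        S2 |\<inter>| S3 = {||} \<and> T |\<inter>| S3 = {||}")
      case True
      let ?k = "\<lambda>S T. koszul_factor (of_nat (fcard S)) (of_nat (fcard T)) :: 'f"
      let ?s = "grassmann_sign S1 S2 * grassmann_sign S1 T * grassmann_sign S2 T *
         grassmann_sign S1 S3 * grassmann_sign S2 S3 * grassmann_sign T S3 :: 'f"
      have swap: "grassmann_sign S3 T = ?k T S3 * grassmann_sign T S3"
         "grassmann_sign S3 S2 = ?k S2 S3 * grassmann_sign S2 S3"
         "grassmann_sign T S2 = ?k S2 T * grassmann_sign S2 T"
         "grassmann_sign S2 S1 = ?k S1 S2 * grassmann_sign S1 S2"
         "grassmann_sign S3 S1 = ?k S1 S3 * grassmann_sign S1 S3"
         "grassmann_sign T S1 = ?k S1 T * grassmann_sign S1 T"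
        using True by (auto simp: grassmann_sign_swap koszul_factor_of_nat)
      let ?U = "S1 |\<union>| S2 |\<union>| T |\<union>| S3"
      have U: "S1 |\<union>| S3 |\<union>| T |\<union>| S2 = ?U" "S2 |\<union>| S3 |\<union>| T |\<union>| S1 = ?U" by auto
      have D: "S3 |\<inter>| S2 = {||}" "T |\<inter>| S2 = {||}" "T |\<inter>| S1 = {||}" "S3 |\<inter>| T = {||}"
        "S3 |\<inter>| S1 = {||}" "S2 |\<inter>| S1 = {||}" using True by auto
      have t1: "((pure_tensor A S1 a \<otimes>\<^bsub>G\<^esub> pure_tensor A S2 b) \<otimes>\<^bsub>G\<^esub> pure_tensor A T c) \<otimes>\<^bsub>G\<^esub> pure_tensor A S3 d
        = pure_tensor A ?U (?s \<odot> (((a \<otimes> b) \<otimes> c) \<otimes> d))"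
        using True cc by (simp add: pure_mult_chain)
      have t2: "((pure_tensor A S1 a \<otimes>\<^bsub>G\<^esub> pure_tensor A S3 d) \<otimes>\<^bsub>G\<^esub> pure_tensor A T c) \<otimes>\<^bsub>G\<^esub> pure_tensor A S2 b
        = pure_tensor A ?U (?s \<odot> ((?k S2 S3 * ?k T S3 * ?k S2 T) \<odot> (((a \<otimes> d) \<otimes> c) \<otimes> b)))"
        using True D cc by (simp add: pure_mult_chain U swap smult_smult mult_closed mult_ac)
      have t3: "((pure_tensor A S2 b \<otimes>\<^bsub>G\<^esub> pure_tensor A S3 d) \<otimes>\<^bsub>G\<^esub> pure_tensor A T c) \<otimes>\<^bsub>G\<^esub> pure_tensor A S1 a
        = pure_tensor A ?U (?s \<odot> ((?k S1 S2 * ?k S1 T * ?k S1 S3 * ?k T S3) \<odot> (((b \<otimes> d) \<otimes> c) \<otimes> a)))"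
        using True D cc by (simp add: pure_mult_chain U swap smult_smult mult_closed mult_ac)
      show ?thesis
        unfolding L_def t1 t2 t3
        using cc jord[OF h]
        by (simp add: pure_add[symmetric] mult_closed smult_add_right[symmetric] del: pure_zero)
           (simp add: pure_zero)
    next
      case False
      then have "L (pure_tensor A S1 a) (pure_tensor A S2 b) (pure_tensor A S3 d) (pure_tensor A T c)
        = \<zero>\<^bsub>G\<^esub> \<oplus>\<^bsub>G\<^esub> \<zero>\<^bsub>G\<^esub> \<oplus>\<^bsub>G\<^esub> \<zero>\<^bsub>G\<^esub>"
        unfolding L_def using cc
        by (intro arg_cong2[where f = "add G"]) (auto simp: pure_mult_chain inf_commute)
      then show ?thesis by simp
    qed
  qed
  have L0: "L x1 x2 x3 y = \<zero>\<^bsub>G\<^esub>" if "x1 \<in> carrier G" "x2 \<in> carrier G" "x3 \<in> carrier G" "y \<in> carrier G" for x1 x2 x3 y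
  proof -
    have Ladd: "L (a \<oplus>\<^bsub>G\<^esub> a') b c d = L a b c d \<oplus>\<^bsub>G\<^esub> L a' b c d"
      "L b (a \<oplus>\<^bsub>G\<^esub> a') c d = L b a c d \<oplus>\<^bsub>G\<^esub> L b a' c d"
      "L b c (a \<oplus>\<^bsub>G\<^esub> a') d = L b c a d \<oplus>\<^bsub>G\<^esub> L b c a' d"
      "L b c d (a \<oplus>\<^bsub>G\<^esub> a') = L b c d a \<oplus>\<^bsub>G\<^esub> L b c d a'"
      if "a \<in> carrier G" "a' \<in> carrier G" "b \<in> carrier G" "c \<in> carrier G" "d \<in> carrier G" for a a' b c d
      unfolding L_def using that by (simp_all add: G.distrib_left G.distrib_right Gc G.M.a_ac)
    have Lz: "L \<zero>\<^bsub>G\<^esub> b c d = \<zero>\<^bsub>G\<^esub>" "L b \<zero>\<^bsub>G\<^esub> c d = \<zero>\<^bsub>G\<^esub>" "L b c \<zero>\<^bsub>G\<^esub> d = \<zero>\<^bsub>G\<^esub>" "L b c d \<zero>\<^bsub>G\<^esub> = \<zero>\<^bsub>G\<^esub>"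
      if "b \<in> carrier G" "c \<in> carrier G" "d \<in> carrier G" for b c d
      unfolding L_def using that by (simp_all add: Gc)
    show ?thesis
    proof (rule envelope_additive_zero[OF that(1), where F = "\<lambda>x1. L x1 x2 x3 y"])
      fix S1 :: "nat fset" and a assume a: "a \<in> grade A (of_nat (fcard S1))"
      show "L (pure_tensor A S1 a) x2 x3 y = \<zero>\<^bsub>G\<^esub>"
      proof (rule envelope_additive_zero[OF that(2), where F = "\<lambda>x2. L _ x2 x3 y"])
        fix S2 :: "nat fset" and b assume b: "b \<in> grade A (of_nat (fcard S2))"
        show "L (pure_tensor A S1 a) (pure_tensor A S2 b) x3 y = \<zero>\<^bsub>G\<^esub>"
        proof (rule envelope_additive_zero[OF that(3), where F = "\<lambda>x3. L _ _ x3 y"])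
          fix S3 :: "nat fset" and d assume d: "d \<in> grade A (of_nat (fcard S3))"
          show "L (pure_tensor A S1 a) (pure_tensor A S2 b) (pure_tensor A S3 d) y = \<zero>\<^bsub>G\<^esub>"
            by (rule envelope_additive_zero[OF that(4), where F = "\<lambda>y. L _ _ _ y"])
              (use a b d L_pure in \<open>simp_all add: Ladd Lz\<close>)
        qed (use a b that in \<open>simp_all add: Ladd Lz\<close>)
      qed (use a that in \<open>simp_all add: Ladd Lz\<close>)
    qed (use that in \<open>simp_all add: Ladd Lz\<close>)
  qed
  show ?thesis
  proof (intro jordan_metabelian.intro jordan_metabelian_axioms.intro envelope_nonassoc_algebra)
    fix x y assume xy: "x \<in> carrier G" "y \<in> carrier G"
    show "x \<otimes>\<^bsub>G\<^esub> y = y \<otimes>\<^bsub>G\<^esub> x" using xy by (rule comm_G)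
    let ?t = "((x \<otimes>\<^bsub>G\<^esub> x) \<otimes>\<^bsub>G\<^esub> y) \<otimes>\<^bsub>G\<^esub> x"
    have tc: "?t \<in> carrier G" using xy by (simp add: Gc)
    have "?t \<oplus>\<^bsub>G\<^esub> ?t \<oplus>\<^bsub>G\<^esub> ?t = 3 \<odot>\<^bsub>G\<^esub> ?t"
      using G.smult_add_left[OF tc, of 2 1] tc by (simp add: G.double)
    then have "3 \<odot>\<^bsub>G\<^esub> ?t = \<zero>\<^bsub>G\<^esub>" using L0[of x x x y] xy by (simp add: L_def)
    then have "?t = \<zero>\<^bsub>G\<^esub>" using G.smult_eq_zero[OF tc] by simp
    then show "associator G (x \<otimes>\<^bsub>G\<^esub> x) y x = \<zero>\<^bsub>G\<^esub>"
      using xy by (simp add: associator_def metab_G a_minus_def)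
  qed (rule metab_G)
qed

text \<open>Attaching a different Grassmann generator to each odd element makes the product of the pure tensors a
  nonzero multiple of a pure tensor, so nothing is lost in passing to the envelope.\<close>

lemma metabelian_if_envelope:
  assumes "jordan_metabelian G" "x \<in> grade A i" "y \<in> grade A j" "z \<in> grade A k" "t \<in> grade A l"
  shows "(x \<otimes> y) \<otimes> (z \<otimes> t) = \<zero>"
proof -
  interpret G: jordan_metabelian G by fact
  define s where "s n m = (if m = (1::bit) then {|n|} else {||})" for n :: nat and m
  have par: "of_nat (fcard (s n m)) = m" for n m by (simp add: s_def)
  have cc: "x \<in> carrier A" "y \<in> carrier A" "z \<in> carrier A" "t \<in> carrier A"
    using assms grade_carrier by auto
  have dis: "s 0 i |\<inter>| s 1 j = {||}" "s 2 k |\<inter>| s 3 l = {||}"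
    "(s 0 i |\<union>| s 1 j) |\<inter>| (s 2 k |\<union>| s 3 l) = {||}" by (auto simp: s_def)
  let ?c = "grassmann_sign (s 0 i) (s 1 j) * grassmann_sign (s 2 k) (s 3 l) *
    grassmann_sign (s 0 i |\<union>| s 1 j) (s 2 k |\<union>| s 3 l) :: 'f"
  have "(pure_tensor A (s 0 i) x \<otimes>\<^bsub>G\<^esub> pure_tensor A (s 1 j) y) \<otimes>\<^bsub>G\<^esub>
      (pure_tensor A (s 2 k) z \<otimes>\<^bsub>G\<^esub> pure_tensor A (s 3 l) t) = \<zero>\<^bsub>G\<^esub>"
    using assms by (intro G.metabelian) (auto simp: par)
  then have "pure_tensor A ((s 0 i |\<union>| s 1 j) |\<union>| (s 2 k |\<union>| s 3 l)) (?c \<odot> ((x \<otimes> y) \<otimes> (z \<otimes> t))) = \<zero>\<^bsub>G\<^esub>"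
    using cc dis by (simp add: pure_mult mult_closed smult_mult_left smult_mult_right smult_smult mult_ac)
  then have "?c \<odot> ((x \<otimes> y) \<otimes> (z \<otimes> t)) = \<zero>" by (simp add: pure_eq_zero_iff)
  then show ?thesis
    by (rule smult_eq_zero[rotated]) (use cc in \<open>auto simp: mult_closed grassmann_sign_def\<close>)
qed

end

section \<open>Superization as evaluation in the envelope\<close>

text \<open>A homogeneous value of the variable \<open>v\<close> is put into the envelope by attaching \<open>e\<^sub>v\<close> to it if it is odd and
  \<open>1\<close> if it is even. A product over the list \<open>vs\<close> then carries the Grassmann generators in \<open>odd_vars p vs\<close>.\<close>

definition odd_vars :: "(nat \<Rightarrow> bit) \<Rightarrow> nat list \<Rightarrow> nat fset" where
  "odd_vars p vs = fset_of_list (filter (\<lambda>v. p v = 1) vs)"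

lemma odd_vars_simps [simp]:
  "odd_vars p [] = {||}"
  "odd_vars p (us @ vs) = odd_vars p us |\<union>| odd_vars p vs"
  "v |\<in>| odd_vars p vs \<longleftrightarrow> v \<in> set vs \<and> p v = 1"
  by (auto simp: odd_vars_def fset_of_list_elem)

lemma odd_vars_Cons: "odd_vars p (v # vs) = odd_vars p [v] |\<union>| odd_vars p vs"
  by auto

lemma odd_vars_disjoint: "set us \<inter> set vs = {} \<Longrightarrow> odd_vars p us |\<inter>| odd_vars p vs = {||}"
  by auto

lemma koszul_sign_Cons:
  assumes "distinct (v # vs)"
  shows "koszul_sign p (v # vs) =
    (grassmann_sign (odd_vars p [v]) (odd_vars p vs) * koszul_sign p vs :: 'f::field_char_0)"
proof -
  let ?P = "\<lambda>vs. {(k, l). k < l \<and> l < length vs \<and> vs ! l < vs ! k \<and> p (vs ! k) * p (vs ! l) = 1}"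
  let ?H = "{l. l < length vs \<and> vs ! l < v \<and> p v * p (vs ! l) = 1}"
  have fin: "finite (?P us)" for us :: "nat list"
    by (rule finite_subset[of _ "{..<length us} \<times> {..<length us}"]) auto
  have split: "?P (v # vs) = (\<lambda>l. (0, Suc l)) ` ?H \<union> map_prod Suc Suc ` ?P vs"
  proof (intro equalityI subsetI)
    fix x assume "x \<in> ?P (v # vs)"
    then obtain k l where x: "x = (k, l)" "k < l" "l < Suc (length vs)"
      "(v # vs) ! l < (v # vs) ! k" "p ((v # vs) ! k) * p ((v # vs) ! l) = 1" by auto
    then obtain l' where l: "l = Suc l'" by (cases l) auto
    show "x \<in> (\<lambda>l. (0, Suc l)) ` ?H \<union> map_prod Suc Suc ` ?P vs"
    proof (cases k)
      case 0 then show ?thesis using x l by auto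
    next
      case (Suc k')
      then have "(k', l') \<in> ?P vs" using x l by simp
      then show ?thesis using x l Suc by (intro UnI2 image_eqI[of _ _ "(k', l')"]) auto
    qed
  qed auto
  have H: "card ?H = card {(i, j). i |\<in>| odd_vars p [v] \<and> j |\<in>| odd_vars p vs \<and> j < i}"
  proof (rule bij_betw_same_card[of "\<lambda>l. (v, vs ! l)"])
    show "bij_betw (\<lambda>l. (v, vs ! l)) ?H {(i, j). i |\<in>| odd_vars p [v] \<and> j |\<in>| odd_vars p vs \<and> j < i}"
      unfolding bij_betw_def
    proof
      show "inj_on (\<lambda>l. (v, vs ! l)) ?H" using assms by (auto simp: inj_on_def nth_eq_iff_index_eq)
      show "(\<lambda>l. (v, vs ! l)) ` ?H = {(i, j). i |\<in>| odd_vars p [v] \<and> j |\<in>| odd_vars p vs \<and> j < i}"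
        by (auto simp: in_set_conv_nth image_iff)
    qed
  qed
  have "card (?P (v # vs)) = card ((\<lambda>l. (0::nat, Suc l)) ` ?H) + card (map_prod Suc Suc ` ?P vs)"
    unfolding split using fin[of vs] by (intro card_Un_disjoint finite_imageI) auto
  also have "card ((\<lambda>l. (0::nat, Suc l)) ` ?H) = card ?H" by (rule card_image) (auto simp: inj_on_def)
  also have "card (map_prod Suc Suc ` ?P vs) = card (?P vs)"
    by (rule card_image) (auto simp: inj_on_def)
  finally show ?thesis unfolding koszul_sign_def grassmann_sign_def H by (simp add: power_add)
qed

text \<open>The Koszul sign of a list is the sign of sorting the product of the Grassmann generators attached to its
  odd entries. For a product of two sorted factors this is the structure constant of the Grassmann algebra.\<close>

lemma koszul_sign_append:
  assumes "distinct (us @ vs)"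
  shows "koszul_sign p (us @ vs) = (koszul_sign p us * koszul_sign p vs *
    grassmann_sign (odd_vars p us) (odd_vars p vs) :: 'f::field_char_0)"
  using assms
proof (induct us)
  case Nil show ?case by (simp add: koszul_sign_def)
next
  case (Cons u us)
  have d: "odd_vars p [u] |\<inter>| odd_vars p us = {||}" "odd_vars p us |\<inter>| odd_vars p vs = {||}"
    using Cons(2) by (auto intro!: odd_vars_disjoint)
  have "koszul_sign p (u # us @ vs) =
      grassmann_sign (odd_vars p [u]) (odd_vars p us |\<union>| odd_vars p vs) * (koszul_sign p (us @ vs) :: 'f)"
    using koszul_sign_Cons[of u "us @ vs" p, where 'f='f] Cons(2) by simp
  also have "\<dots> = grassmann_sign (odd_vars p [u]) (odd_vars p us) * grassmann_sign (odd_vars p [u]) (odd_vars p vs)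
      * (koszul_sign p us * koszul_sign p vs * grassmann_sign (odd_vars p us) (odd_vars p vs))"
    using Cons d by (simp add: grassmann_sign_union_right)
  also have "\<dots> = koszul_sign p (u # us) * koszul_sign p vs *
      (grassmann_sign (odd_vars p [u]) (odd_vars p vs) * grassmann_sign (odd_vars p us) (odd_vars p vs))"
    using koszul_sign_Cons[of u us p, where 'f='f] Cons(2) by simp
  finally show ?case
    using d(1) by (simp add: odd_vars_Cons[of p u us] grassmann_sign_union_left mult_ac)
qed

lemma koszul_sign_neq_0 [simp]: "koszul_sign p vs \<noteq> (0 :: 'f::field_char_0)"
  by (simp add: koszul_sign_def)

lemma superization_support: "superization p f w \<noteq> 0 \<longleftrightarrow> f w \<noteq> 0"
  by (simp add: superization_def)

lemma set_leaves [simp]: "set (leaves w) = vars w"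
  by (induct w) auto

context superalgebra
begin

lemma pure_odd_var_closed:
  "a v \<in> grade A (p v) \<Longrightarrow> pure_tensor A (odd_vars p [v]) (a v) \<in> carrier G"
  by (rule pure_closed) (cases "p v", auto simp: odd_vars_def)

lemma envelope_eval_monomial:
  assumes "distinct (leaves w)" "\<And>v. v \<in> vars w \<Longrightarrow> a v \<in> grade A (p v)"
  shows "eval_monomial G (\<lambda>v. pure_tensor A (odd_vars p [v]) (a v)) w =
    pure_tensor A (odd_vars p (leaves w)) (koszul_sign p (leaves w) \<odot> eval_monomial A a w)"
  using assms
proof (induct w)
  case (Var v)
  have "koszul_sign p [v] = (1::'f)" using koszul_sign_Cons[of v "[]" p] by (simp add: koszul_sign_def)
  then show ?case using Var grade_carrier by simp
next
  case (Mul u w)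
  have c: "eval_monomial A a u \<in> carrier A" "eval_monomial A a w \<in> carrier A"
    by (rule eval_monomial_closed, use Mul grade_carrier in auto)+
  have d: "odd_vars p (leaves u) |\<inter>| odd_vars p (leaves w) = {||}"
    using Mul(3) by (intro odd_vars_disjoint) auto
  show ?case
    using Mul c d koszul_sign_append[of "leaves u" "leaves w" p, where 'f='f]
    by (simp add: pure_mult smult_mult_left smult_mult_right smult_smult mult_closed mult_ac)
qed

lemma pure_finsum:
  assumes "h \<in> S \<rightarrow> grade A (of_nat (fcard U))"
  shows "pure_tensor A U (\<Oplus>i\<in>S. h i) = (\<Oplus>\<^bsub>G\<^esub>i\<in>S. pure_tensor A U (h i))"
proof -
  interpret G: nonassoc_algebra G by (rule envelope_nonassoc_algebra)
  show ?thesis using assms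
  proof (induct S rule: infinite_finite_induct)
    case (insert x F)
    then have h: "h \<in> F \<rightarrow> grade A (of_nat (fcard U))" "h x \<in> grade A (of_nat (fcard U))" by auto
    then have hc: "h \<in> F \<rightarrow> carrier A" "h x \<in> carrier A" using grade_carrier by auto
    have p: "(\<lambda>i. pure_tensor A U (h i)) \<in> F \<rightarrow> carrier G"
      using h(1) by (intro funcsetI pure_closed) (rule funcset_mem)
    show ?case using insert h hc p by (simp add: pure_add finsum_closed)
  qed (auto simp: finsum_infinite G.finsum_infinite)
qed

text \<open>The monomials of a multilinear polynomial all involve the same Grassmann generators, so their values
  are coefficients of one and the same basis element; the superization collects the signs.\<close>

lemma envelope_eval_polynomial:
  assumes f: "multilinear n f" and a: "\<And>v. v < n \<Longrightarrow> a v \<in> grade A (p v)"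
  shows "eval_polynomial G (\<lambda>v. pure_tensor A (odd_vars p [v]) (a v)) f =
    pure_tensor A (odd_vars p [0..<n]) (eval_polynomial A a (superization p f))"
proof -
  interpret G: nonassoc_algebra G by (rule envelope_nonassoc_algebra)
  let ?g = "\<lambda>v. pure_tensor A (odd_vars p [v]) (a v)"
  let ?U = "odd_vars p [0..<n]"
  have w: "distinct (leaves w)" "vars w = {..<n}" "odd_vars p (leaves w) = ?U" if "f w \<noteq> 0" for w
    using f that unfolding multilinear_def by (auto simp del: odd_vars_simps(2))
  have supp: "{w. superization p f w \<noteq> 0} = {w. f w \<noteq> 0}" by (simp add: superization_support)
  have ev: "eval_monomial G ?g w = pure_tensor A ?U (koszul_sign p (leaves w) \<odot> eval_monomial A a w)"
    if "f w \<noteq> 0" for w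
    using envelope_eval_monomial[of w a p] w[OF that] a by simp
  have ec: "eval_monomial A a w \<in> carrier A" if "f w \<noteq> 0" for w
    using w(2)[OF that] a grade_carrier by (intro eval_monomial_closed) auto
  have eg: "eval_monomial A a w \<in> grade A (of_nat (fcard ?U))" if "f w \<noteq> 0" for w
  proof -
    have "eval_monomial A a w \<in> grade A (of_nat (fcard (odd_vars p (leaves w))))"
      if "distinct (leaves w)" "vars w \<subseteq> {..<n}" for w
      using that
    proof (induct w)
      case (Var v)
      then show ?case using a[of v] by (cases "p v") (auto simp: odd_vars_def)
    next
      case (Mul u w)
      have d: "odd_vars p (leaves u) |\<inter>| odd_vars p (leaves w) = {||}"
        using Mul(3) by (intro odd_vars_disjoint) auto
      have "eval_monomial A a u \<otimes> eval_monomial A a w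
        \<in> grade A (of_nat (fcard (odd_vars p (leaves u))) + of_nat (fcard (odd_vars p (leaves w))))"
        using Mul by (intro grade_mult) auto
      then show ?case using fcard_funion_disjoint[OF d] by (simp only: of_nat_add[symmetric] eval_monomial.simps leaves.simps odd_vars_simps)
    qed
    then show ?thesis using w[OF that] by (metis order_refl)
  qed
  have "eval_polynomial G ?g f = (\<Oplus>\<^bsub>G\<^esub>w\<in>{w. f w \<noteq> 0}. pure_tensor A ?U (superization p f w \<odot> eval_monomial A a w))"
    unfolding eval_polynomial_def
  proof (rule G.M.add.finprod_cong')
    show "(\<lambda>w. pure_tensor A ?U (superization p f w \<odot> eval_monomial A a w)) \<in> {w. f w \<noteq> 0} \<rightarrow> carrier G"
      using eg by (auto intro!: pure_closed grade_smult)
    fix w assume "w \<in> {w. f w \<noteq> 0}"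
    then show "f w \<odot>\<^bsub>G\<^esub> eval_monomial G ?g w = pure_tensor A ?U (superization p f w \<odot> eval_monomial A a w)"
      using ev ec by (simp add: pure_smult[symmetric] smult_smult superization_def mult.commute)
  qed simp
  also have "\<dots> = pure_tensor A ?U (eval_polynomial A a (superization p f))"
    unfolding eval_polynomial_def supp
    by (rule pure_finsum[symmetric]) (use eg in \<open>auto intro: grade_smult\<close>)
  finally show ?thesis .
qed

lemma satisfies_superidentity_if_envelope:
  assumes f: "multilinear n f"
    and "\<And>a. (\<And>v. v < n \<Longrightarrow> a v \<in> carrier G) \<Longrightarrow> eval_polynomial G a f = \<zero>\<^bsub>G\<^esub>"
  shows "satisfies_superidentity A f"
  unfolding satisfies_superidentity_def
proof (intro allI impI)
  fix p :: "nat \<Rightarrow> bit" and a assume a: "\<forall>i. a i \<in> grade A (p i)"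
  have "eval_polynomial G (\<lambda>v. pure_tensor A (odd_vars p [v]) (a v)) f = \<zero>\<^bsub>G\<^esub>"
    by (rule assms(2)) (use a in \<open>auto intro: pure_odd_var_closed\<close>)
  then show "eval_polynomial A a (superization p f) = \<zero>"
    using envelope_eval_polynomial[OF f, of a p] a by (simp add: pure_eq_zero_iff)
qed

end

section \<open>Graded homomorphisms\<close>

definition graded_hom ::
  "('f::field_char_0, 'a, 'm) superalgebra_scheme \<Rightarrow> ('f, 'b, 'n) superalgebra_scheme \<Rightarrow> ('a \<Rightarrow> 'b) \<Rightarrow> bool" where
  "graded_hom A B h \<longleftrightarrow> algebra_hom A B h \<and> (\<forall>i. h ` grade A i \<subseteq> grade B i)"

lemma envelope_hom:
  assumes "superalgebra A" "superalgebra B" and h: "graded_hom A B h"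
  shows "algebra_hom (grassmann_envelope A) (grassmann_envelope B) (\<lambda>g S. h (g S))"
proof -
  interpret A: superalgebra A by fact
  interpret B: superalgebra B by fact
  have ah: "algebra_hom A B h" and gr: "\<And>i x. x \<in> grade A i \<Longrightarrow> h x \<in> grade B i"
    using h by (auto simp: graded_hom_def)
  note hom = algebra_homD[OF ah]
  have h0: "h \<zero>\<^bsub>A\<^esub> = \<zero>\<^bsub>B\<^esub>"
    by (rule algebra_hom_zero[OF _ _ ah]) unfold_locales
  have mult: "h (finsum A F S) = (\<Oplus>\<^bsub>B\<^esub>i\<in>S. h (F i))" if "F \<in> S \<rightarrow> carrier A" for F and S :: "nat fset set"
    by (rule algebra_hom_finsum[OF _ _ ah that]) unfold_locales
  show ?thesis
    unfolding algebra_hom_def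
  proof (intro conjI ballI allI funcsetI)
    fix g assume g: "g \<in> carrier A.G"
    have "{S. h (g S) \<noteq> \<zero>\<^bsub>B\<^esub>} \<subseteq> {S. g S \<noteq> \<zero>\<^bsub>A\<^esub>}" using h0 by auto
    then show "(\<lambda>S. h (g S)) \<in> carrier B.G"
      using g gr by (auto simp: envelope_simps intro: finite_subset)
    show "(\<lambda>S. h ((c \<odot>\<^bsub>A.G\<^esub> g) S)) = c \<odot>\<^bsub>B.G\<^esub> (\<lambda>S. h (g S))" for c
      using A.envelope_coord[OF g] by (simp add: envelope_simps hom)
    fix k assume k: "k \<in> carrier A.G"
    show "(\<lambda>S. h ((g \<oplus>\<^bsub>A.G\<^esub> k) S)) = (\<lambda>S. h (g S)) \<oplus>\<^bsub>B.G\<^esub> (\<lambda>S. h (k S))"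
      using A.envelope_coord[OF g] A.envelope_coord[OF k] by (simp add: envelope_simps hom)
    show "(\<lambda>S. h ((g \<otimes>\<^bsub>A.G\<^esub> k) S)) = (\<lambda>S. h (g S)) \<otimes>\<^bsub>B.G\<^esub> (\<lambda>S. h (k S))"
      using A.envelope_coord[OF g] A.envelope_coord[OF k]
      by (simp add: envelope_simps hom mult A.mult_closed Pi_def)
  qed
qed

lemma envelope_jordan_metabelian_embed:
  assumes "superalgebra A" "jordan_metabelian_superalgebra B" "graded_hom A B h" "inj_on h (carrier A)"
  shows "jordan_metabelian_superalgebra A"
proof -
  have B: "superalgebra B" "jordan_metabelian (grassmann_envelope B)"
    using assms(2) by (auto simp: jordan_metabelian_superalgebra_def)
  interpret A: superalgebra A by fact
  have "inj_on (\<lambda>g S. h (g S)) (carrier A.G)"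
  proof (rule inj_onI)
    fix g k assume gk: "g \<in> carrier A.G" "k \<in> carrier A.G" "(\<lambda>S. h (g S)) = (\<lambda>S. h (k S))"
    show "g = k"
    proof
      fix S
      have "h (g S) = h (k S)" using gk(3) by (rule fun_cong)
      then show "g S = k S" using inj_onD[OF assms(4)] A.envelope_coord gk by blast
    qed
  qed
  then have "jordan_metabelian A.G"
    by (rule jordan_metabelian_embed[OF A.envelope_nonassoc_algebra B(2) envelope_hom[OF assms(1) B(1) assms(3)]])
  then show ?thesis using assms(1) by (simp add: jordan_metabelian_superalgebra_def)
qed

section \<open>Identities of Jordan metabelian algebras\<close>

definition rmul :: "('a, 'm) ring_scheme \<Rightarrow> 'a \<Rightarrow> 'a list \<Rightarrow> 'a" where
  "rmul A w cs = foldl (monoid.mult A) w cs"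

lemma rmul_simps [simp]:
  "rmul A w [] = w" "rmul A w (c # cs) = rmul A (w \<otimes>\<^bsub>A\<^esub> c) cs"
  "rmul A w (cs @ ds) = rmul A (rmul A w cs) ds"
  by (simp_all add: rmul_def)

context nonassoc_algebra
begin

lemma rmul_closed: "\<lbrakk>w \<in> carrier A; set cs \<subseteq> carrier A\<rbrakk> \<Longrightarrow> rmul A w cs \<in> carrier A"
  by (induct cs arbitrary: w) (auto simp: mult_closed)

lemma rmul_zero: "set cs \<subseteq> carrier A \<Longrightarrow> rmul A \<zero> cs = \<zero>"
  by (induct cs) auto

lemma rmul_add: "\<lbrakk>w \<in> carrier A; w' \<in> carrier A; set cs \<subseteq> carrier A\<rbrakk>
    \<Longrightarrow> rmul A (w \<oplus> w') cs = rmul A w cs \<oplus> rmul A w' cs"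
  by (induct cs arbitrary: w w') (auto simp: mult_closed distrib_right)

lemma rmul_smult: "\<lbrakk>w \<in> carrier A; set cs \<subseteq> carrier A\<rbrakk> \<Longrightarrow> rmul A (k \<odot> w) cs = k \<odot> rmul A w cs"
  by (induct cs arbitrary: w) (auto simp: mult_closed smult_mult_left)

lemma rmul_minus: "\<lbrakk>w \<in> carrier A; set cs \<subseteq> carrier A\<rbrakk> \<Longrightarrow> rmul A (\<ominus> w) cs = \<ominus> rmul A w cs"
  by (simp add: minus_eq_smult rmul_smult rmul_closed)

lemma zero_if_eq_minus: "\<lbrakk>x \<in> carrier A; x = \<ominus> x\<rbrakk> \<Longrightarrow> x = \<zero>"
  using smult_eq_zero[of x 2] double[of x] M.r_neg[of x] by simp

inductive_set lin_span :: "'a set \<Rightarrow> 'a set" for X :: "'a set" where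
  span_zero: "\<zero> \<in> lin_span X"
| span_base: "x \<in> X \<Longrightarrow> x \<in> lin_span X"
| span_add: "\<lbrakk>x \<in> lin_span X; y \<in> lin_span X\<rbrakk> \<Longrightarrow> x \<oplus> y \<in> lin_span X"
| span_smult: "x \<in> lin_span X \<Longrightarrow> c \<odot> x \<in> lin_span X"

lemma lin_span_subset:
  assumes "X \<subseteq> H" "\<zero> \<in> H" "\<And>x y. \<lbrakk>x \<in> H; y \<in> H\<rbrakk> \<Longrightarrow> x \<oplus> y \<in> H" "\<And>c x. x \<in> H \<Longrightarrow> c \<odot> x \<in> H"
  shows "lin_span X \<subseteq> H"
proof
  fix x assume "x \<in> lin_span X"
  then show "x \<in> H" by induct (use assms in auto)
qed

lemma lin_span_carrier: "X \<subseteq> carrier A \<Longrightarrow> lin_span X \<subseteq> carrier A"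
  by (rule lin_span_subset) auto

end

lemma (in nonassoc_algebra) minus_zero_alg [simp]: "\<ominus> \<zero> = \<zero>"
  by (simp add: minus_eq_smult)

context jordan_metabelian
begin

text \<open>Polarization of \<open>(x\<^sup>2 y) x = 0\<close>, which is what the Jordan identity says if products of products vanish: first
  \<open>x\<close> is replaced by \<open>x + z\<close>, then \<open>x\<close> by \<open>x\<^sub>1 + x\<^sub>2\<close> in the part linear in \<open>z\<close>.\<close>

lemma linear_jordan:
  assumes c: "x1 \<in> carrier A" "x2 \<in> carrier A" "x3 \<in> carrier A" "y \<in> carrier A"
  shows "((x1 \<otimes> x2) \<otimes> y) \<otimes> x3 \<oplus> ((x1 \<otimes> x3) \<otimes> y) \<otimes> x2 \<oplus> ((x2 \<otimes> x3) \<otimes> y) \<otimes> x1 = \<zero>"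
proof -
  note mc = mult_closed
  have D: "((x \<otimes> x) \<otimes> y) \<otimes> x = \<zero>" if "x \<in> carrier A" for x
    using jordan[OF that c(4)] that c(4) by (simp add: associator_def metabelian a_minus_def mc)
  have square: "(x \<oplus> z) \<otimes> (x \<oplus> z) = x \<otimes> x \<oplus> (x \<otimes> z \<oplus> x \<otimes> z) \<oplus> z \<otimes> z"
    if "x \<in> carrier A" "z \<in> carrier A" for x z
    using that commutative[of z x] by (simp add: distrib_left distrib_right mc M.a_assoc)
  have ac6: "X \<oplus> B1 \<oplus> d \<oplus> (a \<oplus> C1 \<oplus> Z) = X \<oplus> Z \<oplus> (a \<oplus> B1 \<oplus> (C1 \<oplus> d))"
    if "X \<in> carrier A" "Z \<in> carrier A" "a \<in> carrier A" "B1 \<in> carrier A" "C1 \<in> carrier A" "d \<in> carrier A"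
    for X Z a B1 C1 d
    using that by (simp add: M.a_ac)
  have ac7: "A1 \<oplus> E1 \<oplus> B1 \<oplus> (F1 \<oplus> G2 \<oplus> (G1 \<oplus> F2)) = A1 \<oplus> F1 \<oplus> (B1 \<oplus> F2) \<oplus> (E1 \<oplus> G1 \<oplus> G2)"
    if "A1 \<in> carrier A" "B1 \<in> carrier A" "E1 \<in> carrier A" "F1 \<in> carrier A" "F2 \<in> carrier A"
      "G1 \<in> carrier A" "G2 \<in> carrier A" for A1 B1 E1 F1 F2 G1 G2
    using that by (simp add: M.a_ac)
  have ac12: "A1 \<oplus> (e \<oplus> e) \<oplus> B1 \<oplus> ((f1 \<oplus> g2 \<oplus> (g1 \<oplus> f2)) \<oplus> (f1 \<oplus> g2 \<oplus> (g1 \<oplus> f2)))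
      = A1 \<oplus> (f1 \<oplus> f1) \<oplus> (B1 \<oplus> (f2 \<oplus> f2)) \<oplus> ((e \<oplus> g1 \<oplus> g2) \<oplus> (e \<oplus> g1 \<oplus> g2))"
    if h: "A1 \<in> carrier A" "B1 \<in> carrier A" "e \<in> carrier A" "f1 \<in> carrier A" "f2 \<in> carrier A"
      "g1 \<in> carrier A" "g2 \<in> carrier A" for A1 B1 e f1 f2 g1 g2
    using h ac7[OF h(1,2), of "2 \<odot> e" "2 \<odot> f1" "2 \<odot> f2" "2 \<odot> g1" "2 \<odot> g2"]
    by (simp add: double smult_add_right)
  have E: "((x \<otimes> x) \<otimes> y) \<otimes> z \<oplus> (((x \<otimes> z) \<otimes> y) \<otimes> x \<oplus> ((x \<otimes> z) \<otimes> y) \<otimes> x)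
      \<oplus> (((x \<otimes> z) \<otimes> y) \<otimes> z \<oplus> ((x \<otimes> z) \<otimes> y) \<otimes> z \<oplus> ((z \<otimes> z) \<otimes> y) \<otimes> x) = \<zero>"
    if xz: "x \<in> carrier A" "z \<in> carrier A" for x z
  proof -
    have "(((x \<oplus> z) \<otimes> (x \<oplus> z)) \<otimes> y) \<otimes> (x \<oplus> z) =
        ((x \<otimes> x) \<otimes> y) \<otimes> x \<oplus> (((x \<otimes> z) \<otimes> y) \<otimes> x \<oplus> ((x \<otimes> z) \<otimes> y) \<otimes> x) \<oplus> ((z \<otimes> z) \<otimes> y) \<otimes> x \<oplus>
        (((x \<otimes> x) \<otimes> y) \<otimes> z \<oplus> (((x \<otimes> z) \<otimes> y) \<otimes> z \<oplus> ((x \<otimes> z) \<otimes> y) \<otimes> z) \<oplus> ((z \<otimes> z) \<otimes> y) \<otimes> z)"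
      unfolding square[OF xz] using xz c by (simp add: distrib_left distrib_right mc)
    also have "\<dots> = \<zero> \<oplus> \<zero> \<oplus> (((x \<otimes> x) \<otimes> y) \<otimes> z \<oplus> (((x \<otimes> z) \<otimes> y) \<otimes> x \<oplus> ((x \<otimes> z) \<otimes> y) \<otimes> x)
      \<oplus> (((x \<otimes> z) \<otimes> y) \<otimes> z \<oplus> ((x \<otimes> z) \<otimes> y) \<otimes> z \<oplus> ((z \<otimes> z) \<otimes> y) \<otimes> x))"
      using xz c by (subst ac6) (simp_all add: mc D)
    finally show ?thesis using D[of "x \<oplus> z"] xz c by (simp add: mc)
  qed
  have P: "((x \<otimes> x) \<otimes> y) \<otimes> z \<oplus> (((x \<otimes> z) \<otimes> y) \<otimes> x \<oplus> ((x \<otimes> z) \<otimes> y) \<otimes> x) = \<zero>"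
    if xz: "x \<in> carrier A" "z \<in> carrier A" for x z
  proof -
    let ?p = "((x \<otimes> x) \<otimes> y) \<otimes> z \<oplus> (((x \<otimes> z) \<otimes> y) \<otimes> x \<oplus> ((x \<otimes> z) \<otimes> y) \<otimes> x)"
    let ?q = "((x \<otimes> z) \<otimes> y) \<otimes> z \<oplus> ((x \<otimes> z) \<otimes> y) \<otimes> z \<oplus> ((z \<otimes> z) \<otimes> y) \<otimes> x"
    have cl: "?p \<in> carrier A" "?q \<in> carrier A" using xz c by (simp_all add: mc)
    have e1: "?p \<oplus> ?q = \<zero>" using E[OF xz] .
    \<comment> \<open>Replacing \<open>z\<close> by its negative separates the parts of odd and even degree in \<open>z\<close>.\<close>
    have e2: "\<ominus> ?p \<oplus> ?q = \<zero>"
      using E[OF xz(1) M.a_inv_closed[OF xz(2)]] xz c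
      by (simp add: mult_minus minus_mult mc M.minus_add)
    have "?q \<oplus> \<ominus> ?p = \<zero>" using e2 M.a_comm[OF M.a_inv_closed[OF cl(1)] cl(2)] by (rule trans[OF sym, rotated])
    then have "\<ominus> (\<ominus> ?p) = ?q" using cl by (intro M.minus_equality M.a_inv_closed)
    then have "?q = ?p" using M.minus_minus[OF cl(1)] by (rule trans[OF sym])
    then have "?p \<oplus> ?p = \<zero>" using e1 by (simp only:)
    then have "2 \<odot> ?p = \<zero>" using double[OF cl(1)] by (simp only:)
    then show ?thesis using smult_eq_zero[OF cl(1)] by simp
  qed
  let ?l = "((x1 \<otimes> x2) \<otimes> y) \<otimes> x3 \<oplus> ((x1 \<otimes> x3) \<otimes> y) \<otimes> x2 \<oplus> ((x2 \<otimes> x3) \<otimes> y) \<otimes> x1"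
  have cl: "?l \<in> carrier A" using c by (simp add: mc)
  have "\<zero> = (((x1 \<oplus> x2) \<otimes> (x1 \<oplus> x2)) \<otimes> y) \<otimes> x3
      \<oplus> ((((x1 \<oplus> x2) \<otimes> x3) \<otimes> y) \<otimes> (x1 \<oplus> x2) \<oplus> (((x1 \<oplus> x2) \<otimes> x3) \<otimes> y) \<otimes> (x1 \<oplus> x2))"
    using c by (intro P[symmetric]) auto
  also have "\<dots> = ((x1 \<otimes> x1) \<otimes> y) \<otimes> x3 \<oplus> (((x1 \<otimes> x2) \<otimes> y) \<otimes> x3 \<oplus> ((x1 \<otimes> x2) \<otimes> y) \<otimes> x3) \<oplus> ((x2 \<otimes> x2) \<otimes> y) \<otimes> x3
    \<oplus> ((((x1 \<otimes> x3) \<otimes> y) \<otimes> x1 \<oplus> ((x2 \<otimes> x3) \<otimes> y) \<otimes> x1 \<oplus> (((x1 \<otimes> x3) \<otimes> y) \<otimes> x2 \<oplus> ((x2 \<otimes> x3) \<otimes> y) \<otimes> x2))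
     \<oplus> (((x1 \<otimes> x3) \<otimes> y) \<otimes> x1 \<oplus> ((x2 \<otimes> x3) \<otimes> y) \<otimes> x1 \<oplus> (((x1 \<otimes> x3) \<otimes> y) \<otimes> x2 \<oplus> ((x2 \<otimes> x3) \<otimes> y) \<otimes> x2)))"
    unfolding square[OF c(1,2)] using c by (simp add: distrib_left distrib_right mc)
  also have "\<dots> = ((x1 \<otimes> x1) \<otimes> y) \<otimes> x3 \<oplus> (((x1 \<otimes> x3) \<otimes> y) \<otimes> x1 \<oplus> ((x1 \<otimes> x3) \<otimes> y) \<otimes> x1)
    \<oplus> (((x2 \<otimes> x2) \<otimes> y) \<otimes> x3 \<oplus> (((x2 \<otimes> x3) \<otimes> y) \<otimes> x2 \<oplus> ((x2 \<otimes> x3) \<otimes> y) \<otimes> x2)) \<oplus> (?l \<oplus> ?l)"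
    by (rule ac12) (use c in \<open>simp_all add: mc\<close>)
  also have "\<dots> = ?l \<oplus> ?l" using P[of x1 x3] P[of x2 x3] c cl by simp
  finally show ?thesis using smult_eq_zero[OF cl, of 2] double[OF cl] by simp
qed

text \<open>The square of the algebra would have to be handled as a span of products. The two subspaces below are defined by
  equations instead, contain all products, and share with the square the properties that matter:
  an element of \<open>sq_ann\<close> is annihilated by every product, and an element of \<open>sq_closure\<close> is moreover
  annihilated by every element of \<open>sq_ann\<close>.\<close>

definition sq_ann :: "'a set" where
  "sq_ann = {w \<in> carrier A. \<forall>x\<in>carrier A. \<forall>y\<in>carrier A. (x \<otimes> y) \<otimes> w = \<zero>}"

definition sq_closure :: "'a set" where
  "sq_closure = {w \<in> sq_ann. \<forall>n\<in>sq_ann. w \<otimes> n = \<zero>}"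

lemma sq_ann_carrier: "w \<in> sq_ann \<Longrightarrow> w \<in> carrier A"
  by (simp add: sq_ann_def)

lemma sq_closure_ann: "w \<in> sq_closure \<Longrightarrow> w \<in> sq_ann"
  by (simp add: sq_closure_def)

lemma sq_closure_carrier: "w \<in> sq_closure \<Longrightarrow> w \<in> carrier A"
  by (simp add: sq_closure_def sq_ann_def)

lemma mult_in_sq_closure: "\<lbrakk>x \<in> carrier A; y \<in> carrier A\<rbrakk> \<Longrightarrow> x \<otimes> y \<in> sq_closure"
  by (auto simp: sq_closure_def sq_ann_def mult_closed metabelian)

lemma sq_closure_zero: "\<zero> \<in> sq_closure"
  using mult_in_sq_closure[of \<zero> \<zero>] by simp

lemma sq_closure_add: "\<lbrakk>x \<in> sq_closure; y \<in> sq_closure\<rbrakk> \<Longrightarrow> x \<oplus> y \<in> sq_closure"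
  by (auto simp: sq_closure_def sq_ann_def mult_closed distrib_left distrib_right)

lemma sq_closure_smult: "x \<in> sq_closure \<Longrightarrow> c \<odot> x \<in> sq_closure"
  by (auto simp: sq_closure_def sq_ann_def mult_closed smult_mult_left smult_mult_right)

text \<open>If \<open>w\<close> is annihilated by products, the linearized Jordan identity loses the term in which \<open>w\<close> is the last
  factor.\<close>

lemma skew:
  assumes w: "w \<in> sq_ann" and c: "a \<in> carrier A" "b \<in> carrier A" "c \<in> carrier A"
  shows "((w \<otimes> a) \<otimes> b) \<otimes> c = \<ominus> (((w \<otimes> c) \<otimes> b) \<otimes> a)"
proof -
  have wc: "w \<in> carrier A" using w by (rule sq_ann_carrier)
  have "((a \<otimes> c) \<otimes> b) \<otimes> w = \<zero>" using w c by (auto simp: sq_ann_def mult_closed)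
  then have "((w \<otimes> a) \<otimes> b) \<otimes> c \<oplus> ((w \<otimes> c) \<otimes> b) \<otimes> a = \<zero>"
    using linear_jordan[OF wc c(1,3,2)] wc c by (simp add: mult_closed)
  then show ?thesis using wc c by (simp add: M.minus_equality mult_closed)
qed

lemma rmul_in_sq_closure: "\<lbrakk>w \<in> sq_closure; set cs \<subseteq> carrier A\<rbrakk> \<Longrightarrow> rmul A w cs \<in> sq_closure"
  by (induct cs arbitrary: w) (auto intro: mult_in_sq_closure sq_closure_carrier)

lemma rmul_skew:
  assumes "w \<in> sq_closure" "set (xs @ [a, b, c] @ ys) \<subseteq> carrier A"
  shows "rmul A w (xs @ [a, b, c] @ ys) = \<ominus> rmul A w (xs @ [c, b, a] @ ys)"
proof -
  have u: "rmul A w xs \<in> sq_closure" by (rule rmul_in_sq_closure) (use assms in auto)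
  then have uc: "rmul A w xs \<in> carrier A" by (rule sq_closure_carrier)
  have "((rmul A w xs \<otimes> a) \<otimes> b) \<otimes> c = \<ominus> (((rmul A w xs \<otimes> c) \<otimes> b) \<otimes> a)"
    by (rule skew) (use u assms in \<open>auto intro: sq_closure_ann\<close>)
  then show ?thesis using assms uc by (simp add: rmul_minus mult_closed)
qed

end

section \<open>Alternating positions\<close>

text \<open>Skew-symmetry relates letters whose positions have the same parity. A word is therefore recorded by
  the list of its letters at odd positions and the list of those at even positions.\<close>

function interleave :: "'v list \<Rightarrow> 'v list \<Rightarrow> 'v list" where
  "interleave [] ds = ds"
| "interleave (t # ts) ds = t # interleave ds ts"
  by pat_completeness auto
termination by (relation "measure (\<lambda>(ts, ds). length ts + length ds)") auto

lemma mset_interleave [simp]: "mset (interleave ts ds) = mset ts + mset ds"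
  by (induct ts ds rule: interleave.induct) auto

lemma set_interleave [simp]: "set (interleave ts ds) = set ts \<union> set ds"
  by (induct ts ds rule: interleave.induct) auto

lemma length_interleave [simp]: "length (interleave ts ds) = length ts + length ds"
  by (induct ts ds rule: interleave.induct) auto

lemma map_interleave: "map f (interleave ts ds) = interleave (map f ts) (map f ds)"
  by (induct ts ds rule: interleave.induct) auto

lemma interleave_swap_first:
  "length xs < length ds \<Longrightarrow> \<exists>us d vs. \<forall>x y. interleave (xs @ x # y # ys) ds = us @ [x, d, y] @ vs"
proof (induct xs arbitrary: ds)
  case Nil
  then obtain d ds' where "ds = d # ds'" by (cases ds) auto
  then show ?case by (intro exI[of _ "[]"] exI[of _ d] exI[of _ "interleave ds' ys"]) simp
next
  case (Cons a xs)
  then obtain d ds' where d: "ds = d # ds'" by (cases ds) auto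
  with Cons obtain us e vs where "\<forall>x y. interleave (xs @ x # y # ys) ds' = us @ [x, e, y] @ vs" by force
  then show ?case using d by (intro exI[of _ "a # d # us"] exI[of _ e] exI[of _ vs]) simp
qed

lemma interleave_swap_second:
  assumes "Suc (length xs) < length ts"
  shows "\<exists>us d vs. \<forall>x y. interleave ts (xs @ x # y # ys) = us @ [x, d, y] @ vs"
proof -
  obtain t ts' where t: "ts = t # ts'" using assms by (cases ts) auto
  then obtain us d vs where "\<forall>x y. interleave (xs @ x # y # ys) ts' = us @ [x, d, y] @ vs"
    using interleave_swap_first[of xs ts' ys] assms by (simp del: interleave.simps) blast
  then show ?thesis using t by (intro exI[of _ "t # us"] exI[of _ d] exI[of _ vs]) simp
qed

lemma interleave_exists:
  "\<exists>ts ds. cs = interleave ts ds \<and> length ts = (length cs + 1) div 2 \<and> length ds = length cs div 2"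
proof (induct cs)
  case Nil show ?case by (intro exI[of _ "[]"]) simp
next
  case (Cons c cs)
  then obtain ts ds where e: "cs = interleave ts ds" and l: "length ts = (length cs + 1) div 2"
    "length ds = length cs div 2" by blast
  have "c # cs = interleave (c # ds) ts" by (simp only: e interleave.simps)
  moreover have "length (c # ds) = (length (c # cs) + 1) div 2" using l(2) by simp
  moreover have "length ts = length (c # cs) div 2" using l(1) by simp
  ultimately show ?case by blast
qed

text \<open>Transpositions of neighbours generate all permutations.\<close>

lemma permute_by_swaps:
  assumes swap: "\<And>xs x y ys. \<lbrakk>mset (xs @ x # y # ys) = mset ts; Q (xs @ x # y # ys)\<rbrakk> \<Longrightarrow> Q (xs @ y # x # ys)"
    and Q: "Q ts" and m: "mset ts = mset ts'"
  shows "Q ts'"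
proof -
  define R where "R l \<longleftrightarrow> mset l = mset ts \<and> Q l" for l
  have sw: "R (xs @ y # x # ys)" if "R (xs @ x # y # ys)" for xs x y ys
  proof -
    have "mset (xs @ y # x # ys) = mset (xs @ x # y # ys)" by simp
    then show ?thesis using that swap[of xs x y ys] unfolding R_def by metis
  qed
  have move: "R (zs @ x # us @ vs)" if "R (zs @ us @ x # vs)" for zs us x vs
    using that
  proof (induct us arbitrary: vs rule: rev_induct)
    case (snoc u us)
    then have "R ((zs @ us) @ u # x # vs)" by simp
    then have "R ((zs @ us) @ x # u # vs)" by (rule sw)
    then show ?case using snoc(1)[of "u # vs"] by simp
  qed simp
  have "R (zs @ ts) \<Longrightarrow> mset ts = mset ts' \<Longrightarrow> R (zs @ ts')" for zs ts
  proof (induct ts' arbitrary: zs ts)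
    case (Cons x ts')
    then have "x \<in> set ts" by (metis list.set_intros(1) mset_eq_setD)
    then obtain us vs where ts: "ts = us @ x # vs" by (meson split_list)
    have "R (zs @ us @ x # vs)" using Cons(2) ts by simp
    then have "R (zs @ x # us @ vs)" by (rule move)
    then show ?case using Cons(1)[of "zs @ [x]" "us @ vs"] Cons(3) ts by simp
  qed simp
  from this[of "[]" ts] show ?thesis using Q m by (simp add: R_def)
qed

text \<open>Each letter of \<open>V\<close> is used exactly once: \<open>i\<close> and \<open>j\<close> in the initial product, \<open>ts\<close> at the odd and \<open>ds\<close> at the
  even positions of the factors that follow. As \<open>k\<close> is fixed, all words considered have the same shape.\<close>

definition is_word :: "nat set \<Rightarrow> nat \<Rightarrow> nat \<Rightarrow> nat \<Rightarrow> nat list \<Rightarrow> nat list \<Rightarrow> bool" where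
  "is_word V k i j ts ds \<longleftrightarrow> distinct (i # j # ts @ ds) \<and> set (i # j # ts @ ds) = V \<and> length ts = k"

lemma is_word_mset:
  assumes "is_word V k i j ts ds" "mset (i # j # ts @ ds) = mset (i' # j' # ts' @ ds')" "length ts' = k"
  shows "is_word V k i' j' ts' ds'"
  using assms(1,3) unfolding is_word_def mset_eq_imp_distinct_iff[OF assms(2)] mset_eq_setD[OF assms(2)]
  by blast

text \<open>The rewriting of words, separated from its algebraic justification: what holds for normal words and is
  stable under the defining relations holds for all words. Letters at positions of the same parity
  are sorted, and the cyclic relation brings the least letter outside \<open>ts\<close> into the initial product.\<close>

lemma word_normalization:
  assumes sym: "\<And>i j ts ds. \<lbrakk>is_word V k i j ts ds; P i j ts ds\<rbrakk> \<Longrightarrow> P j i ts ds"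
    and swT: "\<And>i j xs x y ys ds. \<lbrakk>is_word V k i j (xs @ x # y # ys) ds; P i j (xs @ x # y # ys) ds\<rbrakk>
      \<Longrightarrow> P i j (xs @ y # x # ys) ds"
    and swD: "\<And>i j ts xs x y ys. \<lbrakk>is_word V k i j ts (xs @ x # y # ys); P i j ts (xs @ x # y # ys)\<rbrakk>
      \<Longrightarrow> P i j ts (xs @ y # x # ys)"
    and cyc: "\<And>i j ts d ds. \<lbrakk>is_word V k i j ts (d # ds); P i d ts (j # ds); P j d ts (i # ds)\<rbrakk>
      \<Longrightarrow> P i j ts (d # ds)"
    and norm: "\<And>i j ts ds. \<lbrakk>is_word V k i j ts ds; i = Min (V - set ts); sorted ts; sorted ds\<rbrakk> \<Longrightarrow> P i j ts ds"
    and w: "is_word V k i j ts ds"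
  shows "P i j ts ds"
proof -
  have permT: "P i j ts' ds" if "P i j ts ds" "is_word V k i j ts ds" "mset ts = mset ts'" for i j ts ts' ds
  proof (rule permute_by_swaps[where Q = "\<lambda>l. P i j l ds", OF _ that(1,3)])
    fix xs x y ys assume h: "mset (xs @ x # y # ys) = mset ts" "P i j (xs @ x # y # ys) ds"
    have "mset (i # j # ts @ ds) = mset (i # j # (xs @ x # y # ys) @ ds)"
      by (simp only: mset.simps(2) mset_append h(1)[symmetric])
    moreover have "length (xs @ x # y # ys) = k"
      using mset_eq_length[OF h(1)] that(2) by (simp only: is_word_def)
    ultimately have "is_word V k i j (xs @ x # y # ys) ds" by (rule is_word_mset[OF that(2)])
    then show "P i j (xs @ y # x # ys) ds" using h(2) by (rule swT)
  qed
  have permD: "P i j ts ds'" if "P i j ts ds" "is_word V k i j ts ds" "mset ds = mset ds'" for i j ts ds ds'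
  proof (rule permute_by_swaps[where Q = "\<lambda>l. P i j ts l", OF _ that(1,3)])
    fix xs x y ys assume h: "mset (xs @ x # y # ys) = mset ds" "P i j ts (xs @ x # y # ys)"
    have "mset (i # j # ts @ ds) = mset (i # j # ts @ (xs @ x # y # ys))"
      by (simp only: mset.simps(2) mset_append h(1)[symmetric])
    then have "is_word V k i j ts (xs @ x # y # ys)"
      by (rule is_word_mset[OF that(2)]) (use that(2) in \<open>simp only: is_word_def\<close>)
    then show "P i j ts (xs @ y # x # ys)" using h(2) by (rule swD)
  qed
  have first: "P i j ts ds" if "is_word V k i j ts ds" "i = Min (V - set ts)" for i j ts ds
  proof -
    have s: "is_word V k i j (sort ts) (sort ds)" using that(1) by (auto simp: is_word_def)
    then have "P i j (sort ts) (sort ds)" using that by (intro norm) auto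
    then have p1: "P i j ts (sort ds)" using s by (rule permT) simp
    have "is_word V k i j ts (sort ds)" using that(1) by (auto simp: is_word_def)
    with p1 show ?thesis by (rule permD) simp
  qed
  have second: "P i j ts ds" if "is_word V k i j ts ds" "j = Min (V - set ts)" for i j ts ds
  proof -
    have "is_word V k j i ts ds" using that(1) by (auto simp: is_word_def)
    then show ?thesis using first sym that(2) by blast
  qed
  obtain m where m: "m = Min (V - set ts)" by blast
  have "finite V" "V - set ts = {i, j} \<union> set ds" using w by (auto simp: is_word_def)
  then have "m \<in> {i, j} \<union> set ds" using Min_in[of "V - set ts"] by (simp add: m)
  then consider "m = i" | "m = j" | "m \<in> set ds" by auto
  then show ?thesis
  proof cases
    case 3
    then obtain us vs where ds: "ds = us @ m # vs" by (meson split_list)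
    have w': "is_word V k i j ts (m # us @ vs)"
      by (rule is_word_mset[OF w]) (simp add: ds, use w in \<open>simp only: is_word_def\<close>)
    have wi: "is_word V k i m ts (j # us @ vs)"
      by (rule is_word_mset[OF w']) (simp, use w' in \<open>simp only: is_word_def\<close>)
    have wj: "is_word V k j m ts (i # us @ vs)"
      by (rule is_word_mset[OF w']) (simp, use w' in \<open>simp only: is_word_def\<close>)
    have "P i j ts (m # us @ vs)" by (rule cyc[OF w' second[OF wi m] second[OF wj m]])
    then show ?thesis using w' by (rule permD) (simp add: ds)
  qed (use first second w m in auto)
qed

section \<open>Left-normed words\<close>

text \<open>In a commutative metabelian algebra a monomial with a subterm \<open>(u w) (u' w')\<close> is zero, and every other
  monomial of degree at least two equals a left-normed word. The value \<open>None\<close> stands for zero, except that it is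
  also assigned to single variables.\<close>

fun leftnorm :: "'v monomial \<Rightarrow> ('v \<times> 'v \<times> 'v list) option" where
  "leftnorm (Var v) = None"
| "leftnorm (Mul (Var i) (Var j)) = Some (i, j, [])"
| "leftnorm (Mul (Mul u w) (Var c)) = map_option (\<lambda>(i, j, cs). (i, j, cs @ [c])) (leftnorm (Mul u w))"
| "leftnorm (Mul (Var c) (Mul u w)) = map_option (\<lambda>(i, j, cs). (i, j, cs @ [c])) (leftnorm (Mul u w))"
| "leftnorm (Mul (Mul u w) (Mul u' w')) = None"

lemma leftnorm_mset: "leftnorm w = Some (i, j, cs) \<Longrightarrow> mset (leaves w) = mset (i # j # cs)"
  by (induct w arbitrary: cs rule: leftnorm.induct) auto

definition word_value :: "('a, 'm) ring_scheme \<Rightarrow> (nat \<Rightarrow> 'a) \<Rightarrow> nat \<Rightarrow> nat \<Rightarrow> nat list \<Rightarrow> 'a" where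
  "word_value A a i j cs = rmul A (a i \<otimes>\<^bsub>A\<^esub> a j) (map a cs)"

definition word_monomial :: "'v \<Rightarrow> 'v \<Rightarrow> 'v list \<Rightarrow> 'v monomial" where
  "word_monomial i j cs = foldl (\<lambda>w c. Mul w (Var c)) (Mul (Var i) (Var j)) cs"

lemma eval_foldl_Mul:
  "eval_monomial A a (foldl (\<lambda>w c. Mul w (Var c)) u cs) = rmul A (eval_monomial A a u) (map a cs)"
  by (induct cs arbitrary: u) auto

lemma eval_word_monomial: "eval_monomial A a (word_monomial i j cs) = word_value A a i j cs"
  by (simp add: word_monomial_def word_value_def eval_foldl_Mul)

lemma leaves_word_monomial: "leaves (word_monomial i j cs) = i # j # cs"
proof -
  have "leaves (foldl (\<lambda>w c. Mul w (Var c)) u cs) = leaves u @ cs" for u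
    by (induct cs arbitrary: u) auto
  then show ?thesis by (simp add: word_monomial_def)
qed

context jordan_metabelian
begin

lemma word_value_closed:
  "\<lbrakk>\<And>v. v \<in> set (i # j # cs) \<Longrightarrow> a v \<in> carrier A\<rbrakk> \<Longrightarrow> word_value A a i j cs \<in> carrier A"
  by (auto simp: word_value_def intro!: rmul_closed mult_closed)

lemma eval_leftnorm:
  assumes "\<And>v. v \<in> vars w \<Longrightarrow> a v \<in> carrier A" "\<And>v. w \<noteq> Var v"
  shows "eval_monomial A a w = (case leftnorm w of None \<Rightarrow> \<zero> | Some (i, j, cs) \<Rightarrow> word_value A a i j cs)"
  using assms
proof (induct w rule: leftnorm.induct)
  case (3 u w c)
  have "eval_monomial A a (Mul u w) \<in> carrier A" using 3 by (intro eval_monomial_closed) auto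
  then show ?case using 3 by (auto simp: word_value_def split: option.splits)
next
  case (4 c u w)
  have "eval_monomial A a (Mul u w) \<in> carrier A" using 4 by (intro eval_monomial_closed) auto
  then have "eval_monomial A a (Mul (Var c) (Mul u w)) = eval_monomial A a (Mul u w) \<otimes> a c"
    using 4 commutative[of "a c" "eval_monomial A a (Mul u w)"] by simp
  moreover have "a c \<in> carrier A" using 4 by simp
  ultimately show ?case using 4 by (auto simp: word_value_def split: option.splits)
next
  case (5 u w u' w')
  have "eval_monomial A a v \<in> carrier A" if "v \<in> {u, w, u', w'}" for v
    using 5 that by (intro eval_monomial_closed) auto
  then show ?case by (simp add: metabelian)
qed (auto simp: word_value_def)

lemma word_value_sym:
  "\<lbrakk>a i \<in> carrier A; a j \<in> carrier A\<rbrakk> \<Longrightarrow> word_value A a j i cs = word_value A a i j cs"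
  by (simp add: word_value_def commutative)

lemma word_value_skew:
  assumes "\<And>v. v \<in> set (i # j # xs @ [x, d, y] @ ys) \<Longrightarrow> a v \<in> carrier A"
  shows "word_value A a i j (xs @ [y, d, x] @ ys) = \<ominus> word_value A a i j (xs @ [x, d, y] @ ys)"
  unfolding word_value_def map_append list.map
  by (rule rmul_skew) (use assms in \<open>auto intro: mult_in_sq_closure\<close>)

lemma word_value_swap_first:
  assumes "\<And>v. v \<in> set (i # j # (xs @ x # y # ys) @ ds) \<Longrightarrow> a v \<in> carrier A" "length xs < length ds"
  shows "word_value A a i j (interleave (xs @ y # x # ys) ds)
    = \<ominus> word_value A a i j (interleave (xs @ x # y # ys) ds)"
proof -
  obtain us d vs where e: "\<forall>x y. interleave (xs @ x # y # ys) ds = us @ [x, d, y] @ vs"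
    using interleave_swap_first[OF assms(2), of ys] by auto
  have "set (us @ [x, d, y] @ vs) = set (xs @ x # y # ys) \<union> set ds"
    using e by (metis set_interleave)
  then show ?thesis unfolding e[rule_format] using assms(1) by (intro word_value_skew) auto
qed

lemma word_value_swap_second:
  assumes "\<And>v. v \<in> set (i # j # ts @ xs @ x # y # ys) \<Longrightarrow> a v \<in> carrier A" "Suc (length xs) < length ts"
  shows "word_value A a i j (interleave ts (xs @ y # x # ys))
    = \<ominus> word_value A a i j (interleave ts (xs @ x # y # ys))"
proof -
  obtain us d vs where e: "\<forall>x y. interleave ts (xs @ x # y # ys) = us @ [x, d, y] @ vs"
    using interleave_swap_second[OF assms(2), of ys] by auto
  have "set (us @ [x, d, y] @ vs) = set ts \<union> set (xs @ x # y # ys)"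
    using e by (metis set_interleave)
  then show ?thesis unfolding e[rule_format] using assms(1) by (intro word_value_skew) auto
qed

text \<open>The linearized Jordan identity for \<open>a i\<close>, \<open>a j\<close>, \<open>a d\<close>, with \<open>a t\<close> in the middle.\<close>

lemma word_value_cyclic:
  assumes "\<And>v. v \<in> set (i # j # t # d # cs) \<Longrightarrow> a v \<in> carrier A"
  shows "word_value A a i j (t # d # cs)
    = \<ominus> (word_value A a i d (t # j # cs) \<oplus> word_value A a j d (t # i # cs))"
proof -
  have c: "a i \<in> carrier A" "a j \<in> carrier A" "a d \<in> carrier A" "a t \<in> carrier A"
    and cs: "set (map a cs) \<subseteq> carrier A" using assms by auto
  have "((a i \<otimes> a j) \<otimes> a t) \<otimes> a d \<oplus> (((a i \<otimes> a d) \<otimes> a t) \<otimes> a j \<oplus> ((a j \<otimes> a d) \<otimes> a t) \<otimes> a i) = \<zero>"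
    using linear_jordan[OF c] c by (simp add: mult_closed M.a_assoc)
  then have "((a i \<otimes> a j) \<otimes> a t) \<otimes> a d = \<ominus> (((a i \<otimes> a d) \<otimes> a t) \<otimes> a j \<oplus> ((a j \<otimes> a d) \<otimes> a t) \<otimes> a i)"
    using c by (simp add: M.minus_equality mult_closed)
  then show ?thesis using c cs by (simp add: word_value_def rmul_minus rmul_add mult_closed)
qed

end

section \<open>Symmetrized pairs of multiplications\<close>

definition sym_pair :: "('a, 'm) ring_scheme \<Rightarrow> 'a \<Rightarrow> 'a \<times> 'a \<Rightarrow> 'a" where
  "sym_pair A w r = ((w \<otimes>\<^bsub>A\<^esub> fst r) \<otimes>\<^bsub>A\<^esub> snd r) \<oplus>\<^bsub>A\<^esub> ((w \<otimes>\<^bsub>A\<^esub> snd r) \<otimes>\<^bsub>A\<^esub> fst r)"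

definition sym_pairs :: "('a, 'm) ring_scheme \<Rightarrow> 'a \<Rightarrow> ('a \<times> 'a) list \<Rightarrow> 'a" where
  "sym_pairs A w rs = foldl (sym_pair A) w rs"

lemma sym_pairs_simps [simp]:
  "sym_pairs A w [] = w" "sym_pairs A w (r # rs) = sym_pairs A (sym_pair A w r) rs"
  "sym_pairs A w (rs @ rs') = sym_pairs A (sym_pairs A w rs) rs'"
  by (simp_all add: sym_pairs_def)

context nonassoc_algebra
begin

lemma sym_pair_closed:
  "\<lbrakk>w \<in> carrier A; r \<in> carrier A \<times> carrier A\<rbrakk> \<Longrightarrow> sym_pair A w r \<in> carrier A"
  by (auto simp: sym_pair_def mult_closed)

lemma sym_pair_commute:
  "\<lbrakk>w \<in> carrier A; b \<in> carrier A; c \<in> carrier A\<rbrakk> \<Longrightarrow> sym_pair A w (c, b) = sym_pair A w (b, c)"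
  by (simp add: sym_pair_def M.a_comm mult_closed)

lemma sym_pair_add:
  assumes "w \<in> carrier A" "w' \<in> carrier A" "r \<in> carrier A \<times> carrier A"
  shows "sym_pair A (w \<oplus> w') r = sym_pair A w r \<oplus> sym_pair A w' r"
  using assms by (auto simp: sym_pair_def distrib_right mult_closed M.a_ac)

lemma sym_pair_smult:
  assumes "w \<in> carrier A" "r \<in> carrier A \<times> carrier A"
  shows "sym_pair A (c \<odot> w) r = c \<odot> sym_pair A w r"
  using assms by (auto simp: sym_pair_def smult_mult_left mult_closed smult_add_right)

lemma sym_pair_zero: "r \<in> carrier A \<times> carrier A \<Longrightarrow> sym_pair A \<zero> r = \<zero>"
  by (auto simp: sym_pair_def)

lemma sym_pair_add_arg:
  assumes "w \<in> carrier A" "b \<in> carrier A" "b' \<in> carrier A" "c \<in> carrier A"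
  shows "sym_pair A w (b \<oplus> b', c) = sym_pair A w (b, c) \<oplus> sym_pair A w (b', c)"
  using assms by (auto simp: sym_pair_def distrib_left distrib_right mult_closed M.a_ac)

lemma sym_pair_smult_arg:
  assumes "w \<in> carrier A" "b \<in> carrier A" "c \<in> carrier A"
  shows "sym_pair A w (k \<odot> b, c) = k \<odot> sym_pair A w (b, c)"
  using assms by (auto simp: sym_pair_def smult_mult_left smult_mult_right mult_closed smult_add_right)

lemma sym_pairs_closed:
  "\<lbrakk>w \<in> carrier A; set rs \<subseteq> carrier A \<times> carrier A\<rbrakk> \<Longrightarrow> sym_pairs A w rs \<in> carrier A"
  by (induct rs arbitrary: w) (auto simp: sym_pair_closed)

lemma sym_pairs_smult:
  "\<lbrakk>w \<in> carrier A; set rs \<subseteq> carrier A \<times> carrier A\<rbrakk>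
    \<Longrightarrow> sym_pairs A (c \<odot> w) rs = c \<odot> sym_pairs A w rs"
  by (induct rs arbitrary: w) (auto simp: sym_pair_smult sym_pair_closed)

lemma sym_pairs_zero: "set rs \<subseteq> carrier A \<times> carrier A \<Longrightarrow> sym_pairs A \<zero> rs = \<zero>"
  by (induct rs) (auto simp: sym_pair_zero)

end

context jordan_metabelian
begin

lemma sym_pair_in_sq_closure:
  "\<lbrakk>w \<in> sq_closure; r \<in> carrier A \<times> carrier A\<rbrakk> \<Longrightarrow> sym_pair A w r \<in> sq_closure"
  by (auto simp: sym_pair_def sq_closure_carrier intro!: sq_closure_add mult_in_sq_closure mult_closed)

lemma skew_even:
  assumes w: "w \<in> sq_closure" and c: "a \<in> carrier A" "b \<in> carrier A" "c \<in> carrier A" "d \<in> carrier A"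
  shows "(((w \<otimes> a) \<otimes> b) \<otimes> c) \<otimes> d = \<ominus> ((((w \<otimes> a) \<otimes> d) \<otimes> c) \<otimes> b)"
  by (rule skew) (use w c in \<open>auto intro!: sq_closure_ann mult_in_sq_closure sq_closure_carrier\<close>)

lemma skew_odd:
  assumes w: "w \<in> sq_closure" and c: "a \<in> carrier A" "b \<in> carrier A" "c \<in> carrier A" "d \<in> carrier A"
  shows "(((w \<otimes> a) \<otimes> b) \<otimes> c) \<otimes> d = \<ominus> ((((w \<otimes> c) \<otimes> b) \<otimes> a) \<otimes> d)"
  using skew[OF sq_closure_ann[OF w] c(1-3)] w c
  by (simp add: minus_mult mult_closed sq_closure_carrier)

text \<open>Exchanging the letters at the two odd and at the two even positions gives two signs, which cancel. Hence
  symmetrized pairs commute (\<open>sym_pair_swap\<close>).\<close>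

lemma skew_both:
  assumes w: "w \<in> sq_closure" and c: "a \<in> carrier A" "b \<in> carrier A" "c \<in> carrier A" "d \<in> carrier A"
  shows "(((w \<otimes> a) \<otimes> b) \<otimes> c) \<otimes> d = (((w \<otimes> c) \<otimes> d) \<otimes> a) \<otimes> b"
proof -
  have wc: "w \<in> carrier A" using w by (rule sq_closure_carrier)
  have "(((w \<otimes> a) \<otimes> b) \<otimes> c) \<otimes> d = \<ominus> ((((w \<otimes> c) \<otimes> b) \<otimes> a) \<otimes> d)"
    using w c by (rule skew_odd)
  also have "(((w \<otimes> c) \<otimes> b) \<otimes> a) \<otimes> d = \<ominus> ((((w \<otimes> c) \<otimes> d) \<otimes> a) \<otimes> b)"
    using w c by (intro skew_even)
  finally show ?thesis using wc c by (simp add: mult_closed)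
qed

lemma sym_pair_expand:
  assumes "w \<in> carrier A" "a \<in> carrier A" "b \<in> carrier A" "c \<in> carrier A" "d \<in> carrier A"
  shows "sym_pair A (sym_pair A w (a, b)) (c, d) =
    ((((w \<otimes> a) \<otimes> b) \<otimes> c) \<otimes> d \<oplus> (((w \<otimes> b) \<otimes> a) \<otimes> c) \<otimes> d)
    \<oplus> ((((w \<otimes> a) \<otimes> b) \<otimes> d) \<otimes> c \<oplus> (((w \<otimes> b) \<otimes> a) \<otimes> d) \<otimes> c)"
  using assms by (simp add: sym_pair_def distrib_right mult_closed)

lemma sym_pair_swap:
  assumes w: "w \<in> sq_closure" and c: "a \<in> carrier A" "b \<in> carrier A" "c \<in> carrier A" "d \<in> carrier A"
  shows "sym_pair A (sym_pair A w (a, b)) (c, d) = sym_pair A (sym_pair A w (c, d)) (a, b)"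
proof -
  have wc: "w \<in> carrier A" using w by (rule sq_closure_carrier)
  let ?p = "(((w \<otimes> c) \<otimes> d) \<otimes> a) \<otimes> b" and ?q = "(((w \<otimes> d) \<otimes> c) \<otimes> a) \<otimes> b"
    and ?r = "(((w \<otimes> c) \<otimes> d) \<otimes> b) \<otimes> a" and ?s = "(((w \<otimes> d) \<otimes> c) \<otimes> b) \<otimes> a"
  have cl: "?p \<in> carrier A" "?q \<in> carrier A" "?r \<in> carrier A" "?s \<in> carrier A"
    using wc c by (simp_all add: mult_closed)
  have "sym_pair A (sym_pair A w (a, b)) (c, d) = (?p \<oplus> ?r) \<oplus> (?q \<oplus> ?s)"
    unfolding sym_pair_expand[OF wc c] using w c
    by (simp only: skew_both[of w a b c d] skew_both[of w b a c d] skew_both[of w a b d c] skew_both[of w b a d c])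
  also have "\<dots> = (?p \<oplus> ?q) \<oplus> (?r \<oplus> ?s)"
    using cl by (simp add: M.a_ac)
  also have "\<dots> = sym_pair A (sym_pair A w (c, d)) (a, b)"
    unfolding sym_pair_expand[OF wc c(3,4,1,2)] ..
  finally show ?thesis .
qed

text \<open>A letter that occurs twice in positions of the same parity makes the word equal to its negative.\<close>

lemma mult_alternate_zero:
  assumes w: "w \<in> sq_closure" and c: "a \<in> carrier A" "z \<in> carrier A" "b \<in> carrier A"
  shows "((w \<otimes> z) \<otimes> a) \<otimes> z = \<zero>" "(((w \<otimes> z) \<otimes> a) \<otimes> z) \<otimes> b = \<zero>" "(((w \<otimes> b) \<otimes> z) \<otimes> a) \<otimes> z = \<zero>"
proof -
  have zero: "((u \<otimes> z) \<otimes> a) \<otimes> z = \<zero>" if "u \<in> sq_closure" for u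
    using skew[OF sq_closure_ann[OF that] c(2,1,2)] sq_closure_carrier[OF that] c
    by (intro zero_if_eq_minus) (auto simp: mult_closed)
  show *: "((w \<otimes> z) \<otimes> a) \<otimes> z = \<zero>" by (rule zero[OF w])
  then show "(((w \<otimes> z) \<otimes> a) \<otimes> z) \<otimes> b = \<zero>" using c by simp
  show "(((w \<otimes> b) \<otimes> z) \<otimes> a) \<otimes> z = \<zero>"
    by (rule zero) (use w c in \<open>auto intro: mult_in_sq_closure sq_closure_carrier\<close>)
qed

text \<open>Two occurrences of a letter in different pairs can be collected in one pair.\<close>

lemma sym_pair_contract:
  assumes w: "w \<in> sq_closure" and c: "z \<in> carrier A" "b \<in> carrier A" "c \<in> carrier A"
  shows "2 \<odot> sym_pair A (sym_pair A w (z, b)) (z, c) = \<ominus> sym_pair A (sym_pair A w (z, z)) (b, c)"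
proof -
  have wc: "w \<in> carrier A" using w by (rule sq_closure_carrier)
  let ?p = "(((w \<otimes> z) \<otimes> z) \<otimes> b) \<otimes> c" and ?q = "(((w \<otimes> z) \<otimes> z) \<otimes> c) \<otimes> b"
  have cl: "?p \<in> carrier A" "?q \<in> carrier A" using wc c by (simp_all add: mult_closed)
  have z: "(((w \<otimes> z) \<otimes> b) \<otimes> z) \<otimes> c = \<zero>" "(((w \<otimes> b) \<otimes> z) \<otimes> c) \<otimes> z = \<zero>"
    using mult_alternate_zero(2)[OF w, of b z c] mult_alternate_zero(3)[OF w, of c z b] c by auto
  have s: "(((w \<otimes> b) \<otimes> z) \<otimes> z) \<otimes> c = \<ominus> ?p" "(((w \<otimes> z) \<otimes> b) \<otimes> c) \<otimes> z = \<ominus> ?q"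
    using skew_odd[OF w, of b z z c] skew_even[OF w, of z b c z] c by auto
  have "sym_pair A (sym_pair A w (z, b)) (z, c) = (\<zero> \<oplus> \<ominus> ?p) \<oplus> (\<ominus> ?q \<oplus> \<zero>)"
    unfolding sym_pair_expand[OF wc c(1,2,1,3)] z s ..
  also have "\<dots> = \<ominus> (?p \<oplus> ?q)" using cl by (simp add: M.minus_add)
  finally have e: "sym_pair A (sym_pair A w (z, b)) (z, c) = \<ominus> (?p \<oplus> ?q)" .
  have "sym_pair A (sym_pair A w (z, z)) (b, c) = 2 \<odot> (?p \<oplus> ?q)"
    unfolding sym_pair_expand[OF wc c(1,1,2,3)] using cl by (simp add: double smult_add_right)
  then show ?thesis using e cl by (simp add: smult_minus)
qed

text \<open>Two of the three occurrences of \<open>z\<close> are at positions of the same parity.\<close>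

lemma sym_pair_triple_zero:
  assumes w: "w \<in> sq_closure" and c: "z \<in> carrier A" "c \<in> carrier A"
  shows "sym_pair A (sym_pair A w (z, z)) (z, c) = \<zero>"
proof -
  have wc: "w \<in> carrier A" using w by (rule sq_closure_carrier)
  have "(((w \<otimes> z) \<otimes> z) \<otimes> z) \<otimes> c = \<zero>" "(((w \<otimes> z) \<otimes> z) \<otimes> c) \<otimes> z = \<zero>"
    using mult_alternate_zero(2)[OF w, of z z c] mult_alternate_zero(3)[OF w, of c z z] c by auto
  then show ?thesis unfolding sym_pair_expand[OF wc c(1,1,1,2)] by simp
qed

lemma sym_pairs_move_front:
  assumes "w \<in> sq_closure" "set (rs @ r # rs') \<subseteq> carrier A \<times> carrier A"
  shows "sym_pairs A w (rs @ r # rs') = sym_pairs A w (r # rs @ rs')"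
  using assms
proof (induct rs arbitrary: w)
  case (Cons s rs)
  have "sym_pair A w s \<in> sq_closure" using Cons by (auto intro: sym_pair_in_sq_closure)
  then have "sym_pairs A w ((s # rs) @ r # rs') = sym_pairs A (sym_pair A w s) (r # rs @ rs')"
    using Cons by simp
  also have "\<dots> = sym_pairs A (sym_pair A (sym_pair A w r) s) (rs @ rs')"
    using sym_pair_swap[OF Cons(2), of "fst s" "snd s" "fst r" "snd r"] Cons(3) by (cases s, cases r) auto
  finally show ?case by simp
qed simp

text \<open>Elimination of letters, by induction on the list \<open>zs\<close>; letters from \<open>H\<close> alone cannot form a nonzero pair. If the
  letter \<open>z\<close> occurs in at most one pair, that pair commutes to the end and can be dropped. If it occurs in
  two pairs, contraction collects both occurrences in a pair \<open>(z, z)\<close>, after which \<open>z\<close> cannot occur in any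
  other pair; absorbing \<open>(z, z)\<close> into \<open>w\<close> again removes \<open>z\<close>. Either way one letter costs one pair.\<close>

lemma sym_pairs_vanish:
  assumes H: "H \<subseteq> carrier A" "\<And>w h h'. \<lbrakk>w \<in> sq_closure; h \<in> H; h' \<in> H\<rbrakk> \<Longrightarrow> sym_pair A w (h, h') = \<zero>"
  shows "\<lbrakk>set zs \<subseteq> carrier A; w \<in> sq_closure; set rs \<subseteq> (set zs \<union> H) \<times> (set zs \<union> H); length zs < length rs\<rbrakk>
    \<Longrightarrow> sym_pairs A w rs = \<zero>"
proof (induct zs arbitrary: w rs)
  case Nil
  then obtain r rs' where rs: "rs = r # rs'" by (cases rs) auto
  then obtain h h' where r: "r = (h, h')" "h \<in> H" "h' \<in> H" using Nil by (cases r) auto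
  have "set rs' \<subseteq> H \<times> H" using Nil rs by auto
  then have "set rs' \<subseteq> carrier A \<times> carrier A" using H(1) by blast
  then show ?case using rs r H(2)[OF Nil(2) r(2,3)] by (simp add: sym_pairs_zero)
next
  case (Cons z zs)
  let ?X = "set zs \<union> H" and ?Y = "set (z # zs) \<union> H"
  let ?z = "\<lambda>r. fst r = z \<or> snd r = z"
  have Yc: "?Y \<subseteq> carrier A" using Cons(2) H(1) by auto
  have rsc: "set rs \<subseteq> carrier A \<times> carrier A" using Cons(4) Yc by blast
  have zc: "z \<in> carrier A" and zsc: "set zs \<subseteq> carrier A" using Cons(2) by auto
  have X: "r \<in> ?X \<times> ?X" if "r \<in> set rs" "\<not> ?z r" for r using that Cons(4) by (cases r) auto
  have wc: "w \<in> carrier A" using Cons(3) by (rule sq_closure_carrier)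
  show ?case
  proof (cases "\<exists>us r vs s ts. rs = us @ r # vs @ s # ts \<and> ?z r \<and> ?z s")
    case False
    show ?thesis
    proof (cases "\<exists>r\<in>set rs. ?z r")
      case True
      then obtain us r vs where rs: "rs = us @ r # vs" "?z r" by (metis in_set_conv_decomp)
      have no: "\<not> ?z s" if "s \<in> set (us @ vs)" for s
      proof
        assume zs: "?z s"
        have "s \<in> set us \<or> s \<in> set vs" using that by simp
        then show False
        proof
          assume "s \<in> set us"
          then obtain a b where "us = a @ s # b" by (meson split_list)
          then have "rs = a @ s # b @ r # vs" using rs(1) by simp
          then show False using False zs rs(2) by blast
        next
          assume "s \<in> set vs"
          then obtain a b where "vs = a @ s # b" by (meson split_list)
          then have "rs = us @ r # a @ s # b" using rs(1) by simp
          then show False using False zs rs(2) by blast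
        qed
      qed
      have "set (us @ vs) \<subseteq> ?X \<times> ?X" using X no rs(1) by auto
      then have 0: "sym_pairs A w (us @ vs) = \<zero>"
        using Cons(5) rs(1) by (intro Cons(1)[OF zsc Cons(3)]) auto
      have c: "set (us @ r # vs) \<subseteq> carrier A \<times> carrier A" using rsc rs(1) by simp
      have "sym_pairs A w rs = sym_pairs A (sym_pair A w r) (us @ vs)"
        using sym_pairs_move_front[OF Cons(3) c] rs(1) by simp
      also have "\<dots> = sym_pair A (sym_pairs A w (us @ vs)) r"
        using sym_pairs_move_front[OF Cons(3), of "us @ vs" r "[]"] c by simp
      also have "\<dots> = \<zero>" unfolding 0 using c by (intro sym_pair_zero) auto
      finally show ?thesis .
    next
      case F: False
      have "set rs \<subseteq> ?X \<times> ?X" using X F by auto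
      then show ?thesis using Cons(5) by (intro Cons(1)[OF zsc Cons(3)]) auto
    qed
  next
    case True
    then obtain us r vs s ts where rs: "rs = us @ r # vs @ s # ts" "?z r" "?z s" by blast
    let ?t = "us @ vs @ ts"
    have c: "set (us @ r # vs @ s # ts) \<subseteq> carrier A \<times> carrier A" using rsc rs(1) by simp
    then have rc: "r \<in> carrier A \<times> carrier A" "s \<in> carrier A \<times> carrier A"
      and tc: "set ?t \<subseteq> carrier A \<times> carrier A" by auto
    have rw: "sym_pair A w r \<in> sq_closure" using Cons(3) rc by (auto intro: sym_pair_in_sq_closure)
    have "sym_pairs A w rs = sym_pairs A (sym_pair A w r) ((us @ vs) @ s # ts)"
      using sym_pairs_move_front[OF Cons(3) c] rs(1) by simp
    also have "\<dots> = sym_pairs A (sym_pair A (sym_pair A w r) s) ?t"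
      using sym_pairs_move_front[OF rw, of "us @ vs" s ts] c by simp
    finally have e1: "sym_pairs A w rs = sym_pairs A (sym_pair A (sym_pair A w r) s) ?t" .
    obtain b where b: "b \<in> ?Y" "sym_pair A u r = sym_pair A u (z, b)" if "u \<in> carrier A" for u
    proof -
      have "r \<in> ?Y \<times> ?Y" using Cons(4) rs(1) by auto
      then show ?thesis using rs(2) rc that sym_pair_commute zc by (cases r) (metis fst_conv mem_Sigma_iff snd_conv)
    qed
    obtain d where d: "d \<in> ?Y" "sym_pair A u s = sym_pair A u (z, d)" if "u \<in> carrier A" for u
    proof -
      have "s \<in> ?Y \<times> ?Y" using Cons(4) rs(1) by auto
      then show ?thesis using rs(3) rc that sym_pair_commute zc by (cases s) (metis fst_conv mem_Sigma_iff snd_conv)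
    qed
    have bd: "b \<in> ?Y" "d \<in> ?Y" "b \<in> carrier A" "d \<in> carrier A" using b(1)[OF wc] d(1)[OF wc] Yc by auto
    let ?w = "sym_pair A w (z, z)"
    have w': "?w \<in> sq_closure" using Cons(3) zc by (auto intro: sym_pair_in_sq_closure)
    have wbc: "sym_pair A w (z, b) \<in> carrier A" using wc zc bd by (auto intro: sym_pair_closed)
    have e2: "sym_pair A (sym_pair A w r) s = sym_pair A (sym_pair A w (z, b)) (z, d)"
      using b(2)[OF wc] d(2)[OF wbc] by simp
    have cl: "sym_pair A (sym_pair A w (z, b)) (z, d) \<in> carrier A"
      "sym_pair A ?w (b, d) \<in> carrier A"
      using wc zc bd by (auto intro!: sym_pair_closed)
    have zero: "sym_pairs A ?w ((b, d) # ?t) = \<zero>"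
    proof (cases "\<exists>r\<in>set ((b, d) # ?t). ?z r")
      case True
      then obtain as r' bs where ab: "(b, d) # ?t = as @ r' # bs" "?z r'" by (metis in_set_conv_decomp)
      have c': "set (as @ r' # bs) \<subseteq> carrier A \<times> carrier A" using ab(1)[symmetric] tc bd by simp
      have "sym_pair A ?w r' = \<zero>"
      proof -
        have "sym_pair A ?w (z, e) = \<zero>" "sym_pair A ?w (e, z) = \<zero>" if "e \<in> carrier A" for e
          using sym_pair_triple_zero[OF Cons(3) zc that] sym_pair_commute[of ?w z e] that zc
            sq_closure_carrier[OF w'] by auto
        then show ?thesis using ab(2) c' by (cases r') auto
      qed
      then show ?thesis using sym_pairs_move_front[OF w' c'] c' ab(1) by (simp add: sym_pairs_zero)
    next
      case F: False
      then have bdX: "b \<in> ?X" "d \<in> ?X" using bd by auto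
      have "set ?t \<subseteq> ?X \<times> ?X"
      proof
        fix x assume "x \<in> set ?t"
        then have "x \<in> set rs" "\<not> ?z x" using F rs(1) by auto
        then show "x \<in> ?X \<times> ?X" by (rule X)
      qed
      then have "set ((b, d) # ?t) \<subseteq> ?X \<times> ?X" using bdX by simp
      then show ?thesis using Cons(5) rs(1) by (intro Cons(1)[OF zsc w']) auto
    qed
    have "2 \<odot> sym_pairs A w rs = sym_pairs A (2 \<odot> sym_pair A (sym_pair A w (z, b)) (z, d)) ?t"
      using sym_pairs_smult[OF cl(1) tc, of 2] by (simp only: e1 e2)
    also have "\<dots> = sym_pairs A ((- 1) \<odot> sym_pair A ?w (b, d)) ?t"
      using sym_pair_contract[OF Cons(3) zc bd(3,4)] cl by (simp only: minus_eq_smult)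
    also have "\<dots> = (- 1) \<odot> sym_pairs A ?w ((b, d) # ?t)"
      using sym_pairs_smult[OF cl(2) tc, of "- 1"] by (simp only: sym_pairs_simps(2))
    also have "\<dots> = \<zero>" unfolding zero by simp
    finally show ?thesis
      using smult_eq_zero[of "sym_pairs A w rs" 2] sym_pairs_closed[OF wc rsc] by simp
  qed
qed

text \<open>A composition of \<open>m\<close> operators that vanishes for parameters in \<open>B\<close> vanishes for parameters in \<open>S\<close>. The set \<open>S\<close>
  stands for a span of \<open>B\<close>, but a parameter may be a pair in which the operator is bilinear; this is why
  the passage from \<open>B\<close> to \<open>S\<close> for a single operator is expressed by \<open>ext\<close>, with an arbitrary
  subspace \<open>K\<close> as the target.\<close>

lemma foldl_vanish_span:
  assumes BS: "B \<subseteq> S" and op: "\<And>w b. \<lbrakk>w \<in> sq_closure; b \<in> S\<rbrakk> \<Longrightarrow> op w b \<in> sq_closure"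
    and lin: "\<And>b. b \<in> B \<Longrightarrow> op \<zero> b = \<zero>"
      "\<And>w w' b. \<lbrakk>w \<in> sq_closure; w' \<in> sq_closure; b \<in> B\<rbrakk> \<Longrightarrow> op (w \<oplus> w') b = op w b \<oplus> op w' b"
      "\<And>c w b. \<lbrakk>w \<in> sq_closure; b \<in> B\<rbrakk> \<Longrightarrow> op (c \<odot> w) b = c \<odot> op w b"
    and ext: "\<And>w K b. \<lbrakk>w \<in> sq_closure; \<And>b. b \<in> B \<Longrightarrow> op w b \<in> K; \<zero> \<in> K;
      \<And>x y. \<lbrakk>x \<in> K; y \<in> K\<rbrakk> \<Longrightarrow> x \<oplus> y \<in> K; \<And>c x. x \<in> K \<Longrightarrow> c \<odot> x \<in> K; b \<in> S\<rbrakk> \<Longrightarrow> op w b \<in> K"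
    and van: "\<And>w bs. \<lbrakk>w \<in> sq_closure; set bs \<subseteq> B; length bs = m\<rbrakk> \<Longrightarrow> foldl op w bs = \<zero>"
    and w: "w \<in> sq_closure" and bs: "set bs \<subseteq> S" "length bs = m"
  shows "foldl op w bs = \<zero>"
proof -
  define K where "K m = {w \<in> sq_closure. \<forall>bs. set bs \<subseteq> B \<and> length bs = m \<longrightarrow> foldl op w bs = \<zero>}" for m
  have F: "foldl op \<zero> bs = \<zero>"
    "\<lbrakk>w \<in> sq_closure; w' \<in> sq_closure\<rbrakk> \<Longrightarrow> foldl op (w \<oplus> w') bs = foldl op w bs \<oplus> foldl op w' bs"
    "w \<in> sq_closure \<Longrightarrow> foldl op (c \<odot> w) bs = c \<odot> foldl op w bs"
    if "set bs \<subseteq> B" for w w' c bs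
    using that op BS lin by (induct bs arbitrary: w w') (auto simp: subset_iff)
  have step: "op w b \<in> K m" if w: "w \<in> K (Suc m)" and b: "b \<in> S" for w b m
  proof (rule ext[OF _ _ _ _ _ b])
    show "w \<in> sq_closure" using w by (simp add: K_def)
    fix b assume b: "b \<in> B"
    have "foldl op (op w b) bs = \<zero>" if "set bs \<subseteq> B" "length bs = m" for bs
    proof -
      have "\<forall>bs. set bs \<subseteq> B \<and> length bs = Suc m \<longrightarrow> foldl op w bs = \<zero>" using w by (simp add: K_def)
      from this[rule_format, of "b # bs"] show ?thesis using b that by simp
    qed
    then show "op w b \<in> K m" using w b BS op by (auto simp: K_def)
  qed (auto simp: K_def F sq_closure_zero sq_closure_add sq_closure_smult)
  have "foldl op w bs = \<zero>" if "w \<in> K (length bs)" "set bs \<subseteq> S" for w bs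
    using that
  proof (induct bs arbitrary: w)
    case Nil then show ?case by (simp add: K_def)
  next
    case (Cons b bs) then show ?case using step[of w "length bs" b] by simp
  qed
  moreover have "w \<in> K (length bs)" using w van bs(2) by (auto simp: K_def)
  ultimately show ?thesis using bs(1) by blast
qed

lemma sym_pairs_vanish_span:
  assumes X: "X \<subseteq> carrier A"
    and van: "\<And>w rs. \<lbrakk>w \<in> sq_closure; set rs \<subseteq> X \<times> X; length rs = m\<rbrakk> \<Longrightarrow> sym_pairs A w rs = \<zero>"
    and w: "w \<in> sq_closure" and rs: "set rs \<subseteq> lin_span X \<times> lin_span X" "length rs = m"
  shows "sym_pairs A w rs = \<zero>"
proof -
  have SX: "lin_span X \<subseteq> carrier A" by (rule lin_span_carrier[OF X])
  have pc: "p \<in> carrier A \<times> carrier A" if "p \<in> lin_span X \<times> lin_span X \<or> p \<in> X \<times> X" for p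
    using that SX X by blast
  show ?thesis
    unfolding sym_pairs_def
  proof (rule foldl_vanish_span[where B = "X \<times> X" and op = "sym_pair A", OF _ _ _ _ _ _ _ w rs])
    show "X \<times> X \<subseteq> lin_span X \<times> lin_span X" using span_base by blast
    show "foldl (sym_pair A) w rs = \<zero>" if "w \<in> sq_closure" "set rs \<subseteq> X \<times> X" "length rs = m" for w rs
      using van[OF that] by (simp only: sym_pairs_def)
  next
    fix w K p assume w: "w \<in> sq_closure" and XK: "\<And>p. p \<in> X \<times> X \<Longrightarrow> sym_pair A w p \<in> K"
      and K: "\<zero> \<in> K" "\<And>x y. \<lbrakk>x \<in> K; y \<in> K\<rbrakk> \<Longrightarrow> x \<oplus> y \<in> K" "\<And>c x. x \<in> K \<Longrightarrow> c \<odot> x \<in> K"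
      and p: "p \<in> lin_span X \<times> lin_span X"
    have wc: "w \<in> carrier A" using w by (rule sq_closure_carrier)
    have sub: "lin_span X \<subseteq> {x \<in> carrier A. sym_pair A w (x, y) \<in> K}"
      if y: "y \<in> carrier A" "\<And>x. x \<in> X \<Longrightarrow> sym_pair A w (x, y) \<in> K" for y
    proof (rule lin_span_subset)
      show "\<zero> \<in> {x \<in> carrier A. sym_pair A w (x, y) \<in> K}"
        using wc y(1) K(1) by (simp add: sym_pair_def mult_closed)
    qed (use X y wc K in \<open>auto simp: sym_pair_add_arg sym_pair_smult_arg\<close>)
    obtain b c where bc: "p = (b, c)" "b \<in> lin_span X" "c \<in> lin_span X" using p by auto
    have b: "b \<in> carrier A" using bc(2) SX by blast
    have "sym_pair A w (b, y) \<in> K" if "y \<in> X" for y using sub[of y] XK bc(2) X that by blast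
    then have "sym_pair A w (y, b) \<in> K" if "y \<in> X" for y
      using that sym_pair_commute[OF wc b, of y] X by auto
    then have "sym_pair A w (c, b) \<in> K" using sub[OF b] bc(3) by blast
    then show "sym_pair A w p \<in> K" using sym_pair_commute[OF wc b, of c] bc SX by auto
  qed (use pc in \<open>auto simp: sym_pair_in_sq_closure sym_pair_zero sym_pair_add sym_pair_smult sq_closure_carrier
        simp del: mem_Sigma_iff\<close>)
qed

section \<open>Nilpotency\<close>

text \<open>Pigeonhole principle: more than \<open>card Z\<close> of the letters stand at odd positions, so one of them is repeated
  there, and permuting the letters at odd positions makes its two occurrences neighbours.\<close>

lemma rmul_vanish:
  assumes Z: "finite Z" "Z \<subseteq> carrier A" and w: "w \<in> sq_closure"
    and cs: "set cs \<subseteq> Z \<union> sq_ann" "2 * card Z < length cs"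
  shows "rmul A w cs = \<zero>"
proof (cases "\<exists>c\<in>set cs. c \<in> sq_ann")
  case True
  then obtain us c vs where c: "cs = us @ c # vs" "c \<in> sq_ann" by (metis in_set_conv_decomp)
  have cc: "set cs \<subseteq> carrier A" using cs(1) Z sq_ann_carrier by auto
  then have "rmul A w us \<in> sq_closure" using w c(1) by (intro rmul_in_sq_closure) auto
  then have "rmul A w us \<otimes> c = \<zero>" using c(2) by (auto simp: sq_closure_def)
  then show ?thesis using c(1) cc rmul_zero[of vs] by simp
next
  case False
  then have csZ: "set cs \<subseteq> Z" using cs(1) by auto
  obtain ts ds where e: "cs = interleave ts ds" and l: "length ts = (length cs + 1) div 2"
    "length ds = length cs div 2" using interleave_exists by blast
  have "set ts \<subseteq> Z" using csZ e by simp
  then have "card (set ts) < length ts" using card_mono[OF Z(1), of "set ts"] l(1) cs(2) by linarith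
  then have "\<not> distinct ts" using distinct_card by fastforce
  then obtain us vs rs z where ts: "ts = us @ [z] @ vs @ [z] @ rs" using not_distinct_decomp by blast
  let ?ts = "z # z # us @ vs @ rs"
  have lds: "length ts \<le> Suc (length ds)" using l by linarith
  have P: "rmul A w (interleave ts ds) = \<zero>"
  proof (rule permute_by_swaps[where Q = "\<lambda>l. rmul A w (interleave l ds) = \<zero>" and ts = ?ts])
    have "length ds \<noteq> 0" using lds ts by auto
    then obtain d ds' where d: "ds = d # ds'" by (cases ds) auto
    have "set (z # d # z # interleave ds' (us @ vs @ rs)) \<subseteq> carrier A" using csZ Z(2) e ts d by auto
    then show "rmul A w (interleave ?ts ds) = \<zero>"
      using mult_alternate_zero(1)[OF w, of d z z] rmul_zero[of "interleave ds' (us @ vs @ rs)"] d by simp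
    show "mset ?ts = mset ts" by (simp add: ts)
    fix xs x y ys
    assume h: "mset (xs @ x # y # ys) = mset ?ts" "rmul A w (interleave (xs @ x # y # ys) ds) = \<zero>"
    have "length (xs @ x # y # ys) = length ts" using mset_eq_length[OF h(1)] ts by simp
    then have "length xs < length ds" using lds by simp
    then obtain us' d vs' where i: "\<forall>x y. interleave (xs @ x # y # ys) ds = us' @ [x, d, y] @ vs'"
      using interleave_swap_first by blast
    have st: "set (xs @ x # y # ys) = set ts" using mset_eq_setD[OF h(1)] ts by auto
    have "set (us' @ [x, d, y] @ vs') = set ts \<union> set ds" using i st by (metis set_interleave)
    moreover have "set ts \<union> set ds \<subseteq> carrier A" using csZ Z(2) e by auto
    ultimately have c: "set (us' @ [x, d, y] @ vs') \<subseteq> carrier A" by simp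
    have "rmul A w (us' @ [y, d, x] @ vs') = \<ominus> rmul A w (us' @ [x, d, y] @ vs')"
      by (rule rmul_skew[OF w]) (use c in auto)
    then show "rmul A w (interleave (xs @ y # x # ys) ds) = \<zero>" using h(2) by (simp only: i minus_zero_alg)
  qed
  then show ?thesis using e by simp
qed

lemma rmul_vanish_span:
  assumes X: "X \<subseteq> carrier A"
    and van: "\<And>w cs. \<lbrakk>w \<in> sq_closure; set cs \<subseteq> X; length cs = m\<rbrakk> \<Longrightarrow> rmul A w cs = \<zero>"
    and w: "w \<in> sq_closure" and cs: "set cs \<subseteq> lin_span X" "length cs = m"
  shows "rmul A w cs = \<zero>"
  unfolding rmul_def
proof (rule foldl_vanish_span[where B = X and op = "monoid.mult A", OF _ _ _ _ _ _ _ w cs])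
  show "X \<subseteq> lin_span X" using span_base by blast
  show "foldl (\<otimes>) w cs = \<zero>" if "w \<in> sq_closure" "set cs \<subseteq> X" "length cs = m" for w cs
    using van[OF that] by (simp only: rmul_def)
next
  fix w K b assume w: "w \<in> sq_closure" and XK: "\<And>b. b \<in> X \<Longrightarrow> w \<otimes> b \<in> K"
    and K: "\<zero> \<in> K" "\<And>x y. \<lbrakk>x \<in> K; y \<in> K\<rbrakk> \<Longrightarrow> x \<oplus> y \<in> K" "\<And>c x. x \<in> K \<Longrightarrow> c \<odot> x \<in> K"
    and b: "b \<in> lin_span X"
  have "lin_span X \<subseteq> {x \<in> carrier A. w \<otimes> x \<in> K}"
    by (rule lin_span_subset)
      (use X XK K sq_closure_carrier[OF w] in \<open>auto simp: distrib_left smult_mult_right\<close>)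
  then show "w \<otimes> b \<in> K" using b by blast
qed (use X lin_span_carrier[OF X] in
    \<open>auto simp: subset_iff sq_closure_carrier distrib_right smult_mult_left intro!: mult_in_sq_closure\<close>)

end

section \<open>Quotients of superalgebras\<close>

lemma nonassoc_algebra_image:
  fixes C :: "('f::field_char_0, 'b, 'n) module_scheme"
  assumes "nonassoc_algebra A" and h: "algebra_hom A C h" and surj: "carrier C = h ` carrier A"
    and zero: "\<zero>\<^bsub>C\<^esub> = h \<zero>\<^bsub>A\<^esub>"
  shows "nonassoc_algebra C"
proof -
  interpret A: nonassoc_algebra A by fact
  note hom = algebra_homD(2-4)[OF h, symmetric]
  show ?thesis
  proof (rule nonassoc_algebraI)
    fix x y z assume "x \<in> carrier C" "y \<in> carrier C" "z \<in> carrier C"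
    then obtain x' y' z' where e: "x = h x'" "y = h y'" "z = h z'"
      and c: "x' \<in> carrier A" "y' \<in> carrier A" "z' \<in> carrier A" by (auto simp: surj)
    show "x \<oplus>\<^bsub>C\<^esub> y \<oplus>\<^bsub>C\<^esub> z = x \<oplus>\<^bsub>C\<^esub> (y \<oplus>\<^bsub>C\<^esub> z)" using c by (simp add: e hom A.M.a_assoc)
    show "(x \<oplus>\<^bsub>C\<^esub> y) \<otimes>\<^bsub>C\<^esub> z = x \<otimes>\<^bsub>C\<^esub> z \<oplus>\<^bsub>C\<^esub> y \<otimes>\<^bsub>C\<^esub> z"
      using c by (simp add: e hom A.distrib_right A.mult_closed)
    show "x \<otimes>\<^bsub>C\<^esub> (y \<oplus>\<^bsub>C\<^esub> z) = x \<otimes>\<^bsub>C\<^esub> y \<oplus>\<^bsub>C\<^esub> x \<otimes>\<^bsub>C\<^esub> z"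
      using c by (simp add: e hom A.distrib_left A.mult_closed)
  next
    fix x y assume "x \<in> carrier C" "y \<in> carrier C"
    then obtain x' y' where e: "x = h x'" "y = h y'" and c: "x' \<in> carrier A" "y' \<in> carrier A"
      by (auto simp: surj)
    show "x \<oplus>\<^bsub>C\<^esub> y \<in> carrier C" using c by (simp add: e hom surj)
    show "x \<otimes>\<^bsub>C\<^esub> y \<in> carrier C" using c by (simp add: e hom surj A.mult_closed)
    show "x \<oplus>\<^bsub>C\<^esub> y = y \<oplus>\<^bsub>C\<^esub> x" using c by (simp add: e hom A.M.a_comm)
    fix k
    show "k \<odot>\<^bsub>C\<^esub> (x \<oplus>\<^bsub>C\<^esub> y) = k \<odot>\<^bsub>C\<^esub> x \<oplus>\<^bsub>C\<^esub> k \<odot>\<^bsub>C\<^esub> y"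
      using c by (simp add: e hom A.smult_add_right)
    show "(k \<odot>\<^bsub>C\<^esub> x) \<otimes>\<^bsub>C\<^esub> y = k \<odot>\<^bsub>C\<^esub> (x \<otimes>\<^bsub>C\<^esub> y)"
      using c by (simp add: e hom A.smult_mult_left A.mult_closed)
    show "x \<otimes>\<^bsub>C\<^esub> (k \<odot>\<^bsub>C\<^esub> y) = k \<odot>\<^bsub>C\<^esub> (x \<otimes>\<^bsub>C\<^esub> y)"
      using c by (simp add: e hom A.smult_mult_right A.mult_closed)
  next
    fix x assume "x \<in> carrier C"
    then obtain x' where e: "x = h x'" and c: "x' \<in> carrier A" by (auto simp: surj)
    show "\<zero>\<^bsub>C\<^esub> \<oplus>\<^bsub>C\<^esub> x = x" using c by (simp add: e hom zero)
    show "1 \<odot>\<^bsub>C\<^esub> x = x" using c by (simp add: e hom)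
    show "0 \<odot>\<^bsub>C\<^esub> x = \<zero>\<^bsub>C\<^esub>" using c by (simp add: e hom zero)
    fix a b
    show "a \<odot>\<^bsub>C\<^esub> x \<in> carrier C" using c by (simp add: e hom surj)
    show "(a + b) \<odot>\<^bsub>C\<^esub> x = a \<odot>\<^bsub>C\<^esub> x \<oplus>\<^bsub>C\<^esub> b \<odot>\<^bsub>C\<^esub> x" using c by (simp add: e hom A.smult_add_left)
    show "(a * b) \<odot>\<^bsub>C\<^esub> x = a \<odot>\<^bsub>C\<^esub> (b \<odot>\<^bsub>C\<^esub> x)" using c by (simp add: e hom A.smult_smult)
  qed (simp add: surj zero)
qed

lemma quotient_simps:
  "carrier (quotient_superalgebra A I) = a_rcosets\<^bsub>A\<^esub> I"
  "monoid.mult (quotient_superalgebra A I) = rcoset_mult A I"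
  "zero (quotient_superalgebra A I) = I"
  "add (quotient_superalgebra A I) = set_add A"
  "smult (quotient_superalgebra A I) = (\<lambda>c X. \<Union>x\<in>X. I +>\<^bsub>A\<^esub> (c \<odot>\<^bsub>A\<^esub> x))"
  "grade (quotient_superalgebra A I) i = (\<lambda>x. I +>\<^bsub>A\<^esub> x) ` grade A i"
  by (simp_all add: quotient_superalgebra_def)

context superalgebra
begin

context
  fixes I assumes I: "graded_ideal A I"
begin

abbreviation "Q \<equiv> quotient_superalgebra A I"

lemma ideal_submodule: "submodule I scalars A"
  using I by (simp add: graded_ideal_def)

lemma ideal_facts:
  shows ideal_carrier: "x \<in> I \<Longrightarrow> x \<in> carrier A"
    and ideal_zero: "\<zero> \<in> I"
    and ideal_add: "\<lbrakk>x \<in> I; y \<in> I\<rbrakk> \<Longrightarrow> x \<oplus> y \<in> I"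
    and ideal_minus: "x \<in> I \<Longrightarrow> \<ominus> x \<in> I"
    and ideal_smult: "x \<in> I \<Longrightarrow> c \<odot> x \<in> I"
    and ideal_mult: "\<lbrakk>x \<in> carrier A; y \<in> I\<rbrakk> \<Longrightarrow> x \<otimes> y \<in> I" "\<lbrakk>x \<in> carrier A; y \<in> I\<rbrakk> \<Longrightarrow> y \<otimes> x \<in> I"
proof -
  note E = submoduleE[OF ideal_submodule]
  show "x \<in> carrier A" if "x \<in> I" using E(1) that by auto
  obtain y where y: "y \<in> I" using E(2) by auto
  then have "0 \<odot> y \<in> I" using E(4)[of 0 y] by simp
  then show "\<zero> \<in> I" using y E(1) by auto
  show "x \<oplus> y \<in> I" if "x \<in> I" "y \<in> I" for x y using E(5) that by auto
  show "\<ominus> x \<in> I" if "x \<in> I" using E(3) that by auto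
  show "c \<odot> x \<in> I" if "x \<in> I" using E(4)[of c x] that by auto
  show "x \<otimes> y \<in> I" "y \<otimes> x \<in> I" if "x \<in> carrier A" "y \<in> I" for x y
    using I that by (auto simp: graded_ideal_def)
qed

lemma ideal_decompose:
  assumes "x \<in> I"
  obtains y z where "y \<in> I" "y \<in> grade A 0" "z \<in> I" "z \<in> grade A 1" "x = y \<oplus> z"
proof -
  have "x \<in> (I \<inter> grade A 0) <+> (I \<inter> grade A 1)" using I assms by (auto simp: graded_ideal_def)
  then show ?thesis using that by (auto simp: set_add_def')
qed

lemma ideal_abelian_subgroup: "abelian_subgroup I A"
  by (rule abelian_subgroupI3[OF additive_subgroup.intro M.abelian_group_axioms])
    (rule submodule.axioms(1)[OF ideal_submodule])

abbreviation coset where "coset x \<equiv> I +> x"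

lemma coset_eq_iff: "\<lbrakk>x \<in> carrier A; y \<in> carrier A\<rbrakk> \<Longrightarrow> coset x = coset y \<longleftrightarrow> y \<oplus> \<ominus> x \<in> I"
  using abelian_subgroup.a_rcos_module[OF ideal_abelian_subgroup, of x y]
    abelian_subgroup.a_repr_independence'[OF ideal_abelian_subgroup, of y x]
    abelian_subgroup.a_repr_independenceD[OF ideal_abelian_subgroup, of y x]
  by blast

lemma coset_zero_iff: "x \<in> carrier A \<Longrightarrow> coset x = I \<longleftrightarrow> x \<in> I"
proof -
  assume x: "x \<in> carrier A"
  have "coset \<zero> = I" using ideal_facts(1) by (intro a_coset_add_zero) auto
  then show ?thesis using coset_eq_iff[of \<zero> x] x by auto
qed

lemma coset_mem: "\<lbrakk>x \<in> carrier A; y \<in> coset x\<rbrakk> \<Longrightarrow> y \<in> carrier A \<and> y \<oplus> \<ominus> x \<in> I"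
proof -
  assume h: "x \<in> carrier A" "y \<in> coset x"
  have "y \<in> carrier A" using h ideal_carrier by (auto simp: a_r_coset_def')
  then show ?thesis
    using abelian_subgroup.a_rcos_module[OF ideal_abelian_subgroup, of x y] h by simp
qed

lemma coset_self: "x \<in> carrier A \<Longrightarrow> x \<in> coset x"
  by (rule abelian_subgroup.a_rcos_self[OF ideal_abelian_subgroup])

lemma coset_add: "\<lbrakk>x \<in> carrier A; y \<in> carrier A\<rbrakk> \<Longrightarrow> coset x <+> coset y = coset (x \<oplus> y)"
  by (rule abelian_subgroup.a_rcos_sum[OF ideal_abelian_subgroup])

lemma coset_mult:
  assumes x: "x \<in> carrier A" and y: "y \<in> carrier A"
  shows "rcoset_mult A I (coset x) (coset y) = coset (x \<otimes> y)"
proof -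
  have "coset (a \<otimes> b) = coset (x \<otimes> y)" if "a \<in> coset x" "b \<in> coset y" for a b
  proof -
    have a: "a \<in> carrier A" "a \<oplus> \<ominus> x \<in> I" and b: "b \<in> carrier A" "b \<oplus> \<ominus> y \<in> I"
      using coset_mem[OF x that(1)] coset_mem[OF y that(2)] by auto
    have "(a \<oplus> \<ominus> x) \<otimes> b \<oplus> x \<otimes> (b \<oplus> \<ominus> y) \<in> I"
      by (rule ideal_add[OF ideal_mult(2)[OF b(1) a(2)] ideal_mult(1)[OF x b(2)]])
    moreover have "(a \<oplus> \<ominus> x) \<otimes> b \<oplus> x \<otimes> (b \<oplus> \<ominus> y) = a \<otimes> b \<oplus> \<ominus> (x \<otimes> y)"
      using a b x y
      by (simp add: distrib_left distrib_right mult_minus minus_mult mult_closed M.a_assoc M.r_neg1)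
    ultimately show ?thesis using coset_eq_iff[of "x \<otimes> y" "a \<otimes> b"] a b x y by (simp add: mult_closed)
  qed
  then show ?thesis unfolding rcoset_mult_def using coset_self[OF x] coset_self[OF y] by blast
qed

lemma coset_smult:
  assumes x: "x \<in> carrier A"
  shows "(\<Union>a\<in>coset x. coset (c \<odot> a)) = coset (c \<odot> x)"
proof -
  have "coset (c \<odot> a) = coset (c \<odot> x)" if "a \<in> coset x" for a
  proof -
    have a: "a \<in> carrier A" "a \<oplus> \<ominus> x \<in> I" using coset_mem[OF x that] by auto
    have "c \<odot> (a \<oplus> \<ominus> x) \<in> I" using a by (intro ideal_smult)
    then show ?thesis using coset_eq_iff[of "c \<odot> x" "c \<odot> a"] a x
      by (simp add: smult_add_right smult_minus)
  qed
  then show ?thesis using coset_self[OF x] by blast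
qed

lemma coset_hom: "algebra_hom A Q coset"
  unfolding algebra_hom_def
  by (auto simp: quotient_simps coset_add coset_mult coset_smult A_RCOSETS_def')

lemma quotient_carrier: "carrier Q = coset ` carrier A"
  by (auto simp: quotient_simps A_RCOSETS_def')

lemma quotient_nonassoc_algebra: "nonassoc_algebra Q"
  by (rule nonassoc_algebra_image[OF nonassoc_algebra_axioms coset_hom quotient_carrier])
    (use coset_zero_iff[of \<zero>] ideal_zero in \<open>simp add: quotient_simps\<close>)

lemma quotient_superalgebra: "superalgebra Q"
proof (intro superalgebra.intro superalgebra_axioms.intro quotient_nonassoc_algebra)
  interpret Q: nonassoc_algebra Q by (rule quotient_nonassoc_algebra)
  note hom = algebra_homD[OF coset_hom]
  show "submodule (grade Q i) scalars Q" for i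
  proof (rule Q.submoduleI)
    show "grade Q i \<subseteq> carrier Q" using grade_carrier by (auto simp: quotient_simps(6) quotient_carrier)
    show "\<zero>\<^bsub>Q\<^esub> \<in> grade Q i" using coset_zero_iff[of \<zero>] ideal_zero
      by (auto simp: quotient_simps(3,6) intro!: image_eqI[of _ _ \<zero>])
    show "x \<oplus>\<^bsub>Q\<^esub> y \<in> grade Q i" if "x \<in> grade Q i" "y \<in> grade Q i" for x y
      using that grade_carrier by (auto simp: quotient_simps(6) hom(2)[symmetric] intro!: imageI grade_add)
    show "c \<odot>\<^bsub>Q\<^esub> x \<in> grade Q i" if "x \<in> grade Q i" for c x
      using that grade_carrier by (auto simp: quotient_simps(6) hom(4)[symmetric] intro!: imageI grade_smult)
    then show "\<ominus>\<^bsub>Q\<^esub> x \<in> grade Q i" if "x \<in> grade Q i" for x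
      using that \<open>grade Q i \<subseteq> carrier Q\<close> by (subst Q.minus_eq_smult) auto
  qed
  show "carrier Q = grade Q 0 <+>\<^bsub>Q\<^esub> grade Q 1"
  proof
    show "carrier Q \<subseteq> grade Q 0 <+>\<^bsub>Q\<^esub> grade Q 1"
    proof
      fix X assume "X \<in> carrier Q"
      then obtain x where x: "x \<in> carrier A" "X = coset x" by (auto simp: quotient_carrier)
      obtain y z where yz: "y \<in> grade A 0" "z \<in> grade A 1" "x = y \<oplus> z" using grade_decompose[OF x(1)] .
      then have "X = coset y \<oplus>\<^bsub>Q\<^esub> coset z" using x hom(2) grade_carrier by simp
      then show "X \<in> grade Q 0 <+>\<^bsub>Q\<^esub> grade Q 1" using yz by (auto simp: set_add_def' quotient_simps(6))
    qed
    show "grade Q 0 <+>\<^bsub>Q\<^esub> grade Q 1 \<subseteq> carrier Q"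
      using grade_carrier by (auto simp: set_add_def' quotient_simps(6) hom(2)[symmetric] quotient_carrier)
  qed
  show "grade Q 0 \<inter> grade Q 1 = {\<zero>\<^bsub>Q\<^esub>}"
  proof
    show "grade Q 0 \<inter> grade Q 1 \<subseteq> {\<zero>\<^bsub>Q\<^esub>}"
    proof
      fix X assume "X \<in> grade Q 0 \<inter> grade Q 1"
      then obtain y z where yz: "y \<in> grade A 0" "z \<in> grade A 1" "X = coset y" "X = coset z"
        by (auto simp: quotient_simps(6))
      have c: "y \<in> carrier A" "z \<in> carrier A" using yz grade_carrier by auto
      have "z \<oplus> \<ominus> y \<in> I" using coset_eq_iff[OF c] yz by simp
      then obtain u v where uv: "u \<in> I" "u \<in> grade A 0" "v \<in> I" "v \<in> grade A 1" "z \<oplus> \<ominus> y = u \<oplus> v"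
        by (rule ideal_decompose)
      have uvc: "u \<in> carrier A" "v \<in> carrier A" using uv ideal_carrier by auto
      have "u \<oplus> y \<in> grade A 0" using uv yz by (intro grade_add)
      moreover have "v \<oplus> \<ominus> z \<in> grade A 1"
        using uv(4) grade_smult[OF yz(2), of "- 1"] c by (intro grade_add) (simp_all add: minus_eq_smult)
      moreover have "(u \<oplus> y) \<oplus> (v \<oplus> \<ominus> z) = \<zero>"
      proof -
        have "(u \<oplus> y) \<oplus> (v \<oplus> \<ominus> z) = (u \<oplus> v) \<oplus> (y \<oplus> \<ominus> z)" using uvc c by (simp add: M.a_ac)
        also have "\<dots> = (z \<oplus> \<ominus> y) \<oplus> (y \<oplus> \<ominus> z)" using uv(5) by simp
        also have "\<dots> = \<zero>" using c by (simp add: M.a_assoc M.r_neg M.r_neg1)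
        finally show ?thesis .
      qed
      ultimately have "v \<oplus> \<ominus> z = \<zero>" by (rule grade_sum_zero(2))
      then have "v = z" using uvc c M.minus_equality[of v "\<ominus> z"] by simp
      then show "X \<in> {\<zero>\<^bsub>Q\<^esub>}" using uv(3) yz(4) coset_zero_iff[OF c(2)] by (simp add: quotient_simps(3))
    qed
    have "coset \<zero> = I" using coset_zero_iff[of \<zero>] ideal_zero by simp
    then show "{\<zero>\<^bsub>Q\<^esub>} \<subseteq> grade Q 0 \<inter> grade Q 1"
      by (auto simp: quotient_simps(3,6) intro!: image_eqI[of _ _ \<zero>])
  qed
  show "x \<otimes>\<^bsub>Q\<^esub> y \<in> grade Q (i + j)" if xy: "x \<in> grade Q i" "y \<in> grade Q j" for x y i j
  proof -
    obtain u v where "u \<in> grade A i" "v \<in> grade A j" "x = coset u" "y = coset v"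
      using xy by (auto simp: quotient_simps(6))
    then show ?thesis unfolding quotient_simps(6)
      using grade_carrier hom(3) by (intro image_eqI[OF _ grade_mult[of u i v j]]) auto
  qed
qed

lemma quotient_satisfies_iff:
  "satisfies_superidentity Q f \<longleftrightarrow>
    (\<forall>p a. (\<forall>i. a i \<in> grade A (p i)) \<longrightarrow> eval_polynomial A a (superization p f) \<in> I)"
proof -
  have ev: "eval_polynomial Q (\<lambda>i. coset (a i)) (superization p f) = \<zero>\<^bsub>Q\<^esub> \<longleftrightarrow>
      eval_polynomial A a (superization p f) \<in> I" if "\<forall>i. a i \<in> grade A (p i)" for a p
  proof -
    have c: "a i \<in> carrier A" for i using that grade_carrier by auto
    have "coset (eval_polynomial A a (superization p f)) = eval_polynomial Q (\<lambda>i. coset (a i)) (superization p f)"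
      by (rule algebra_hom_eval_polynomial[OF nonassoc_algebra_axioms quotient_nonassoc_algebra coset_hom]) (rule c)
    moreover have "eval_polynomial A a (superization p f) \<in> carrier A"
      using c by (intro eval_polynomial_closed eval_monomial_closed)
    ultimately show ?thesis
      using coset_zero_iff[of "eval_polynomial A a (superization p f)"] by (simp add: quotient_simps(3))
  qed
  show ?thesis
  proof
    assume s: "satisfies_superidentity Q f"
    show "\<forall>p a. (\<forall>i. a i \<in> grade A (p i)) \<longrightarrow> eval_polynomial A a (superization p f) \<in> I"
      using s ev unfolding satisfies_superidentity_def by (fastforce simp: quotient_simps(6))
  next
    assume s: "\<forall>p a. (\<forall>i. a i \<in> grade A (p i)) \<longrightarrow> eval_polynomial A a (superization p f) \<in> I"
    show "satisfies_superidentity Q f"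
      unfolding satisfies_superidentity_def
    proof (intro allI impI)
      fix p :: "nat \<Rightarrow> bit" and b assume "\<forall>i. b i \<in> grade Q (p i)"
      then have "\<forall>i. \<exists>x. x \<in> grade A (p i) \<and> b i = coset x" by (auto simp: quotient_simps(6))
      then obtain a where a: "\<forall>i. a i \<in> grade A (p i)" "b = (\<lambda>i. coset (a i))" by metis
      then show "eval_polynomial Q b (superization p f) = \<zero>\<^bsub>Q\<^esub>" using s ev by simp
    qed
  qed
qed

end

end

definition hom_kernel :: "('f::field_char_0, 'a, 'm) module_scheme \<Rightarrow> ('f, 'b, 'n) module_scheme \<Rightarrow> ('a \<Rightarrow> 'b) \<Rightarrow> 'a set" where
  "hom_kernel A B h = {x \<in> carrier A. h x = \<zero>\<^bsub>B\<^esub>}"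

lemma graded_ideal_kernel:
  assumes "superalgebra A" "superalgebra B" and h: "graded_hom A B h"
  shows "graded_ideal A (hom_kernel A B h)"
proof -
  interpret A: superalgebra A by fact
  interpret B: superalgebra B by fact
  have ah: "algebra_hom A B h" and gr: "\<And>i x. x \<in> grade A i \<Longrightarrow> h x \<in> grade B i"
    using h by (auto simp: graded_hom_def)
  note hom = algebra_homD[OF ah]
  have h0: "h \<zero>\<^bsub>A\<^esub> = \<zero>\<^bsub>B\<^esub>" by (rule algebra_hom_zero[OF _ _ ah]) unfold_locales
  let ?I = "hom_kernel A B h"
  show ?thesis
    unfolding graded_ideal_def
  proof (intro conjI ballI)
    show "submodule ?I scalars A"
    proof (rule A.submoduleI)
      show "\<ominus>\<^bsub>A\<^esub> x \<in> ?I" if "x \<in> ?I" for x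
        using that by (auto simp: hom_kernel_def A.minus_eq_smult hom)
    qed (auto simp: hom_kernel_def hom h0)
    fix x y assume "x \<in> carrier A" "y \<in> ?I"
    then show "x \<otimes>\<^bsub>A\<^esub> y \<in> ?I" "y \<otimes>\<^bsub>A\<^esub> x \<in> ?I"
      by (auto simp: hom_kernel_def hom A.mult_closed)
  next
    show "?I = (?I \<inter> grade A 0) <+>\<^bsub>A\<^esub> (?I \<inter> grade A 1)"
    proof
      show "?I \<subseteq> (?I \<inter> grade A 0) <+>\<^bsub>A\<^esub> (?I \<inter> grade A 1)"
      proof
        fix x assume "x \<in> ?I"
        then have x: "x \<in> carrier A" "h x = \<zero>\<^bsub>B\<^esub>" by (auto simp: hom_kernel_def)
        obtain y z where yz: "y \<in> grade A 0" "z \<in> grade A 1" "x = y \<oplus>\<^bsub>A\<^esub> z" using A.grade_decompose[OF x(1)] .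
        then have c: "y \<in> carrier A" "z \<in> carrier A" using A.grade_carrier by auto
        have "h y \<oplus>\<^bsub>B\<^esub> h z = \<zero>\<^bsub>B\<^esub>" using x(2) yz(3) hom(2)[OF c] by simp
        then have "h y = \<zero>\<^bsub>B\<^esub>" "h z = \<zero>\<^bsub>B\<^esub>" using B.grade_sum_zero gr yz by blast+
        then show "x \<in> (?I \<inter> grade A 0) <+>\<^bsub>A\<^esub> (?I \<inter> grade A 1)"
          using yz c by (auto simp: set_add_def' hom_kernel_def)
      qed
      show "(?I \<inter> grade A 0) <+>\<^bsub>A\<^esub> (?I \<inter> grade A 1) \<subseteq> ?I"
        by (auto simp: set_add_def' hom_kernel_def hom)
    qed
  qed
qed

text \<open>The quotient embeds into \<open>B\<close>, and so do the Grassmann envelopes.\<close>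

lemma quotient_by_kernel:
  assumes A: "superalgebra A" and B: "jordan_metabelian_superalgebra B" and h: "graded_hom A B h"
  shows "jordan_metabelian_superalgebra (quotient_superalgebra A (hom_kernel A B h))"
proof -
  interpret A: superalgebra A by fact
  have B': "superalgebra B" using B by (simp add: jordan_metabelian_superalgebra_def)
  interpret B: superalgebra B by fact
  let ?I = "hom_kernel A B h"
  let ?Q = "quotient_superalgebra A ?I"
  have I: "graded_ideal A ?I" by (rule graded_ideal_kernel[OF A B' h])
  have ah: "algebra_hom A B h" and gr: "\<And>i x. x \<in> grade A i \<Longrightarrow> h x \<in> grade B i"
    using h by (auto simp: graded_hom_def)
  note hom = algebra_homD[OF ah]
  have hm: "h (\<ominus>\<^bsub>A\<^esub> x) = \<ominus>\<^bsub>B\<^esub> h x" if "x \<in> carrier A" for x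
    by (rule algebra_hom_minus[OF _ _ ah that]) unfold_locales
  have eq: "?I +>\<^bsub>A\<^esub> x = ?I +>\<^bsub>A\<^esub> y \<longleftrightarrow> h x = h y" if "x \<in> carrier A" "y \<in> carrier A" for x y
  proof -
    have "h (y \<oplus>\<^bsub>A\<^esub> \<ominus>\<^bsub>A\<^esub> x) = h y \<oplus>\<^bsub>B\<^esub> \<ominus>\<^bsub>B\<^esub> h x" using that by (simp add: hom hm)
    moreover have "h y \<oplus>\<^bsub>B\<^esub> \<ominus>\<^bsub>B\<^esub> h x = \<zero>\<^bsub>B\<^esub> \<longleftrightarrow> h x = h y"
    proof
      assume "h y \<oplus>\<^bsub>B\<^esub> \<ominus>\<^bsub>B\<^esub> h x = \<zero>\<^bsub>B\<^esub>"
      then have "\<ominus>\<^bsub>B\<^esub> (\<ominus>\<^bsub>B\<^esub> h x) = h y" using that hom(1) by (intro B.M.minus_equality) auto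
      then show "h x = h y" using that hom(1) by simp
    qed (use that hom(1) in \<open>simp add: B.M.r_neg\<close>)
    moreover have "y \<oplus>\<^bsub>A\<^esub> \<ominus>\<^bsub>A\<^esub> x \<in> ?I \<longleftrightarrow> h (y \<oplus>\<^bsub>A\<^esub> \<ominus>\<^bsub>A\<^esub> x) = \<zero>\<^bsub>B\<^esub>"
      using that by (simp add: hom_kernel_def)
    ultimately show ?thesis using A.coset_eq_iff[OF I that] by metis
  qed
  define g where "g X = h (SOME x. x \<in> carrier A \<and> X = ?I +>\<^bsub>A\<^esub> x)" for X
  have g: "g (?I +>\<^bsub>A\<^esub> x) = h x" if "x \<in> carrier A" for x
  proof -
    have "\<exists>y. y \<in> carrier A \<and> ?I +>\<^bsub>A\<^esub> x = ?I +>\<^bsub>A\<^esub> y" using that by auto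
    from someI_ex[OF this] have y: "(SOME y. y \<in> carrier A \<and> ?I +>\<^bsub>A\<^esub> x = ?I +>\<^bsub>A\<^esub> y) \<in> carrier A"
       "?I +>\<^bsub>A\<^esub> x = ?I +>\<^bsub>A\<^esub> (SOME y. y \<in> carrier A \<and> ?I +>\<^bsub>A\<^esub> x = ?I +>\<^bsub>A\<^esub> y)"
      by blast+
    show ?thesis unfolding g_def by (rule eq[OF that y(1), THEN iffD1, OF y(2), symmetric])
  qed
  note chom = algebra_homD(2-4)[OF A.coset_hom[OF I], symmetric]
  have "graded_hom ?Q B g"
    unfolding graded_hom_def algebra_hom_def
    by (auto simp: A.quotient_carrier[OF I] g hom chom A.mult_closed quotient_simps(6) gr A.grade_carrier)
  moreover have "inj_on g (carrier ?Q)"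
    by (auto simp: A.quotient_carrier[OF I] inj_on_def g eq)
  ultimately show ?thesis
    using envelope_jordan_metabelian_embed[OF A.quotient_superalgebra[OF I] B] by blast
qed

section \<open>The free nonassociative superalgebra\<close>

definition gens :: "nat \<Rightarrow> nat \<Rightarrow> (nat + nat) set" where
  "gens r s = Inl ` {..<r} \<union> Inr ` {..<s}"

definition monom :: "'v monomial \<Rightarrow> ('f::field_char_0, 'v) polynomial" where
  "monom w = (\<lambda>v. if v = w then 1 else 0)"

lemma monom_apply: "monom w v = (if v = w then 1 else 0)"
  by (simp add: monom_def)

lemma free_nonassoc_simps:
  "f \<in> carrier (free_nonassoc_superalgebra r s) \<longleftrightarrow>
    finite {w. f w \<noteq> 0} \<and> (\<forall>w. f w \<noteq> 0 \<longrightarrow> vars w \<subseteq> gens r s)"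
  "zero (free_nonassoc_superalgebra r s) = (\<lambda>w. 0)"
  "add (free_nonassoc_superalgebra r s) f g = (\<lambda>w. f w + g w)"
  "smult (free_nonassoc_superalgebra r s) c f = (\<lambda>w. c * f w)"
  "monoid.mult (free_nonassoc_superalgebra r s) f g = (\<lambda>w. case w of Var x \<Rightarrow> 0 | Mul u v \<Rightarrow> f u * g v)"
  "f \<in> grade (free_nonassoc_superalgebra r s) i \<longleftrightarrow>
    f \<in> carrier (free_nonassoc_superalgebra r s) \<and> (\<forall>w. f w \<noteq> 0 \<longrightarrow> monomial_parity w = i)"
  by (auto simp: free_nonassoc_superalgebra_def free_nonassoc_carrier_def gens_def)

lemma free_superalgebra: "superalgebra (free_nonassoc_superalgebra r s)"
proof -
  let ?N = "free_nonassoc_superalgebra r s"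
  note S = free_nonassoc_simps
  have add: "f \<oplus>\<^bsub>?N\<^esub> g \<in> carrier ?N" if "f \<in> carrier ?N" "g \<in> carrier ?N" for f g
  proof -
    have "{w. f w + g w \<noteq> 0} \<subseteq> {w. f w \<noteq> 0} \<union> {w. g w \<noteq> 0}" by auto
    then have "finite {w. f w + g w \<noteq> 0}" using that by (auto simp: S intro: finite_subset)
    moreover have "vars w \<subseteq> gens r s" if "f w + g w \<noteq> 0" for w
      using that \<open>f \<in> carrier ?N\<close> \<open>g \<in> carrier ?N\<close> unfolding S by (cases "f w = 0") auto
    ultimately show ?thesis by (simp add: S)
  qed
  have smult: "c \<odot>\<^bsub>?N\<^esub> f \<in> carrier ?N" if "f \<in> carrier ?N" for c f
  proof -
    have "{w. c * f w \<noteq> 0} \<subseteq> {w. f w \<noteq> 0}" by auto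
    then show ?thesis using that by (auto simp: S intro: finite_subset)
  qed
  have na: "nonassoc_algebra ?N"
  proof (rule nonassoc_algebraI)
    show "f \<otimes>\<^bsub>?N\<^esub> g \<in> carrier ?N" if "f \<in> carrier ?N" "g \<in> carrier ?N" for f g
    proof -
      have "{w. (f \<otimes>\<^bsub>?N\<^esub> g) w \<noteq> 0} \<subseteq> (\<lambda>(u, v). Mul u v) ` ({w. f w \<noteq> 0} \<times> {w. g w \<noteq> 0})"
      proof
        fix w assume "w \<in> {w. (f \<otimes>\<^bsub>?N\<^esub> g) w \<noteq> 0}"
        then show "w \<in> (\<lambda>(u, v). Mul u v) ` ({w. f w \<noteq> 0} \<times> {w. g w \<noteq> 0})"
          by (cases w) (auto simp: S(5))
      qed
      then have "finite {w. (f \<otimes>\<^bsub>?N\<^esub> g) w \<noteq> 0}" by (rule finite_subset) (use that in \<open>auto simp: S\<close>)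
      moreover have "vars w \<subseteq> gens r s" if "(f \<otimes>\<^bsub>?N\<^esub> g) w \<noteq> 0" for w
        using that \<open>f \<in> carrier ?N\<close> \<open>g \<in> carrier ?N\<close> unfolding S by (cases w) auto
      ultimately show ?thesis by (simp only: S(1)) blast
    qed
  qed (use add smult in \<open>auto simp: S(2-5) fun_eq_iff algebra_simps split: monomial.splits\<close>, simp_all add: S(1))
  interpret nonassoc_algebra ?N by (rule na)
  show ?thesis
  proof (intro superalgebra.intro superalgebra_axioms.intro na)
    show "submodule (grade ?N i) scalars ?N" for i
    proof (rule submoduleI)
      show "f \<oplus>\<^bsub>?N\<^esub> g \<in> grade ?N i" if "f \<in> grade ?N i" "g \<in> grade ?N i" for f g
      proof -
        have "monomial_parity w = i" if "f w + g w \<noteq> 0" for w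
          using that \<open>f \<in> grade ?N i\<close> \<open>g \<in> grade ?N i\<close> unfolding S(6) by (cases "f w = 0") auto
        then show ?thesis using that add[of f g] by (simp add: S(3,6))
      qed
      show sm: "c \<odot>\<^bsub>?N\<^esub> f \<in> grade ?N i" if "f \<in> grade ?N i" for c f
        using that smult[of f c] by (auto simp: S(4,6))
      show "\<ominus>\<^bsub>?N\<^esub> f \<in> grade ?N i" if "f \<in> grade ?N i" for f
        using sm[OF that, of "- 1"] that minus_eq_smult[of f] by (simp add: S(6))
    qed (auto simp: S(6) S(1,2))
    show "carrier ?N = grade ?N 0 <+>\<^bsub>?N\<^esub> grade ?N 1"
    proof
      show "carrier ?N \<subseteq> grade ?N 0 <+>\<^bsub>?N\<^esub> grade ?N 1"
      proof
        fix f assume f: "f \<in> carrier ?N"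
        let ?p = "\<lambda>i w. if monomial_parity w = i then f w else 0"
        have "?p i \<in> grade ?N i" for i
        proof -
          have "{w. ?p i w \<noteq> 0} \<subseteq> {w. f w \<noteq> 0}" by auto
          then have "finite {w. ?p i w \<noteq> 0}" using f by (auto simp: S intro: finite_subset)
          then show ?thesis using f by (auto simp: S(6) S(1))
        qed
        moreover have "f = ?p 0 \<oplus>\<^bsub>?N\<^esub> ?p 1" by (auto simp: S(3) fun_eq_iff)
        ultimately show "f \<in> grade ?N 0 <+>\<^bsub>?N\<^esub> grade ?N 1" unfolding set_add_def' by blast
      qed
      show "grade ?N 0 <+>\<^bsub>?N\<^esub> grade ?N 1 \<subseteq> carrier ?N" using add by (auto simp: set_add_def' S(6))
    qed
    show "grade ?N 0 \<inter> grade ?N 1 = {\<zero>\<^bsub>?N\<^esub>}"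
    proof
      show "grade ?N 0 \<inter> grade ?N 1 \<subseteq> {\<zero>\<^bsub>?N\<^esub>}"
        by (auto simp: S(2,6) fun_eq_iff)
    qed (auto simp: S(6) S(1,2))
    show "f \<otimes>\<^bsub>?N\<^esub> g \<in> grade ?N (i + j)" if "f \<in> grade ?N i" "g \<in> grade ?N j" for f g i j
    proof -
      have "monomial_parity w = i + j" if "(f \<otimes>\<^bsub>?N\<^esub> g) w \<noteq> 0" for w
        using that \<open>f \<in> grade ?N i\<close> \<open>g \<in> grade ?N j\<close> unfolding S(5,6) by (cases w) auto
      then show ?thesis using that mult_closed[of f g] unfolding S(6) by blast
    qed
  qed
qed

lemma free_finsum_apply:
  assumes "\<And>i. i \<in> T \<Longrightarrow> F i \<in> carrier (free_nonassoc_superalgebra r s)"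
  shows "(\<Oplus>\<^bsub>free_nonassoc_superalgebra r s\<^esub>i\<in>T. F i) w = (\<Sum>i\<in>T. F i w)"
proof -
  interpret superalgebra "free_nonassoc_superalgebra r s" by (rule free_superalgebra)
  show ?thesis using assms
  proof (induct T rule: infinite_finite_induct)
    case (insert x T)
    then have "F \<in> T \<rightarrow> carrier (free_nonassoc_superalgebra r s)" by auto
    then show ?case using insert by (simp add: free_nonassoc_simps(3))
  qed (auto simp: finsum_infinite free_nonassoc_simps(2))
qed

lemma monom_carrier: "vars w \<subseteq> gens r s \<Longrightarrow> monom w \<in> carrier (free_nonassoc_superalgebra r s)"
  by (simp add: free_nonassoc_simps monom_def)

lemma eval_monomial_free:
  "vars w \<subseteq> gens r s \<Longrightarrow>
    eval_monomial (free_nonassoc_superalgebra r s) (\<lambda>g. monom (Var g)) w = monom w"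
  by (induct w) (auto simp: free_nonassoc_simps(5) monom_def fun_eq_iff split: monomial.splits)

lemma eval_polynomial_free:
  fixes f :: "('f::field_char_0, nat + nat) polynomial"
  assumes "f \<in> carrier (free_nonassoc_superalgebra r s)"
  shows "eval_polynomial (free_nonassoc_superalgebra r s) (\<lambda>g. monom (Var g)) f = f"
proof
  fix w
  let ?N = "free_nonassoc_superalgebra r s :: ('f, ('f, nat + nat) polynomial) superalgebra"
  interpret superalgebra ?N by (rule free_superalgebra)
  have e: "eval_monomial ?N (\<lambda>g. monom (Var g)) w = monom w" "(monom w :: ('f, nat + nat) polynomial) \<in> carrier ?N"
    if "f w \<noteq> 0" for w
  proof -
    have "vars w \<subseteq> gens r s" using that assms by (simp add: free_nonassoc_simps(1))
    then show "eval_monomial ?N (\<lambda>g. monom (Var g)) w = monom w" "monom w \<in> carrier ?N"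
      by (rule eval_monomial_free, rule monom_carrier)
  qed
  have "eval_polynomial ?N (\<lambda>g. monom (Var g)) f w =
      (\<Sum>v\<in>{w. f w \<noteq> 0}. (f v \<odot>\<^bsub>?N\<^esub> eval_monomial ?N (\<lambda>g. monom (Var g)) v) w)"
    unfolding eval_polynomial_def by (rule free_finsum_apply) (use e in auto)
  also have "\<dots> = (\<Sum>v\<in>{w. f w \<noteq> 0}. if v = w then f v else 0)"
    by (rule sum.cong) (auto simp: e free_nonassoc_simps(4) monom_apply)
  also have "\<dots> = f w"
    using assms by (simp add: free_nonassoc_simps(1) sum.delta')
  finally show "eval_polynomial ?N (\<lambda>g. monom (Var g)) f w = f w" .
qed

lemma free_induct [consumes 1, case_names zero add]:
  assumes "f \<in> carrier (free_nonassoc_superalgebra r s)" "P (\<lambda>w. 0)"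
    "\<And>c w g. \<lbrakk>vars w \<subseteq> gens r s; g \<in> carrier (free_nonassoc_superalgebra r s); P g\<rbrakk>
      \<Longrightarrow> P (\<lambda>v. c * monom w v + g v)"
  shows "P f"
proof -
  have "\<forall>f \<in> carrier (free_nonassoc_superalgebra r s). {w. f w \<noteq> 0} = X \<longrightarrow> P f" if "finite X" for X
    using that
  proof (induct X)
    case empty
    show ?case
    proof (intro ballI impI)
      fix f :: "(nat + nat) monomial \<Rightarrow> 'a" assume "{w. f w \<noteq> 0} = {}"
      then have "f = (\<lambda>w. 0)" by auto
      then show "P f" using assms(2) by (simp only:)
    qed
  next
    case (insert w X)
    show ?case
    proof (intro ballI impI)
      fix f :: "(nat + nat) monomial \<Rightarrow> 'a"
      assume f: "f \<in> carrier (free_nonassoc_superalgebra r s)" "{v. f v \<noteq> 0} = insert w X"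
      let ?g = "f(w := 0)"
      have supp: "{v. ?g v \<noteq> 0} = X" using f(2) insert(2) by auto
      then have g: "?g \<in> carrier (free_nonassoc_superalgebra r s)"
        using f insert(1) by (auto simp: free_nonassoc_simps(1))
      have e: "(\<lambda>v. f w * monom w v + ?g v) = f" by (auto simp: monom_def)
      have w: "vars w \<subseteq> gens r s" using f by (auto simp: free_nonassoc_simps(1))
      have "P ?g" using insert(3) g supp by blast
      then have "P (\<lambda>v. f w * monom w v + ?g v)" by (rule assms(3)[OF w g])
      then show "P f" by (simp only: e)
    qed
  qed
  then show ?thesis using assms(1) by (auto simp: free_nonassoc_simps(1))
qed

text \<open>The universal property of the free nonassociative superalgebra. Multiplicativity is checked on monomials and
  extended by linearity in both factors.\<close>

lemma free_graded_hom:
  fixes B :: "('f::field_char_0, 'b, 'm) superalgebra_scheme"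
  assumes B: "superalgebra B" and b: "\<And>g. g \<in> gens r s \<Longrightarrow> b g \<in> grade B (generator_parity g)"
  shows "graded_hom (free_nonassoc_superalgebra r s) B (eval_polynomial B b)"
proof -
  let ?N = "free_nonassoc_superalgebra r s :: ('f, ('f, nat + nat) polynomial) superalgebra"
  let ?h = "eval_polynomial B b"
  interpret N: superalgebra ?N by (rule free_superalgebra)
  interpret B: superalgebra B by (rule B)
  have eg: "eval_monomial B b w \<in> grade B (monomial_parity w)" if "vars w \<subseteq> gens r s" for w
    using that by (induct w) (use b B.grade_mult in \<open>auto simp del: plus_bit_def\<close>)
  then have ec: "eval_monomial B b w \<in> carrier B" if "vars w \<subseteq> gens r s" for w
    using that B.grade_carrier by blast
  have fin: "finite {w. f w \<noteq> 0}" "\<And>w. f w \<noteq> 0 \<Longrightarrow> vars w \<subseteq> gens r s" if "f \<in> carrier ?N" for f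
    using that by (auto simp: free_nonassoc_simps(1))
  have hom_add: "?h (f \<oplus>\<^bsub>?N\<^esub> g) = ?h f \<oplus>\<^bsub>B\<^esub> ?h g" if fg: "f \<in> carrier ?N" "g \<in> carrier ?N" for f g
  proof -
    let ?T = "{w. f w \<noteq> 0} \<union> {w. g w \<noteq> 0}"
    have T: "finite ?T" "\<And>w. w \<in> ?T \<Longrightarrow> eval_monomial B b w \<in> carrier B"
      using fin[OF fg(1)] fin[OF fg(2)] ec by auto
    have T': "eval_monomial B b w \<in> carrier B" if "f w + g w \<noteq> 0" for w
      using that T(2)[of w] by (cases "f w = 0") auto
    have "?h (f \<oplus>\<^bsub>?N\<^esub> g) = (\<Oplus>\<^bsub>B\<^esub>w\<in>?T. (f w + g w) \<odot>\<^bsub>B\<^esub> eval_monomial B b w)"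
      by (subst B.eval_polynomial_superset[OF T(1)]) (use T T' in \<open>auto simp: free_nonassoc_simps(3)\<close>)
    also have "\<dots> = (\<Oplus>\<^bsub>B\<^esub>w\<in>?T. f w \<odot>\<^bsub>B\<^esub> eval_monomial B b w \<oplus>\<^bsub>B\<^esub> g w \<odot>\<^bsub>B\<^esub> eval_monomial B b w)"
      by (rule B.M.add.finprod_cong') (use T(2) in \<open>auto simp: B.smult_add_left\<close>)
    also have "\<dots> = (\<Oplus>\<^bsub>B\<^esub>w\<in>?T. f w \<odot>\<^bsub>B\<^esub> eval_monomial B b w) \<oplus>\<^bsub>B\<^esub> (\<Oplus>\<^bsub>B\<^esub>w\<in>?T. g w \<odot>\<^bsub>B\<^esub> eval_monomial B b w)"
      by (rule B.finsum_addf) (use T(2) in auto)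
    also have "(\<Oplus>\<^bsub>B\<^esub>w\<in>?T. f w \<odot>\<^bsub>B\<^esub> eval_monomial B b w) = ?h f"
      by (rule B.eval_polynomial_superset[OF T(1), symmetric]) (use T(2) in auto)
    also have "(\<Oplus>\<^bsub>B\<^esub>w\<in>?T. g w \<odot>\<^bsub>B\<^esub> eval_monomial B b w) = ?h g"
      by (rule B.eval_polynomial_superset[OF T(1), symmetric]) (use T(2) in auto)
    finally show ?thesis .
  qed
  have smult: "?h (c \<odot>\<^bsub>?N\<^esub> f) = c \<odot>\<^bsub>B\<^esub> ?h f" if f: "f \<in> carrier ?N" for c f
  proof -
    let ?T = "{w. f w \<noteq> 0}"
    have T: "finite ?T" "\<And>w. w \<in> ?T \<Longrightarrow> eval_monomial B b w \<in> carrier B" using fin[OF f] ec by auto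
    have "?h (c \<odot>\<^bsub>?N\<^esub> f) = (\<Oplus>\<^bsub>B\<^esub>w\<in>?T. (c * f w) \<odot>\<^bsub>B\<^esub> eval_monomial B b w)"
      by (subst B.eval_polynomial_superset[OF T(1)]) (use T in \<open>auto simp: free_nonassoc_simps(4)\<close>)
    also have "\<dots> = (\<Oplus>\<^bsub>B\<^esub>w\<in>?T. c \<odot>\<^bsub>B\<^esub> (f w \<odot>\<^bsub>B\<^esub> eval_monomial B b w))"
      by (rule B.M.add.finprod_cong') (use T(2) in \<open>auto simp: B.smult_smult\<close>)
    also have "\<dots> = c \<odot>\<^bsub>B\<^esub> ?h f"
      unfolding eval_polynomial_def by (rule B.finsum_smult[symmetric]) (use T(2) in auto)
    finally show ?thesis .
  qed
  have closed: "?h f \<in> carrier B" if "f \<in> carrier ?N" for f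
    using fin[OF that] ec by (intro B.eval_polynomial_closed) auto
  have hm: "?h (monom w) = eval_monomial B b w" if "vars w \<subseteq> gens r s" for w
  proof -
    have "{v. monom w v \<noteq> (0::'f)} = {w}" by (auto simp: monom_def)
    then show ?thesis using ec[OF that] by (simp add: eval_polynomial_def monom_def)
  qed
  have mm: "monom u \<otimes>\<^bsub>?N\<^esub> monom v = monom (Mul u v)" for u v
    by (auto simp: free_nonassoc_simps(5) monom_def fun_eq_iff split: monomial.splits)
  have dec: "(\<lambda>v. c * monom w v + g v) = c \<odot>\<^bsub>?N\<^esub> monom w \<oplus>\<^bsub>?N\<^esub> g" for c w g
    by (simp add: free_nonassoc_simps)
  have h0: "?h (\<lambda>w. 0) = \<zero>\<^bsub>B\<^esub>" by (simp add: eval_polynomial_def)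
  have N0: "(\<lambda>w. 0) = \<zero>\<^bsub>?N\<^esub>" by (simp add: free_nonassoc_simps(2))
  have mult: "?h (f \<otimes>\<^bsub>?N\<^esub> g) = ?h f \<otimes>\<^bsub>B\<^esub> ?h g" if f: "f \<in> carrier ?N" and g: "g \<in> carrier ?N" for f g
    using f
  proof (induct rule: free_induct)
    case zero
    show ?case using g closed[OF g] unfolding N0 by (simp add: h0[unfolded N0])
  next
    case (add c w f')
    have w: "monom w \<in> carrier ?N" using add(1) by (rule monom_carrier)
    have "?h (monom w \<otimes>\<^bsub>?N\<^esub> g) = ?h (monom w) \<otimes>\<^bsub>B\<^esub> ?h g"
      using g
    proof (induct rule: free_induct)
      case zero
      show ?case using w closed[OF w] unfolding N0 by (simp add: h0[unfolded N0])
    next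
      case (add d v g')
      have v: "monom v \<in> carrier ?N" using add(1) by (rule monom_carrier)
      have "?h (monom w \<otimes>\<^bsub>?N\<^esub> monom v) = ?h (monom w) \<otimes>\<^bsub>B\<^esub> ?h (monom v)"
        using add(1) \<open>vars w \<subseteq> gens r s\<close> by (simp add: mm hm)
      then show ?case unfolding dec using add w v
        by (simp add: N.distrib_left N.smult_mult_right N.mult_closed hom_add
            smult closed B.distrib_left B.smult_mult_right)
    qed
    then show ?case unfolding dec using add w g
      by (simp add: N.distrib_right N.smult_mult_left N.mult_closed hom_add
          smult closed B.distrib_right B.smult_mult_left)
  qed
  have "?h f \<in> grade B i" if f: "f \<in> grade ?N i" for f i
    unfolding eval_polynomial_def
  proof (rule B.grade_finsum)
    fix w assume "w \<in> {w. f w \<noteq> 0}"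
    then have "monomial_parity w = i" "vars w \<subseteq> gens r s"
      using f by (auto simp: free_nonassoc_simps(6) free_nonassoc_simps(1))
    then show "f w \<odot>\<^bsub>B\<^esub> eval_monomial B b w \<in> grade B i" using eg B.grade_smult by blast
  qed
  then show ?thesis
    unfolding graded_hom_def algebra_hom_def using hom_add smult mult closed by auto
qed

section \<open>Superidentities of the free Jordan metabelian superalgebra\<close>

text \<open>The free Jordan metabelian superalgebra is the quotient by the intersection of the admissible ideals.\<close>

definition admissible :: "nat \<Rightarrow> nat \<Rightarrow> ('f::field_char_0, nat + nat) polynomial set \<Rightarrow> bool" where
  "admissible r s I \<longleftrightarrow> graded_ideal (free_nonassoc_superalgebra r s) I \<and>
     jordan_metabelian_superalgebra (quotient_superalgebra (free_nonassoc_superalgebra r s) I)"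

definition identity_ideal :: "nat \<Rightarrow> nat \<Rightarrow> ('f::field_char_0, nat + nat) polynomial set" where
  "identity_ideal r s = \<Inter>{I. admissible r s I}"

lemma free_jordan_metabelian_eq:
  "free_jordan_metabelian_superalgebra r s =
    quotient_superalgebra (free_nonassoc_superalgebra r s) (identity_ideal r s)"
  by (simp add: free_jordan_metabelian_superalgebra_def identity_ideal_def admissible_def)

text \<open>The intersection of no ideals would not be an ideal; the quotient by the whole algebra is zero and hence
  Jordan metabelian.\<close>

lemma admissible_exists: "\<exists>I. admissible r s (I :: ('f::field_char_0, nat + nat) polynomial set)"
proof -
  let ?N = "free_nonassoc_superalgebra r s :: ('f, ('f, nat + nat) polynomial) superalgebra"
  interpret N: superalgebra ?N by (rule free_superalgebra)
  have I: "graded_ideal ?N (carrier ?N)"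
    unfolding graded_ideal_def
  proof (intro conjI ballI N.carrier_is_submodule)
    have "carrier ?N \<inter> grade ?N i = grade ?N i" for i using N.grade_carrier by blast
    then show "carrier ?N = (carrier ?N \<inter> grade ?N 0) <+>\<^bsub>?N\<^esub> (carrier ?N \<inter> grade ?N 1)"
      using N.grade_sum by simp
  qed (auto intro: N.mult_closed)
  let ?Q = "quotient_superalgebra ?N (carrier ?N)"
  interpret Q: superalgebra ?Q by (rule N.quotient_superalgebra[OF I])
  have z: "x = \<zero>\<^bsub>?Q\<^esub>" if "x \<in> carrier ?Q" for x
    using that N.coset_zero_iff[OF I] by (auto simp: N.quotient_carrier[OF I] quotient_simps(3))
  have zg: "x = \<zero>\<^bsub>?Q\<^esub>" if "x \<in> grade ?Q i" for x i
    using z Q.grade_carrier[OF that] by simp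
  have "jordan_metabelian Q.G"
  proof (rule Q.envelope_jordan_metabelianI)
    fix i j k l x y z' t
    assume "x \<in> grade ?Q i" "y \<in> grade ?Q j" "z' \<in> grade ?Q k" "t \<in> grade ?Q l"
    note g = this[THEN zg]
    show "(x \<otimes>\<^bsub>?Q\<^esub> y) \<otimes>\<^bsub>?Q\<^esub> (z' \<otimes>\<^bsub>?Q\<^esub> t) = \<zero>\<^bsub>?Q\<^esub>" unfolding g by simp
  next
    fix i j x y assume "x \<in> grade ?Q i" "y \<in> grade ?Q j"
    note g = this[THEN zg]
    show "y \<otimes>\<^bsub>?Q\<^esub> x = koszul_factor i j \<odot>\<^bsub>?Q\<^esub> (x \<otimes>\<^bsub>?Q\<^esub> y)" unfolding g by simp
  next
    fix i1 i2 i3 j x1 x2 x3 y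
    assume "x1 \<in> grade ?Q i1" "x2 \<in> grade ?Q i2" "x3 \<in> grade ?Q i3" "y \<in> grade ?Q j"
    note g = this[THEN zg]
    show "((x1 \<otimes>\<^bsub>?Q\<^esub> x2) \<otimes>\<^bsub>?Q\<^esub> y) \<otimes>\<^bsub>?Q\<^esub> x3
      \<oplus>\<^bsub>?Q\<^esub> (koszul_factor i2 i3 * koszul_factor j i3 * koszul_factor i2 j) \<odot>\<^bsub>?Q\<^esub> (((x1 \<otimes>\<^bsub>?Q\<^esub> x3) \<otimes>\<^bsub>?Q\<^esub> y) \<otimes>\<^bsub>?Q\<^esub> x2)
      \<oplus>\<^bsub>?Q\<^esub> (koszul_factor i1 i2 * koszul_factor i1 j * koszul_factor i1 i3 * koszul_factor j i3)
          \<odot>\<^bsub>?Q\<^esub> (((x2 \<otimes>\<^bsub>?Q\<^esub> x3) \<otimes>\<^bsub>?Q\<^esub> y) \<otimes>\<^bsub>?Q\<^esub> x1) = \<zero>\<^bsub>?Q\<^esub>" unfolding g by simp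
  qed
  then have "admissible r s (carrier ?N)"
    using I Q.superalgebra_axioms by (simp add: admissible_def jordan_metabelian_superalgebra_def)
  then show ?thesis by blast
qed

text \<open>The homogeneous components of an element do not depend on the ideal, so they lie in every admissible ideal
  that contains the element.\<close>

lemma identity_ideal_graded:
  "graded_ideal (free_nonassoc_superalgebra r s) (identity_ideal r s :: ('f::field_char_0, nat + nat) polynomial set)"
proof -
  let ?N = "free_nonassoc_superalgebra r s :: ('f, ('f, nat + nat) polynomial) superalgebra"
  let ?I = "identity_ideal r s :: ('f, nat + nat) polynomial set"
  interpret N: superalgebra ?N by (rule free_superalgebra)
  obtain I0 :: "('f, nat + nat) polynomial set" where I0: "admissible r s I0" using admissible_exists by blast
  have gi: "graded_ideal ?N I" if "admissible r s I" for I :: "('f, nat + nat) polynomial set"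
    using that by (simp add: admissible_def)
  have mem: "x \<in> ?I \<longleftrightarrow> (\<forall>I. admissible r s I \<longrightarrow> x \<in> I)" for x by (auto simp: identity_ideal_def)
  have sub: "?I \<subseteq> carrier ?N" using N.ideal_carrier[OF gi[OF I0]] I0 mem by blast
  show ?thesis
    unfolding graded_ideal_def
  proof (intro conjI ballI)
    show "submodule ?I scalars ?N"
    proof (rule N.submoduleI[OF sub])
      show "\<zero>\<^bsub>?N\<^esub> \<in> ?I" using N.ideal_zero gi by (auto simp: mem)
      show "\<ominus>\<^bsub>?N\<^esub> x \<in> ?I" if "x \<in> ?I" for x using that N.ideal_minus gi by (auto simp: mem)
      show "x \<oplus>\<^bsub>?N\<^esub> y \<in> ?I" if "x \<in> ?I" "y \<in> ?I" for x y using that N.ideal_add gi by (auto simp: mem)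
      show "c \<odot>\<^bsub>?N\<^esub> x \<in> ?I" if "x \<in> ?I" for c x using that N.ideal_smult gi by (auto simp: mem)
    qed
    fix x y assume "x \<in> carrier ?N" "y \<in> ?I"
    then show "x \<otimes>\<^bsub>?N\<^esub> y \<in> ?I" "y \<otimes>\<^bsub>?N\<^esub> x \<in> ?I" using N.ideal_mult gi by (auto simp: mem)
  next
    show "?I = (?I \<inter> grade ?N 0) <+>\<^bsub>?N\<^esub> (?I \<inter> grade ?N 1)"
    proof
      show "?I \<subseteq> (?I \<inter> grade ?N 0) <+>\<^bsub>?N\<^esub> (?I \<inter> grade ?N 1)"
      proof
        fix x assume x: "x \<in> ?I"
        then obtain y z where yz: "y \<in> grade ?N 0" "z \<in> grade ?N 1" "x = y \<oplus>\<^bsub>?N\<^esub> z"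
          using N.grade_decompose sub by blast
        have c: "y \<in> carrier ?N" "z \<in> carrier ?N" using yz N.grade_carrier by auto
        have "y \<in> I \<and> z \<in> I" if I: "admissible r s I" for I
        proof -
          obtain u v where uv: "u \<in> I" "u \<in> grade ?N 0" "v \<in> I" "v \<in> grade ?N 1" "x = u \<oplus>\<^bsub>?N\<^esub> v"
            using N.ideal_decompose[OF gi[OF I]] x I by (metis mem)
          have g: "u \<oplus>\<^bsub>?N\<^esub> (- 1) \<odot>\<^bsub>?N\<^esub> y \<in> grade ?N 0" "v \<oplus>\<^bsub>?N\<^esub> (- 1) \<odot>\<^bsub>?N\<^esub> z \<in> grade ?N 1"
            using uv yz by (auto intro!: N.grade_add N.grade_smult)
          have "(u \<oplus>\<^bsub>?N\<^esub> (- 1) \<odot>\<^bsub>?N\<^esub> y) \<oplus>\<^bsub>?N\<^esub> (v \<oplus>\<^bsub>?N\<^esub> (- 1) \<odot>\<^bsub>?N\<^esub> z) = \<zero>\<^bsub>?N\<^esub>"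
            using uv(5) yz(3) by (auto simp: free_nonassoc_simps(2-4) fun_eq_iff algebra_simps)
          then have "u \<oplus>\<^bsub>?N\<^esub> (- 1) \<odot>\<^bsub>?N\<^esub> y = \<zero>\<^bsub>?N\<^esub>" "v \<oplus>\<^bsub>?N\<^esub> (- 1) \<odot>\<^bsub>?N\<^esub> z = \<zero>\<^bsub>?N\<^esub>"
            using N.grade_sum_zero[OF g] by auto
          then have "u = y" "v = z" by (auto simp: free_nonassoc_simps(2-4) fun_eq_iff)
          then show ?thesis using uv by simp
        qed
        then have "y \<in> ?I" "z \<in> ?I" unfolding mem by blast+
        then show "x \<in> (?I \<inter> grade ?N 0) <+>\<^bsub>?N\<^esub> (?I \<inter> grade ?N 1)"
          using yz unfolding set_add_def' by blast
      qed
      show "(?I \<inter> grade ?N 0) <+>\<^bsub>?N\<^esub> (?I \<inter> grade ?N 1) \<subseteq> ?I"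
        using N.ideal_add gi by (auto simp: set_add_def' mem)
    qed
  qed
qed

lemma free_jordan_metabelian_is_superalgebra:
  "superalgebra (free_jordan_metabelian_superalgebra r s)"
  unfolding free_jordan_metabelian_eq
  by (rule superalgebra.quotient_superalgebra[OF free_superalgebra identity_ideal_graded])

abbreviation free_satisfies :: "nat \<Rightarrow> nat \<Rightarrow> ('f::field_char_0, nat) polynomial \<Rightarrow> bool" where
  "free_satisfies r s f \<equiv>
    satisfies_superidentity (free_jordan_metabelian_superalgebra r s :: ('f, 'f free_element) superalgebra) f"

text \<open>This replaces the free superalgebra by quotients that are Jordan metabelian by the choice of the ideals.\<close>

lemma free_satisfies_iff:
  "free_satisfies r s f \<longleftrightarrow>
    (\<forall>I. admissible r s I \<longrightarrow> satisfies_superidentity (quotient_superalgebra (free_nonassoc_superalgebra r s) I) f)"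
proof -
  have "satisfies_superidentity (quotient_superalgebra (free_nonassoc_superalgebra r s) I) f \<longleftrightarrow>
    (\<forall>p a. (\<forall>i. a i \<in> grade (free_nonassoc_superalgebra r s) (p i)) \<longrightarrow>
      eval_polynomial (free_nonassoc_superalgebra r s) a (superization p f) \<in> I)" if "admissible r s I" for I
    by (rule superalgebra.quotient_satisfies_iff[OF free_superalgebra]) (use that in \<open>simp add: admissible_def\<close>)
  moreover have "free_satisfies r s f \<longleftrightarrow>
    (\<forall>p a. (\<forall>i. a i \<in> grade (free_nonassoc_superalgebra r s) (p i)) \<longrightarrow>
      eval_polynomial (free_nonassoc_superalgebra r s) a (superization p f) \<in> identity_ideal r s)"
    unfolding free_jordan_metabelian_eq
    by (rule superalgebra.quotient_satisfies_iff[OF free_superalgebra identity_ideal_graded])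
  ultimately show ?thesis unfolding identity_ideal_def by auto
qed

text \<open>A superidentity of the free superalgebra holds for the elements of \<open>B\<close> generated by \<open>r\<close> even and \<open>s\<close> odd
  elements: the kernel of the homomorphism that they induce is admissible.\<close>

lemma free_satisfies_transfer:
  fixes f :: "('f::field_char_0, nat) polynomial"
  assumes f: "free_satisfies r s f"
    and B: "jordan_metabelian_superalgebra B"
    and b: "\<And>g. g \<in> gens r s \<Longrightarrow> b g \<in> grade B (generator_parity g)"
    and n: "\<And>i. n i \<in> grade (free_nonassoc_superalgebra r s) (p i)"
  shows "eval_polynomial B (\<lambda>i. eval_polynomial B b (n i)) (superization p f) = \<zero>\<^bsub>B\<^esub>"
proof -
  let ?N = "free_nonassoc_superalgebra r s :: ('f, ('f, nat + nat) polynomial) superalgebra"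
  have B': "superalgebra B" using B by (simp add: jordan_metabelian_superalgebra_def)
  interpret N: superalgebra ?N by (rule free_superalgebra)
  interpret B: superalgebra B by (rule B')
  have h: "graded_hom ?N B (eval_polynomial B b)" by (rule free_graded_hom[OF B' b])
  let ?I = "hom_kernel ?N B (eval_polynomial B b)"
  have gi: "graded_ideal ?N ?I" by (rule graded_ideal_kernel[OF free_superalgebra B' h])
  have "admissible r s ?I"
    using gi quotient_by_kernel[OF free_superalgebra B h] by (simp add: admissible_def)
  then have "satisfies_superidentity (quotient_superalgebra ?N ?I) f" using f free_satisfies_iff by blast
  then have "eval_polynomial ?N n (superization p f) \<in> ?I"
    using n by (simp add: N.quotient_satisfies_iff[OF gi])
  then have "eval_polynomial B b (eval_polynomial ?N n (superization p f)) = \<zero>\<^bsub>B\<^esub>"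
    by (simp add: hom_kernel_def)
  moreover have "eval_polynomial B b (eval_polynomial ?N n (superization p f)) =
      eval_polynomial B (\<lambda>i. eval_polynomial B b (n i)) (superization p f)"
    by (rule algebra_hom_eval_polynomial[OF N.nonassoc_algebra_axioms B.nonassoc_algebra_axioms])
      (use h n N.grade_carrier in \<open>auto simp: graded_hom_def\<close>)
  ultimately show ?thesis by simp
qed

lemma monom_grade:
  "vars w \<subseteq> gens r s \<Longrightarrow> monom w \<in> grade (free_nonassoc_superalgebra r s) (monomial_parity w)"
  using monom_carrier[of w r s] by (auto simp: free_nonassoc_simps(6) monom_apply)

lemma quotient_eval_generators:
  fixes I :: "('f::field_char_0, nat + nat) polynomial set"
  assumes I: "graded_ideal (free_nonassoc_superalgebra r s) I"
    and n: "n \<in> carrier (free_nonassoc_superalgebra r s)"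
  shows "eval_polynomial (quotient_superalgebra (free_nonassoc_superalgebra r s) I)
    (\<lambda>g. I +>\<^bsub>free_nonassoc_superalgebra r s\<^esub> monom (Var g)) n = I +>\<^bsub>free_nonassoc_superalgebra r s\<^esub> n"
proof -
  let ?N = "free_nonassoc_superalgebra r s :: ('f, ('f, nat + nat) polynomial) superalgebra"
  interpret N: superalgebra ?N by (rule free_superalgebra)
  have v: "monom (Var g) \<in> carrier ?N" if "n w \<noteq> 0" "g \<in> vars w" for g w
    using n that monom_carrier[of "Var g" r s] by (auto simp: free_nonassoc_simps(1))
  have "I +>\<^bsub>?N\<^esub> eval_polynomial ?N (\<lambda>g. monom (Var g)) n
      = eval_polynomial (quotient_superalgebra ?N I) (\<lambda>g. I +>\<^bsub>?N\<^esub> monom (Var g)) n"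
    by (rule algebra_hom_eval_polynomial[OF N.nonassoc_algebra_axioms
          N.quotient_nonassoc_algebra[OF I] N.coset_hom[OF I] v])
  then show ?thesis using eval_polynomial_free[OF n] by simp
qed

lemma free_satisfies_mono:
  fixes f :: "('f::field_char_0, nat) polynomial"
  assumes rs: "r \<le> r'" "s \<le> s'"
    and f: "free_satisfies r' s' f"
  shows "free_satisfies r s f"
  unfolding free_satisfies_iff
proof (intro allI impI)
  fix I :: "('f, nat + nat) polynomial set" assume I: "admissible r s I"
  let ?N = "free_nonassoc_superalgebra r s :: ('f, ('f, nat + nat) polynomial) superalgebra"
  let ?N' = "free_nonassoc_superalgebra r' s' :: ('f, ('f, nat + nat) polynomial) superalgebra"
  let ?Q = "quotient_superalgebra ?N I"
  interpret N: superalgebra ?N by (rule free_superalgebra)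
  have gi: "graded_ideal ?N I" and Q: "jordan_metabelian_superalgebra ?Q"
    using I by (auto simp: admissible_def)
  interpret Q: superalgebra ?Q by (rule N.quotient_superalgebra[OF gi])
  have sub: "gens r s \<subseteq> gens r' s'" using rs by (auto simp: gens_def)
  define b where "b g = (if g \<in> gens r s then I +>\<^bsub>?N\<^esub> monom (Var g) else \<zero>\<^bsub>?Q\<^esub>)" for g
  have bg: "b g \<in> grade ?Q (generator_parity g)" for g
  proof (cases "g \<in> gens r s")
    case True
    then have "monom (Var g) \<in> grade ?N (generator_parity g)" using monom_grade[of "Var g" r s] by simp
    then show ?thesis using True by (simp add: b_def quotient_simps(6))
  qed (simp add: b_def)
  have coset: "eval_polynomial ?Q b n = I +>\<^bsub>?N\<^esub> n" if n: "n \<in> carrier ?N" for n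
  proof -
    have "eval_polynomial ?Q b n = eval_polynomial ?Q (\<lambda>g. I +>\<^bsub>?N\<^esub> monom (Var g)) n"
    proof (rule Q.eval_polynomial_cong)
      fix w g assume "n w \<noteq> 0" "g \<in> vars w"
      then have g: "g \<in> gens r s" using n by (auto simp: free_nonassoc_simps(1))
      then show "b g = I +>\<^bsub>?N\<^esub> monom (Var g)" by (simp add: b_def)
      show "I +>\<^bsub>?N\<^esub> monom (Var g) \<in> carrier ?Q"
        using g monom_carrier[of "Var g" r s] by (intro algebra_homD(1)[OF N.coset_hom[OF gi]]) simp
    qed
    then show ?thesis unfolding quotient_eval_generators[OF gi n] .
  qed
  show "satisfies_superidentity ?Q f"
    unfolding satisfies_superidentity_def
  proof (intro allI impI)
    fix p :: "nat \<Rightarrow> bit" and a assume "\<forall>i. a i \<in> grade ?Q (p i)"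
    then have "\<forall>i. \<exists>x. x \<in> grade ?N (p i) \<and> a i = I +>\<^bsub>?N\<^esub> x" by (auto simp: quotient_simps(6))
    then obtain n where n: "\<And>i. n i \<in> grade ?N (p i)" "\<And>i. a i = I +>\<^bsub>?N\<^esub> n i" by metis
    have n': "n i \<in> grade ?N' (p i)" for i
      using n(1)[of i] sub by (auto simp: free_nonassoc_simps(6) free_nonassoc_simps(1))
    have "eval_polynomial ?Q (\<lambda>i. eval_polynomial ?Q b (n i)) (superization p f) = \<zero>\<^bsub>?Q\<^esub>"
      by (rule free_satisfies_transfer[OF f Q bg n'])
    moreover have "eval_polynomial ?Q b (n i) = a i" for i
      using coset N.grade_carrier[OF n(1)] n(2) by simp
    ultimately show "eval_polynomial ?Q a (superization p f) = \<zero>\<^bsub>?Q\<^esub>" by simp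
  qed
qed

section \<open>A split null extension\<close>

definition weight :: "(nat \<Rightarrow> bit) \<Rightarrow> nat list \<Rightarrow> bit" where
  "weight p cs = (\<Sum>c\<leftarrow>cs. p c)"

lemma weight_simps [simp]:
  "weight p [] = 0" "weight p (c # cs) = p c + weight p cs" "weight p (xs @ ys) = weight p xs + weight p ys"
  by (simp_all add: weight_def)

text \<open>Functions on words that transform under the exchange of two letters with one letter in between as a
  word in a Jordan metabelian superalgebra does (\<open>skew\<close> with Koszul signs).\<close>

definition super_skew :: "(nat \<Rightarrow> bit) \<Rightarrow> (nat list \<Rightarrow> 'f::field_char_0) \<Rightarrow> bool" where
  "super_skew p u \<longleftrightarrow> (\<forall>xs a b c ys. u (xs @ [a, b, c] @ ys) =
    - (koszul_factor (p a) (p b) * koszul_factor (p b) (p c) * koszul_factor (p a) (p c) * u (xs @ [c, b, a] @ ys)))"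

definition act :: "nat \<Rightarrow> (nat \<Rightarrow> 'f::field_char_0) \<Rightarrow> (nat list \<Rightarrow> 'f) \<Rightarrow> nat list \<Rightarrow> 'f" where
  "act d z u cs = (\<Sum>i<d. z i * u (i # cs))"

text \<open>A function that is nonzero only on words of weight \<open>j\<close> is homogeneous of parity \<open>k + j\<close>. Hence
  \<open>k + weight p (i # cs)\<close> is the parity of the component of \<open>u\<close> that contributes to the summand, and the sign is
  the one for moving the letter \<open>i\<close> past it.\<close>

definition signed_act ::
  "(nat \<Rightarrow> bit) \<Rightarrow> nat \<Rightarrow> bit \<Rightarrow> (nat \<Rightarrow> 'f::field_char_0) \<Rightarrow> (nat list \<Rightarrow> 'f) \<Rightarrow> nat list \<Rightarrow> 'f" where
  "signed_act p d k z u cs = (\<Sum>i<d. koszul_factor (p i) (k + weight p (i # cs)) * (z i * u (i # cs)))"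

type_synonym 'f split_element = "(nat \<Rightarrow> 'f) \<times> (nat list \<Rightarrow> 'f)"

definition split_carrier :: "(nat \<Rightarrow> bit) \<Rightarrow> nat \<Rightarrow> 'f::field_char_0 split_element set" where
  "split_carrier p d = {(z, u). (\<forall>i. z i \<noteq> 0 \<longrightarrow> i < d) \<and> super_skew p u}"

text \<open>The split null extension of a space with basis \<open>e\<^sub>0, \<dots>, e\<^sub>d\<^sub>-\<^sub>1\<close> and zero multiplication by the space of
  \<open>super_skew\<close> functions, on which \<open>e\<^sub>i\<close> acts from the right by \<open>u \<mapsto> (\<lambda>cs. u (i # cs))\<close> and from the left as
  supercommutativity dictates. A product of \<open>u\<close> with the letters \<open>e\<^sub>c\<close> of a word evaluates \<open>u\<close> at this word, so
  that a single well-chosen \<open>u\<close> detects whether a word is nonzero. The letter \<open>e\<^sub>i\<close> has parity \<open>p i\<close>, and \<open>k\<close>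
  shifts the parity of the functions.\<close>

definition split_extension :: "(nat \<Rightarrow> bit) \<Rightarrow> nat \<Rightarrow> bit \<Rightarrow> ('f::field_char_0, 'f split_element) superalgebra" where
  "split_extension p d k =
    \<lparr>carrier = split_carrier p d,
     monoid.mult = (\<lambda>(z, u) (z', u'). (\<lambda>i. 0, \<lambda>cs. act d z' u cs + signed_act p d k z u' cs)),
     one = undefined,
     zero = (\<lambda>i. 0, \<lambda>cs. 0),
     add = (\<lambda>(z, u) (z', u'). (\<lambda>i. z i + z' i, \<lambda>cs. u cs + u' cs)),
     smult = (\<lambda>c (z, u). (\<lambda>i. c * z i, \<lambda>cs. c * u cs)),
     grade = (\<lambda>j. {(z, u) \<in> split_carrier p d.
       (\<forall>i. z i \<noteq> 0 \<longrightarrow> p i = j) \<and> (\<forall>cs. u cs \<noteq> 0 \<longrightarrow> k + weight p cs = j)})\<rparr>"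

lemma split_simps:
  "(z, u) \<in> carrier (split_extension p d k) \<longleftrightarrow> (\<forall>i. z i \<noteq> 0 \<longrightarrow> i < d) \<and> super_skew p u"
  "zero (split_extension p d k) = (\<lambda>i. 0, \<lambda>cs. 0)"
  "add (split_extension p d k) (z, u) (z', u') = (\<lambda>i. z i + z' i, \<lambda>cs. u cs + u' cs)"
  "smult (split_extension p d k) c (z, u) = (\<lambda>i. c * z i, \<lambda>cs. c * u cs)"
  "monoid.mult (split_extension p d k) (z, u) (z', u') =
    (\<lambda>i. 0, \<lambda>cs. act d z' u cs + signed_act p d k z u' cs)"
  "(z, u) \<in> grade (split_extension p d k) j \<longleftrightarrow> (\<forall>i. z i \<noteq> 0 \<longrightarrow> i < d) \<and> super_skew p u \<and>
       (\<forall>i. z i \<noteq> 0 \<longrightarrow> p i = j) \<and> (\<forall>cs. u cs \<noteq> 0 \<longrightarrow> k + weight p cs = j)"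
  by (auto simp: split_extension_def split_carrier_def)

lemma act_linear:
  "act d (\<lambda>i. z i + z' i) u cs = act d z u cs + act d z' u cs"
  "act d (\<lambda>i. c * z i) u cs = c * act d z u cs"
  "act d z (\<lambda>cs. u cs + u' cs) cs = act d z u cs + act d z u' cs"
  "act d z (\<lambda>cs. c * u cs) cs = c * act d z u cs"
  "act d (\<lambda>i. 0) u cs = 0" "act d z (\<lambda>cs. 0) cs = 0"
  by (simp_all add: act_def algebra_simps sum.distrib sum_distrib_left)

lemma signed_act_linear:
  "signed_act p d k (\<lambda>i. z i + z' i) u cs = signed_act p d k z u cs + signed_act p d k z' u cs"
  "signed_act p d k (\<lambda>i. c * z i) u cs = c * signed_act p d k z u cs"
  "signed_act p d k z (\<lambda>cs. u cs + u' cs) cs = signed_act p d k z u cs + signed_act p d k z u' cs"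
  "signed_act p d k z (\<lambda>cs. c * u cs) cs = c * signed_act p d k z u cs"
  "signed_act p d k (\<lambda>i. 0) u cs = 0" "signed_act p d k z (\<lambda>cs. 0) cs = 0"
  by (simp_all add: signed_act_def algebra_simps sum.distrib sum_distrib_left)

lemma koszul_factor_commute: "koszul_factor i j = koszul_factor j i"
  by (auto simp: koszul_factor_def)

lemma super_skewD:
  "super_skew p u \<Longrightarrow> u (xs @ [a, b, c] @ ys) =
    - (koszul_factor (p a) (p b) * koszul_factor (p b) (p c) * koszul_factor (p a) (p c) * u (xs @ [c, b, a] @ ys))"
  unfolding super_skew_def by blast

lemma super_skew_linear:
  "super_skew p (\<lambda>cs. 0)"
  "\<lbrakk>super_skew p u; super_skew p u'\<rbrakk> \<Longrightarrow> super_skew p (\<lambda>cs. u cs + u' cs)"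
  "super_skew p u \<Longrightarrow> super_skew p (\<lambda>cs. c * u cs)"
proof -
  show "super_skew p (\<lambda>cs. 0)" by (simp add: super_skew_def)
  show "super_skew p (\<lambda>cs. u cs + u' cs)" if "super_skew p u" "super_skew p u'"
    unfolding super_skew_def
  proof (intro allI)
    fix xs a b c' ys
    show "u (xs @ [a, b, c'] @ ys) + u' (xs @ [a, b, c'] @ ys) = - (koszul_factor (p a) (p b) * koszul_factor (p b) (p c') *
      koszul_factor (p a) (p c') * (u (xs @ [c', b, a] @ ys) + u' (xs @ [c', b, a] @ ys)))"
      unfolding super_skewD[OF that(1), of xs a b c' ys] super_skewD[OF that(2), of xs a b c' ys]
      by (simp add: algebra_simps)
  qed
  show "super_skew p (\<lambda>cs. c * u cs)" if "super_skew p u"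
    unfolding super_skew_def
  proof (intro allI)
    fix xs a b c' ys
    show "c * u (xs @ [a, b, c'] @ ys) = - (koszul_factor (p a) (p b) * koszul_factor (p b) (p c') *
      koszul_factor (p a) (p c') * (c * u (xs @ [c', b, a] @ ys)))"
      unfolding super_skewD[OF that(1), of xs a b c' ys] by (simp add: algebra_simps)
  qed
qed

lemma super_skew_act:
  assumes "super_skew p u"
  shows "super_skew p (act d z u)"
  unfolding super_skew_def
proof (intro allI)
  fix xs a b c ys
  let ?k = "koszul_factor (p a) (p b) * koszul_factor (p b) (p c) * koszul_factor (p a) (p c) :: 'a"
  have "u (i # xs @ [a, b, c] @ ys) = - (?k * u (i # xs @ [c, b, a] @ ys))" for i
    using super_skewD[OF assms, of "i # xs" a b c ys] by simp
  then show "act d z u (xs @ [a, b, c] @ ys) = - (?k * act d z u (xs @ [c, b, a] @ ys))"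
    by (simp add: act_def sum_distrib_left sum_negf[symmetric] algebra_simps)
qed

lemma super_skew_signed_act:
  assumes "super_skew p u"
  shows "super_skew p (signed_act p d k z u)"
  unfolding super_skew_def
proof (intro allI)
  fix xs a b c ys
  let ?k = "koszul_factor (p a) (p b) * koszul_factor (p b) (p c) * koszul_factor (p a) (p c) :: 'a"
  have u: "u (i # xs @ [a, b, c] @ ys) = - (?k * u (i # xs @ [c, b, a] @ ys))" for i
    using super_skewD[OF assms, of "i # xs" a b c ys] by simp
  have w: "weight p (i # xs @ [a, b, c] @ ys) = weight p (i # xs @ [c, b, a] @ ys)" for i
    by (simp add: add_ac del: add_bit_eq_xor plus_bit_def)
  show "signed_act p d k z u (xs @ [a, b, c] @ ys) = - (?k * signed_act p d k z u (xs @ [c, b, a] @ ys))"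
    unfolding signed_act_def u w
    by (simp add: sum_distrib_left sum_negf[symmetric] algebra_simps del: weight_simps)
qed

lemma act_nonzero: "act d z u cs \<noteq> 0 \<Longrightarrow> \<exists>i<d. z i \<noteq> 0 \<and> u (i # cs) \<noteq> 0"
  unfolding act_def by (metis (no_types, lifting) lessThan_iff mult_eq_0_iff sum.neutral)

lemma signed_act_nonzero: "signed_act p d k z u cs \<noteq> 0 \<Longrightarrow> \<exists>i<d. z i \<noteq> 0 \<and> u (i # cs) \<noteq> 0"
  unfolding signed_act_def by (metis (no_types, lifting) lessThan_iff mult_eq_0_iff sum.neutral)

lemma bit_add_self: "(x :: bit) + x = 0" "(x :: bit) + (x + y) = y"
  by (cases x; cases y; simp)+

lemma split_superalgebra: "superalgebra (split_extension p d k :: ('f::field_char_0, 'f split_element) superalgebra)"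
proof -
  let ?M = "split_extension p d k :: ('f, 'f split_element) superalgebra"
  note S = split_simps
  have add: "x \<oplus>\<^bsub>?M\<^esub> y \<in> carrier ?M" if "x \<in> carrier ?M" "y \<in> carrier ?M" for x y
    using that by (cases x, cases y) (auto simp: S super_skew_linear, metis add.right_neutral add_eq_0_iff)
  have smult: "c \<odot>\<^bsub>?M\<^esub> x \<in> carrier ?M" if "x \<in> carrier ?M" for c x
    using that by (cases x) (auto simp: S super_skew_linear)
  have na: "nonassoc_algebra ?M"
  proof (rule nonassoc_algebraI)
    fix x y assume "x \<in> carrier ?M" "y \<in> carrier ?M"
    then show "x \<otimes>\<^bsub>?M\<^esub> y \<in> carrier ?M"
      by (cases x, cases y) (auto simp: S intro!: super_skew_linear super_skew_act super_skew_signed_act)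
  next
    show "\<zero>\<^bsub>?M\<^esub> \<in> carrier ?M" by (simp add: S super_skew_linear)
  next
    fix x y z assume "x \<in> carrier ?M" "y \<in> carrier ?M" "z \<in> carrier ?M"
    show "x \<oplus>\<^bsub>?M\<^esub> y \<oplus>\<^bsub>?M\<^esub> z = x \<oplus>\<^bsub>?M\<^esub> (y \<oplus>\<^bsub>?M\<^esub> z)"
      by (cases x, cases y, cases z) (auto simp: S fun_eq_iff algebra_simps)
    show "(x \<oplus>\<^bsub>?M\<^esub> y) \<otimes>\<^bsub>?M\<^esub> z = x \<otimes>\<^bsub>?M\<^esub> z \<oplus>\<^bsub>?M\<^esub> y \<otimes>\<^bsub>?M\<^esub> z"
      by (cases x, cases y, cases z) (auto simp: S fun_eq_iff act_linear signed_act_linear)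
    show "x \<otimes>\<^bsub>?M\<^esub> (y \<oplus>\<^bsub>?M\<^esub> z) = x \<otimes>\<^bsub>?M\<^esub> y \<oplus>\<^bsub>?M\<^esub> x \<otimes>\<^bsub>?M\<^esub> z"
      by (cases x, cases y, cases z) (auto simp: S fun_eq_iff act_linear signed_act_linear)
  next
    fix x y assume "x \<in> carrier ?M" "y \<in> carrier ?M"
    show "x \<oplus>\<^bsub>?M\<^esub> y = y \<oplus>\<^bsub>?M\<^esub> x" by (cases x, cases y) (auto simp: S fun_eq_iff algebra_simps)
    fix c
    show "c \<odot>\<^bsub>?M\<^esub> (x \<oplus>\<^bsub>?M\<^esub> y) = c \<odot>\<^bsub>?M\<^esub> x \<oplus>\<^bsub>?M\<^esub> c \<odot>\<^bsub>?M\<^esub> y"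
      by (cases x, cases y) (auto simp: S fun_eq_iff algebra_simps)
    show "(c \<odot>\<^bsub>?M\<^esub> x) \<otimes>\<^bsub>?M\<^esub> y = c \<odot>\<^bsub>?M\<^esub> (x \<otimes>\<^bsub>?M\<^esub> y)" "x \<otimes>\<^bsub>?M\<^esub> (c \<odot>\<^bsub>?M\<^esub> y) = c \<odot>\<^bsub>?M\<^esub> (x \<otimes>\<^bsub>?M\<^esub> y)"
      by (cases x, cases y, auto simp: S fun_eq_iff act_linear signed_act_linear algebra_simps)+
  next
    fix x assume x: "x \<in> carrier ?M"
    show "\<zero>\<^bsub>?M\<^esub> \<oplus>\<^bsub>?M\<^esub> x = x" "1 \<odot>\<^bsub>?M\<^esub> x = x" "0 \<odot>\<^bsub>?M\<^esub> x = \<zero>\<^bsub>?M\<^esub>" by (cases x, simp add: S)+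
    fix a b
    show "(a + b) \<odot>\<^bsub>?M\<^esub> x = a \<odot>\<^bsub>?M\<^esub> x \<oplus>\<^bsub>?M\<^esub> b \<odot>\<^bsub>?M\<^esub> x" "(a * b) \<odot>\<^bsub>?M\<^esub> x = a \<odot>\<^bsub>?M\<^esub> (b \<odot>\<^bsub>?M\<^esub> x)"
      by (cases x, simp add: S fun_eq_iff algebra_simps)+
  qed (use add smult in auto)
  interpret nonassoc_algebra ?M by (rule na)
  have gc: "x \<in> carrier ?M" if "x \<in> grade ?M i" for x i using that by (cases x) (auto simp: S)
  show ?thesis
  proof (intro superalgebra.intro superalgebra_axioms.intro na)
    show "submodule (grade ?M i) scalars ?M" for i
    proof (rule submoduleI)
      show "grade ?M i \<subseteq> carrier ?M" using gc by blast
      show "\<zero>\<^bsub>?M\<^esub> \<in> grade ?M i" by (simp add: S super_skew_linear)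
      show "x \<oplus>\<^bsub>?M\<^esub> y \<in> grade ?M i" if xy: "x \<in> grade ?M i" "y \<in> grade ?M i" for x y
      proof -
        obtain z u z' u' where e: "x = (z, u)" "y = (z', u')" by (cases x, cases y)
        have "i' < d" "p i' = i" if "z i' + z' i' \<noteq> 0" for i'
          using that xy unfolding e S by (cases "z i' = 0"; auto)+
        moreover have "k + weight p cs = i" if "u cs + u' cs \<noteq> 0" for cs
          using that xy unfolding e S by (cases "u cs = 0"; auto)
        ultimately show ?thesis using xy unfolding e S by (auto intro: super_skew_linear)
      qed
      show sm: "c \<odot>\<^bsub>?M\<^esub> x \<in> grade ?M i" if "x \<in> grade ?M i" for c x
        using that by (cases x) (auto simp: S super_skew_linear)
      show "\<ominus>\<^bsub>?M\<^esub> x \<in> grade ?M i" if "x \<in> grade ?M i" for x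
        using sm[OF that, of "- 1"] minus_eq_smult[OF gc[OF that]] by simp
    qed
    show "carrier ?M = grade ?M 0 <+>\<^bsub>?M\<^esub> grade ?M 1"
    proof
      show "carrier ?M \<subseteq> grade ?M 0 <+>\<^bsub>?M\<^esub> grade ?M 1"
      proof
        fix x assume x: "x \<in> carrier ?M"
        obtain z u where e: "x = (z, u)" by (cases x)
        define y where "y j = (\<lambda>i. if p i = j then z i else 0, \<lambda>cs. if k + weight p cs = j then u cs else 0)" for j
        have "y j \<in> grade ?M j" for j
        proof -
          have su: "super_skew p u" using x unfolding e S by simp
          have "super_skew p (\<lambda>cs. if k + weight p cs = j then u cs else 0)"
            unfolding super_skew_def
          proof (intro allI)
            fix xs a b c ys
            have w: "weight p (xs @ [a, b, c] @ ys) = weight p (xs @ [c, b, a] @ ys)"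
              by (simp add: add_ac del: add_bit_eq_xor plus_bit_def)
            show "(if k + weight p (xs @ [a, b, c] @ ys) = j then u (xs @ [a, b, c] @ ys) else 0) =
              - (koszul_factor (p a) (p b) * koszul_factor (p b) (p c) * koszul_factor (p a) (p c) *
                 (if k + weight p (xs @ [c, b, a] @ ys) = j then u (xs @ [c, b, a] @ ys) else 0))"
              unfolding w using super_skewD[OF su, of xs a b c ys] by simp
          qed
          then show ?thesis using x unfolding y_def e S by (auto split: if_splits)
        qed
        moreover have "x = y 0 \<oplus>\<^bsub>?M\<^esub> y 1"
        proof -
          have "b = 0 \<or> b = 1" for b :: bit by (cases b) auto
          then show ?thesis unfolding e y_def S by (auto simp: fun_eq_iff)
        qed
        ultimately show "x \<in> grade ?M 0 <+>\<^bsub>?M\<^esub> grade ?M 1" unfolding set_add_def' by blast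
      qed
      show "grade ?M 0 <+>\<^bsub>?M\<^esub> grade ?M 1 \<subseteq> carrier ?M"
        using gc add unfolding set_add_def' by blast
    qed
    show "grade ?M 0 \<inter> grade ?M 1 = {\<zero>\<^bsub>?M\<^esub>}"
    proof
      show "grade ?M 0 \<inter> grade ?M 1 \<subseteq> {\<zero>\<^bsub>?M\<^esub>}"
      proof
        fix x assume x: "x \<in> grade ?M 0 \<inter> grade ?M 1"
        obtain z u where e: "x = (z, u)" by (cases x)
        have "z i = 0" for i using x unfolding e Int_iff S by (metis zero_neq_one)
        moreover have "u cs = 0" for cs using x unfolding e Int_iff S by (metis zero_neq_one)
        ultimately show "x \<in> {\<zero>\<^bsub>?M\<^esub>}" unfolding e S by auto
      qed
    qed (simp add: S super_skew_linear)
    show "x \<otimes>\<^bsub>?M\<^esub> y \<in> grade ?M (i + j)" if xy: "x \<in> grade ?M i" "y \<in> grade ?M j" for x y i j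
    proof -
      obtain z u z' u' where e: "x = (z, u)" "y = (z', u')" by (cases x, cases y)
      have 1: "k + weight p cs = i + j" if nz: "act d z' u cs \<noteq> 0" for cs
      proof -
        obtain a where "z' a \<noteq> 0" "u (a # cs) \<noteq> 0" using act_nonzero[OF nz] by auto
        then have "p a = j" "k + (p a + weight p cs) = i" using xy unfolding e S by (auto simp only: weight_simps)
        then show ?thesis by (cases k; cases "p a"; cases "weight p cs"; cases i; cases j; simp)
      qed
      have 2: "k + weight p cs = i + j" if nz: "signed_act p d k z u' cs \<noteq> 0" for cs
      proof -
        obtain a where "z a \<noteq> 0" "u' (a # cs) \<noteq> 0" using signed_act_nonzero[OF nz] by auto
        then have "p a = i" "k + (p a + weight p cs) = j" using xy unfolding e S by (auto simp only: weight_simps)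
        then show ?thesis by (cases k; cases "p a"; cases "weight p cs"; cases i; cases j; simp)
      qed
      have "k + weight p cs = i + j" if "act d z' u cs + signed_act p d k z u' cs \<noteq> 0" for cs
        using that 1[of cs] 2[of cs] by (cases "act d z' u cs = 0") auto
      moreover have "super_skew p u" "super_skew p u'" using xy unfolding e S by auto
      ultimately show ?thesis unfolding e S
        by (intro conjI allI impI super_skew_linear super_skew_act super_skew_signed_act) (simp_all only: simp_thms)
    qed
  qed
qed

lemma signed_act_homogeneous:
  assumes "(z, w) \<in> grade (split_extension p d k) i" "(w', u) \<in> grade (split_extension p d k) j"
  shows "signed_act p d k z u cs = koszul_factor i j * act d z u cs"
proof -
  have *: "koszul_factor (p a) (k + weight p (a # cs)) * (z a * u (a # cs)) = koszul_factor i j * (z a * u (a # cs))" for a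
  proof (cases "z a = 0 \<or> u (a # cs) = 0")
    case False
    then have "p a = i" "k + weight p (a # cs) = j" using assms unfolding split_simps by blast+
    then show ?thesis by (simp only:)
  qed auto
  show ?thesis unfolding signed_act_def act_def * by (rule sum_distrib_left[symmetric])
qed

lemma act_skew:
  assumes u: "super_skew p u" and z: "\<And>i. z1 i \<noteq> 0 \<Longrightarrow> p i = i1" "\<And>i. z2 i \<noteq> 0 \<Longrightarrow> p i = i2" "\<And>i. z3 i \<noteq> 0 \<Longrightarrow> p i = i3"
  shows "act d z3 (act d z2 (act d z1 u)) cs =
    - (koszul_factor i1 i2 * koszul_factor i2 i3 * koszul_factor i1 i3 * act d z1 (act d z2 (act d z3 u)) cs)"
proof -
  let ?k = "koszul_factor i1 i2 * koszul_factor i2 i3 * koszul_factor i1 i3 :: 'a"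
  have *: "z3 c * (z2 b * (z1 a * u (a # b # c # cs))) = - (?k * (z1 a * (z2 b * (z3 c * u (c # b # a # cs)))))" for a b c
  proof (cases "z1 a = 0 \<or> z2 b = 0 \<or> z3 c = 0")
    case False
    then have "p a = i1" "p b = i2" "p c = i3" using z by blast+
    then have "u (a # b # c # cs) = - (?k * u (c # b # a # cs))"
      using super_skewD[OF u, of "[]" a b c cs] by simp
    then show ?thesis by (simp only:) (simp add: algebra_simps)
  qed auto
  have "act d z3 (act d z2 (act d z1 u)) cs = (\<Sum>c<d. \<Sum>b<d. \<Sum>a<d. z3 c * (z2 b * (z1 a * u (a # b # c # cs))))"
    by (simp add: act_def sum_distrib_left)
  also have "\<dots> = (\<Sum>c<d. \<Sum>b<d. \<Sum>a<d. - (?k * (z1 a * (z2 b * (z3 c * u (c # b # a # cs))))))"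
    by (simp only: *)
  also have "\<dots> = - (?k * (\<Sum>c<d. \<Sum>b<d. \<Sum>a<d. z1 a * (z2 b * (z3 c * u (c # b # a # cs)))))"
    by (simp add: sum_distrib_left sum_negf)
  also have "(\<Sum>c<d. \<Sum>b<d. \<Sum>a<d. z1 a * (z2 b * (z3 c * u (c # b # a # cs))))
     = (\<Sum>a<d. \<Sum>b<d. \<Sum>c<d. z1 a * (z2 b * (z3 c * u (c # b # a # cs))))"
  proof -
    have "(\<Sum>c<d. \<Sum>b<d. \<Sum>a<d. z1 a * (z2 b * (z3 c * u (c # b # a # cs))))
      = (\<Sum>c<d. \<Sum>a<d. \<Sum>b<d. z1 a * (z2 b * (z3 c * u (c # b # a # cs))))"
      by (intro sum.cong refl sum.swap)
    also have "\<dots> = (\<Sum>a<d. \<Sum>c<d. \<Sum>b<d. z1 a * (z2 b * (z3 c * u (c # b # a # cs))))"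
      by (rule sum.swap)
    also have "\<dots> = (\<Sum>a<d. \<Sum>b<d. \<Sum>c<d. z1 a * (z2 b * (z3 c * u (c # b # a # cs))))"
      by (intro sum.cong refl sum.swap)
    finally show ?thesis .
  qed
  also have "\<dots> = act d z1 (act d z2 (act d z3 u)) cs"
    by (simp add: act_def sum_distrib_left)
  finally show ?thesis .
qed

text \<open>In the linearized Jordan identity each of the three terms is a sum of two actions on functions, and the six
  summands cancel in pairs because the functions are \<open>super_skew\<close>.\<close>

lemma split_jordan_metabelian:
  "jordan_metabelian_superalgebra (split_extension p d k :: ('f::field_char_0, 'f split_element) superalgebra)"
proof -
  let ?M = "split_extension p d k :: ('f, 'f split_element) superalgebra"
  let ?kf = "koszul_factor :: bit \<Rightarrow> bit \<Rightarrow> 'f"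
  interpret superalgebra ?M by (rule split_superalgebra)
  have mult: "(z, u) \<otimes>\<^bsub>?M\<^esub> (z', u') = (\<lambda>i. 0, \<lambda>cs. act d z' u cs + ?kf i j * act d z u' cs)"
    if "(z, u) \<in> grade ?M i" "(z', u') \<in> grade ?M j" for z u z' u' i j
    unfolding split_simps signed_act_homogeneous[OF that] ..
  have mult0: "(\<lambda>i. 0, u) \<otimes>\<^bsub>?M\<^esub> (z, u') = (\<lambda>i. 0, act d z u)" for z u u'
    by (simp add: split_simps signed_act_linear)
  have "jordan_metabelian G"
  proof (rule envelope_jordan_metabelianI)
    fix i j x y assume xy: "x \<in> grade ?M i" "y \<in> grade ?M j"
    obtain z u z' u' where e: "x = (z, u)" "y = (z', u')" by (cases x, cases y)
    show "y \<otimes>\<^bsub>?M\<^esub> x = koszul_factor i j \<odot>\<^bsub>?M\<^esub> (x \<otimes>\<^bsub>?M\<^esub> y)"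
      unfolding e mult[OF xy[unfolded e]] mult[OF xy(2)[unfolded e] xy(1)[unfolded e]]
      by (simp add: split_simps(4) koszul_factor_commute[of j i] algebra_simps fun_eq_iff)
  next
    fix i j i' l x y x' t
    assume "x \<in> grade ?M i" "y \<in> grade ?M j" "x' \<in> grade ?M i'" "t \<in> grade ?M l"
    obtain z1 u1 z2 u2 z3 u3 z4 u4 where e: "x = (z1, u1)" "y = (z2, u2)" "x' = (z3, u3)" "t = (z4, u4)"
      by (cases x, cases y, cases x', cases t)
    show "(x \<otimes>\<^bsub>?M\<^esub> y) \<otimes>\<^bsub>?M\<^esub> (x' \<otimes>\<^bsub>?M\<^esub> t) = \<zero>\<^bsub>?M\<^esub>"
      unfolding e split_simps by (simp add: act_linear signed_act_linear)
  next
    fix i1 i2 i3 j x1 x2 x3 y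
    assume h: "x1 \<in> grade ?M i1" "x2 \<in> grade ?M i2" "x3 \<in> grade ?M i3" "y \<in> grade ?M j"
    obtain z1 u1 z2 u2 z3 u3 z4 u4 where e: "x1 = (z1, u1)" "x2 = (z2, u2)" "x3 = (z3, u3)" "y = (z4, u4)"
      by (cases x1, cases x2, cases x3, cases y)
    note h = h[unfolded e]
    have p: "\<And>i. z1 i \<noteq> 0 \<Longrightarrow> p i = i1" "\<And>i. z2 i \<noteq> 0 \<Longrightarrow> p i = i2" "\<And>i. z3 i \<noteq> 0 \<Longrightarrow> p i = i3"
      "\<And>i. z4 i \<noteq> 0 \<Longrightarrow> p i = j"
      and sk: "super_skew p u1" "super_skew p u2" "super_skew p u3"
      using h unfolding split_simps by blast+
    define T where "T a b c u = act d c (act d b (act d a u))" for a b c and u :: "nat list \<Rightarrow> 'f"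
    have lin: "act d a (act d b (\<lambda>cs. act d c u cs + m * act d c' u' cs)) = (\<lambda>cs. T c b a u cs + m * T c' b a u' cs)"
      for a b c c' m u u'
      unfolding T_def by (simp add: act_def algebra_simps sum.distrib sum_distrib_left fun_eq_iff)
    have t1: "((x1 \<otimes>\<^bsub>?M\<^esub> x2) \<otimes>\<^bsub>?M\<^esub> y) \<otimes>\<^bsub>?M\<^esub> x3 = (\<lambda>i. 0, \<lambda>cs. T z2 z4 z3 u1 cs + ?kf i1 i2 * T z1 z4 z3 u2 cs)"
      unfolding e mult[OF h(1,2)] mult0 lin ..
    have t2: "((x1 \<otimes>\<^bsub>?M\<^esub> x3) \<otimes>\<^bsub>?M\<^esub> y) \<otimes>\<^bsub>?M\<^esub> x2 = (\<lambda>i. 0, \<lambda>cs. T z3 z4 z2 u1 cs + ?kf i1 i3 * T z1 z4 z2 u3 cs)"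
      unfolding e mult[OF h(1,3)] mult0 lin ..
    have t3: "((x2 \<otimes>\<^bsub>?M\<^esub> x3) \<otimes>\<^bsub>?M\<^esub> y) \<otimes>\<^bsub>?M\<^esub> x1 = (\<lambda>i. 0, \<lambda>cs. T z3 z4 z1 u2 cs + ?kf i2 i3 * T z2 z4 z1 u3 cs)"
      unfolding e mult[OF h(2,3)] mult0 lin ..
    have s1: "T z3 z4 z2 u1 cs = - (?kf j i3 * ?kf i2 j * ?kf i2 i3 * T z2 z4 z3 u1 cs)" for cs
      using act_skew[of p u1 z3 i3 z4 j z2 i2 d cs] sk(1) p
      by (simp add: T_def koszul_factor_commute[of i3 j] koszul_factor_commute[of j i2] koszul_factor_commute[of i3 i2])
    have s2: "T z3 z4 z1 u2 cs = - (?kf j i3 * ?kf i1 j * ?kf i1 i3 * T z1 z4 z3 u2 cs)" for cs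
      using act_skew[of p u2 z3 i3 z4 j z1 i1 d cs] sk(2) p
      by (simp add: T_def koszul_factor_commute[of i3 j] koszul_factor_commute[of j i1] koszul_factor_commute[of i3 i1])
    have s3: "T z2 z4 z1 u3 cs = - (?kf i2 j * ?kf i1 j * ?kf i1 i2 * T z1 z4 z2 u3 cs)" for cs
      using act_skew[of p u3 z2 i2 z4 j z1 i1 d cs] sk(3) p
      by (simp add: T_def koszul_factor_commute[of j i1] koszul_factor_commute[of i2 i1])
    have kf: "?kf i j * (x * (?kf i j * y)) = x * y" for i j x y by (simp add: koszul_factor_def)
    show "((x1 \<otimes>\<^bsub>?M\<^esub> x2) \<otimes>\<^bsub>?M\<^esub> y) \<otimes>\<^bsub>?M\<^esub> x3
      \<oplus>\<^bsub>?M\<^esub> (koszul_factor i2 i3 * koszul_factor j i3 * koszul_factor i2 j) \<odot>\<^bsub>?M\<^esub> (((x1 \<otimes>\<^bsub>?M\<^esub> x3) \<otimes>\<^bsub>?M\<^esub> y) \<otimes>\<^bsub>?M\<^esub> x2)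
      \<oplus>\<^bsub>?M\<^esub> (koszul_factor i1 i2 * koszul_factor i1 j * koszul_factor i1 i3 * koszul_factor j i3)
          \<odot>\<^bsub>?M\<^esub> (((x2 \<otimes>\<^bsub>?M\<^esub> x3) \<otimes>\<^bsub>?M\<^esub> y) \<otimes>\<^bsub>?M\<^esub> x1) = \<zero>\<^bsub>?M\<^esub>"
      unfolding t1 t2 t3 split_simps s1 s2 s3
      by (auto simp: fun_eq_iff koszul_factor_def)
  qed
  then show ?thesis using split_superalgebra by (simp add: jordan_metabelian_superalgebra_def)
qed

section \<open>Normal words\<close>

text \<open>A pair \<open>(b, T)\<close> stands for the word with the letters \<open>T\<close> at the odd positions and with \<open>b\<close> and the least letter
  outside \<open>T\<close> in the initial product. Of the \<open>n - 2\<close> letters after the initial product, \<open>(n - 1) div 2\<close> are at odd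
  positions.\<close>

definition normal_indices :: "nat \<Rightarrow> (nat \<times> nat set) set" where
  "normal_indices n = {(b, T). T \<subseteq> {..<n} \<and> card T = (n - 1) div 2 \<and> b \<in> {..<n} - T \<and> b \<noteq> Min ({..<n} - T)}"

definition normal_value :: "('a, 'm) ring_scheme \<Rightarrow> (nat \<Rightarrow> 'a) \<Rightarrow> nat \<Rightarrow> nat \<times> nat set \<Rightarrow> 'a" where
  "normal_value A a n = (\<lambda>(b, T). word_value A a (Min ({..<n} - T)) b
     (interleave (sorted_list_of_set T) (sorted_list_of_set ({..<n} - T - {Min ({..<n} - T), b}))))"

lemma finite_normal_indices: "finite (normal_indices n)"
  by (rule finite_subset[of _ "{..<n} \<times> Pow {..<n}"]) (auto simp: normal_indices_def)

lemma normal_value_of_word: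
  assumes w: "is_word {..<n} ((n - 1) div 2) i j ts ds" and i: "i = Min ({..<n} - set ts)"
    and s: "sorted ts" "sorted ds"
  shows "(j, set ts) \<in> normal_indices n"
    "normal_value A a n (j, set ts) = word_value A a i j (interleave ts ds)"
proof -
  have d: "distinct (i # j # ts @ ds)" "set (i # j # ts @ ds) = {..<n}" "length ts = (n - 1) div 2"
    using w unfolding is_word_def by blast+
  have "set ts \<subseteq> {..<n}" "card (set ts) = (n - 1) div 2" "j \<in> {..<n} - set ts" "j \<noteq> i"
    using d distinct_card[of ts] by auto
  then show "(j, set ts) \<in> normal_indices n" using i unfolding normal_indices_def by blast
  have "{..<n} - set ts - {i, j} = set ds" using d(1) unfolding d(2)[symmetric] by auto
  moreover have "sorted_list_of_set (set ts) = ts" "sorted_list_of_set (set ds) = ds"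
    using s d(1) by (simp_all add: sorted_list_of_set.idem_if_sorted_distinct)
  ultimately show "normal_value A a n (j, set ts) = word_value A a i j (interleave ts ds)"
    by (simp add: normal_value_def i[symmetric])
qed

lemma normal_index_word:
  assumes "(b, T) \<in> normal_indices n"
  shows "is_word {..<n} ((n - 1) div 2) (Min ({..<n} - T)) b (sorted_list_of_set T)
    (sorted_list_of_set ({..<n} - T - {Min ({..<n} - T), b}))"
proof -
  have h: "T \<subseteq> {..<n}" "card T = (n - 1) div 2" "b \<in> {..<n} - T" "b \<noteq> Min ({..<n} - T)"
    using assms unfolding normal_indices_def by blast+
  obtain m where m: "m = Min ({..<n} - T)" by blast
  have mT: "m \<in> {..<n} - T" unfolding m by (rule Min_in) (use h(3) in auto)
  have fin: "finite T" using h(1) finite_subset by blast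
  show ?thesis
    unfolding is_word_def m[symmetric] using h(1-3) h(4)[folded m] mT fin by auto
qed

lemma is_word_of_monomial:
  assumes "distinct (leaves w)" "vars w = {..<n}" "leftnorm w = Some (i, j, cs)"
  obtains ts ds where "cs = interleave ts ds" "is_word {..<n} ((n - 1) div 2) i j ts ds"
proof -
  have m: "mset (leaves w) = mset (i # j # cs)" by (rule leftnorm_mset[OF assms(3)])
  obtain ts ds where e: "cs = interleave ts ds" "length ts = (length cs + 1) div 2"
    using interleave_exists by blast
  have "length (leaves w) = n" using distinct_card[OF assms(1)] assms(2) by simp
  then have "length cs + 2 = n" using mset_eq_length[OF m] by simp
  then have l: "length ts = (n - 1) div 2" using e(2) by auto
  have m': "mset (leaves w) = mset (i # j # ts @ ds)" using m e(1) by simp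
  have "distinct (i # j # ts @ ds)" using assms(1) mset_eq_imp_distinct_iff[OF m'] by blast
  moreover have "set (i # j # ts @ ds) = {..<n}" using mset_eq_setD[OF m'] assms(2) by (simp only: set_leaves)
  ultimately have "is_word {..<n} ((n - 1) div 2) i j ts ds" using l unfolding is_word_def by blast
  then show ?thesis using e(1) that by blast
qed

text \<open>In every Jordan metabelian algebra a multilinear polynomial is a linear combination of normal words. Its
  coefficients are the same for all algebras, and they can be read off in an auxiliary algebra \<open>C\<close>
  in which, for each index \<open>x\<close>, a substitution \<open>g x\<close> and a functional \<open>psi x\<close> single out one normal word. If
  the polynomial vanishes under these substitutions, then all its coefficients are zero. The independence of the
  coefficients from the algebra is obtained by rewriting a word in \<open>A\<close> and in \<open>C\<close> simultaneously.\<close>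

lemma multilinear_vanishes:
  fixes A :: "('f::field_char_0, 'a, 'm) module_scheme" and C :: "('f, 'c, 'k) module_scheme"
  assumes A: "jordan_metabelian A" and C: "jordan_metabelian C"
    and f: "multilinear n f" and n: "2 \<le> n"
    and a: "\<And>v. v < n \<Longrightarrow> a v \<in> carrier A"
    and g: "\<And>x v. \<lbrakk>x \<in> normal_indices n; v < n\<rbrakk> \<Longrightarrow> g x v \<in> carrier C"
    and psi_add: "\<And>x c c'. \<lbrakk>x \<in> normal_indices n; c \<in> carrier C; c' \<in> carrier C\<rbrakk>
      \<Longrightarrow> psi x (c \<oplus>\<^bsub>C\<^esub> c') = psi x c + psi x c'"
    and psi_smult: "\<And>x c k. \<lbrakk>x \<in> normal_indices n; c \<in> carrier C\<rbrakk> \<Longrightarrow> psi x (k \<odot>\<^bsub>C\<^esub> c) = k * (psi x c :: 'f)"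
    and diag: "\<And>x. x \<in> normal_indices n \<Longrightarrow> psi x (normal_value C (g x) n x) \<noteq> 0"
    and off: "\<And>x y. \<lbrakk>x \<in> normal_indices n; y \<in> normal_indices n; x \<noteq> y\<rbrakk> \<Longrightarrow> psi x (normal_value C (g x) n y) = 0"
    and zero: "\<And>x. x \<in> normal_indices n \<Longrightarrow> psi x (eval_polynomial C (g x) f) = 0"
  shows "eval_polynomial A a f = \<zero>\<^bsub>A\<^esub>"
proof -
  interpret A: jordan_metabelian A by (rule A)
  interpret C: jordan_metabelian C by (rule C)
  let ?X = "normal_indices n" and ?k = "(n - 1) div 2"
  note fin = finite_normal_indices[of n]
  let ?e = "\<lambda>x. psi x (normal_value C (g x) n x)"
  \<comment> \<open>The combination of normal words whose image under each \<open>psi x\<close> would be \<open>c x\<close>.\<close>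
  define R where "R c = (\<Oplus>\<^bsub>A\<^esub>x\<in>?X. (c x / ?e x) \<odot>\<^bsub>A\<^esub> normal_value A a n x)" for c :: "nat \<times> nat set \<Rightarrow> 'f"
  have NA: "normal_value A a n x \<in> carrier A" if "x \<in> ?X" for x
  proof -
    obtain b T where x: "x = (b, T)" by (cases x)
    note w = normal_index_word[OF that[unfolded x]]
    show ?thesis unfolding x normal_value_def prod.case
      by (rule A.word_value_closed, rule a) (use w in \<open>unfold is_word_def, auto\<close>)
  qed
  have Rc: "R c \<in> carrier A" for c unfolding R_def by (rule A.finsum_closed) (use NA in auto)
  have R_add: "R (\<lambda>x. c x + c' x) = R c \<oplus>\<^bsub>A\<^esub> R c'" for c c'
  proof -
    have "R (\<lambda>x. c x + c' x) = (\<Oplus>\<^bsub>A\<^esub>x\<in>?X. (c x / ?e x) \<odot>\<^bsub>A\<^esub> normal_value A a n x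
        \<oplus>\<^bsub>A\<^esub> (c' x / ?e x) \<odot>\<^bsub>A\<^esub> normal_value A a n x)"
      unfolding R_def
      by (rule A.M.add.finprod_cong') (use NA in \<open>auto simp: A.smult_add_left add_divide_distrib\<close>)
    also have "\<dots> = R c \<oplus>\<^bsub>A\<^esub> R c'"
      unfolding R_def by (rule A.finsum_addf) (use NA in auto)
    finally show ?thesis .
  qed
  have R_smult: "R (\<lambda>x. l * c x) = l \<odot>\<^bsub>A\<^esub> R c" for c l
  proof -
    have "l \<odot>\<^bsub>A\<^esub> R c = (\<Oplus>\<^bsub>A\<^esub>x\<in>?X. l \<odot>\<^bsub>A\<^esub> ((c x / ?e x) \<odot>\<^bsub>A\<^esub> normal_value A a n x))"
      unfolding R_def by (rule A.finsum_smult) (use NA in auto)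
    also have "\<dots> = R (\<lambda>x. l * c x)"
      unfolding R_def by (rule A.M.add.finprod_cong') (use NA in \<open>auto simp: A.smult_smult\<close>)
    finally show ?thesis by (rule sym)
  qed
  have R_zero: "R (\<lambda>x. 0) = \<zero>\<^bsub>A\<^esub>"
    unfolding R_def by (rule A.finsum_all_zero) (use NA in auto)
  have R_neg: "R (\<lambda>x. - c x) = \<ominus>\<^bsub>A\<^esub> R c" for c
    using R_smult[of "- 1" c] Rc by (simp add: A.minus_eq_smult)
  have R_cong: "R c = R c'" if "\<And>x. x \<in> ?X \<Longrightarrow> c x = c' x" for c c'
    unfolding R_def by (rule A.M.add.finprod_cong') (use that NA in auto)
  have psi_zero: "psi x \<zero>\<^bsub>C\<^esub> = 0" if "x \<in> ?X" for x
    using psi_smult[OF that C.M.zero_closed, of 0] by simp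
  have psi_neg: "psi x (\<ominus>\<^bsub>C\<^esub> c) = - psi x c" if "x \<in> ?X" "c \<in> carrier C" for x c
    using psi_smult[OF that, of "- 1"] that by (simp add: C.minus_eq_smult)
  define P where "P i j ts ds \<longleftrightarrow> word_value A a i j (interleave ts ds)
      = R (\<lambda>x. psi x (word_value C (g x) i j (interleave ts ds)))" for i j ts ds
  have word_in: "set (i # j # interleave ts ds) \<subseteq> {..<n}" if "is_word {..<n} ?k i j ts ds" for i j ts ds
    using that unfolding is_word_def by auto
  have word_len: "length ts \<le> Suc (length ds)" "length ds \<le> length ts" if "is_word {..<n} ?k i j ts ds" for i j ts ds
  proof -
    have d: "distinct (i # j # ts @ ds)" "set (i # j # ts @ ds) = {..<n}" "length ts = ?k"
      using that unfolding is_word_def by blast+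
    have "length (i # j # ts @ ds) = n" using distinct_card[OF d(1)] unfolding d(2) by simp
    then have "2 + ?k + length ds = n" using d(3) by simp
    then show "length ts \<le> Suc (length ds)" "length ds \<le> length ts" using d(3) by linarith+
  qed
  have Cc: "word_value C (g x) i j cs \<in> carrier C" if "x \<in> ?X" "set (i # j # cs) \<subseteq> {..<n}" for x i j cs
    by (rule C.word_value_closed) (use that(2) g[OF that(1)] in auto)
  have P: "P i j ts ds" if "is_word {..<n} ?k i j ts ds" for i j ts ds
  proof (rule word_normalization[where P = P, OF _ _ _ _ _ that])
    fix i j ts ds assume w: "is_word {..<n} ?k i j ts ds" "P i j ts ds"
    have ij: "i < n" "j < n" using word_in[OF w(1)] by auto
    have "word_value A a j i (interleave ts ds) = word_value A a i j (interleave ts ds)"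
      using a ij by (intro A.word_value_sym) auto
    moreover have "R (\<lambda>x. psi x (word_value C (g x) j i (interleave ts ds))) = R (\<lambda>x. psi x (word_value C (g x) i j (interleave ts ds)))"
    proof (rule R_cong)
      fix x assume "x \<in> ?X"
      then have "g x i \<in> carrier C" "g x j \<in> carrier C" using g ij by blast+
      then show "psi x (word_value C (g x) j i (interleave ts ds)) = psi x (word_value C (g x) i j (interleave ts ds))"
        by (simp only: C.word_value_sym)
    qed
    ultimately show "P j i ts ds" using w(2) unfolding P_def by simp
  next
    fix i j xs x y ys ds
    assume w: "is_word {..<n} ?k i j (xs @ x # y # ys) ds" "P i j (xs @ x # y # ys) ds"
    have s: "\<And>v. v \<in> set (i # j # (xs @ x # y # ys) @ ds) \<Longrightarrow> v < n" using w(1) unfolding is_word_def by auto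
    have l: "length xs < length ds" using word_len(1)[OF w(1)] by simp
    have 1: "word_value A a i j (interleave (xs @ y # x # ys) ds) = \<ominus>\<^bsub>A\<^esub> word_value A a i j (interleave (xs @ x # y # ys) ds)"
      by (rule A.word_value_swap_first[OF a[OF s] l])
    have "R (\<lambda>z. psi z (word_value C (g z) i j (interleave (xs @ y # x # ys) ds)))
      = R (\<lambda>z. - psi z (word_value C (g z) i j (interleave (xs @ x # y # ys) ds)))"
    proof (rule R_cong)
      fix z assume z: "z \<in> ?X"
      have "word_value C (g z) i j (interleave (xs @ y # x # ys) ds) = \<ominus>\<^bsub>C\<^esub> word_value C (g z) i j (interleave (xs @ x # y # ys) ds)"
        by (rule C.word_value_swap_first[OF g[OF z s] l])
      then show "psi z (word_value C (g z) i j (interleave (xs @ y # x # ys) ds))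
        = - psi z (word_value C (g z) i j (interleave (xs @ x # y # ys) ds))"
        using psi_neg[OF z Cc[OF z word_in[OF w(1)]]] by simp
    qed
    then show "P i j (xs @ y # x # ys) ds" using 1 w(2) unfolding P_def R_neg by simp
  next
    fix i j ts xs x y ys
    assume w: "is_word {..<n} ?k i j ts (xs @ x # y # ys)" "P i j ts (xs @ x # y # ys)"
    have s: "\<And>v. v \<in> set (i # j # ts @ xs @ x # y # ys) \<Longrightarrow> v < n" using w(1) unfolding is_word_def by auto
    have l: "Suc (length xs) < length ts" using word_len(2)[OF w(1)] by simp
    have 1: "word_value A a i j (interleave ts (xs @ y # x # ys)) = \<ominus>\<^bsub>A\<^esub> word_value A a i j (interleave ts (xs @ x # y # ys))"
      by (rule A.word_value_swap_second[OF a[OF s] l])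
    have "R (\<lambda>z. psi z (word_value C (g z) i j (interleave ts (xs @ y # x # ys))))
      = R (\<lambda>z. - psi z (word_value C (g z) i j (interleave ts (xs @ x # y # ys))))"
    proof (rule R_cong)
      fix z assume z: "z \<in> ?X"
      have "word_value C (g z) i j (interleave ts (xs @ y # x # ys)) = \<ominus>\<^bsub>C\<^esub> word_value C (g z) i j (interleave ts (xs @ x # y # ys))"
        by (rule C.word_value_swap_second[OF g[OF z s] l])
      then show "psi z (word_value C (g z) i j (interleave ts (xs @ y # x # ys)))
        = - psi z (word_value C (g z) i j (interleave ts (xs @ x # y # ys)))"
        using psi_neg[OF z Cc[OF z word_in[OF w(1)]]] by simp
    qed
    then show "P i j ts (xs @ y # x # ys)" using 1 w(2) unfolding P_def R_neg by simp
  next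
    fix i j ts d ds
    assume w: "is_word {..<n} ?k i j ts (d # ds)" "P i d ts (j # ds)" "P j d ts (i # ds)"
    obtain t ts' where t: "ts = t # ts'" using word_len(2)[OF w(1)] by (cases ts) auto
    have il: "interleave ts (z # ds) = t # z # interleave ts' ds" for z by (simp add: t)
    let ?c = "interleave ts' ds"
    have s: "v < n" if "v \<in> set (i # j # t # d # ?c)" for v
      using that w(1) unfolding is_word_def t by auto
    have 1: "word_value A a i j (t # d # ?c) = \<ominus>\<^bsub>A\<^esub> (word_value A a i d (t # j # ?c) \<oplus>\<^bsub>A\<^esub> word_value A a j d (t # i # ?c))"
      by (rule A.word_value_cyclic) (rule a[OF s])
    have "R (\<lambda>z. psi z (word_value C (g z) i j (t # d # ?c)))
      = R (\<lambda>z. - (psi z (word_value C (g z) i d (t # j # ?c)) + psi z (word_value C (g z) j d (t # i # ?c))))"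
    proof (rule R_cong)
      fix z assume z: "z \<in> ?X"
      have e: "word_value C (g z) i j (t # d # ?c) = \<ominus>\<^bsub>C\<^esub> (word_value C (g z) i d (t # j # ?c) \<oplus>\<^bsub>C\<^esub> word_value C (g z) j d (t # i # ?c))"
        by (rule C.word_value_cyclic) (rule g[OF z s])
      have c: "word_value C (g z) i d (t # j # ?c) \<in> carrier C" "word_value C (g z) j d (t # i # ?c) \<in> carrier C"
        by (rule Cc[OF z], use s in auto)+
      show "psi z (word_value C (g z) i j (t # d # ?c))
        = - (psi z (word_value C (g z) i d (t # j # ?c)) + psi z (word_value C (g z) j d (t # i # ?c)))"
        unfolding e using c z by (simp add: psi_neg psi_add)
    qed
    then show "P i j ts (d # ds)" using 1 w(2,3) unfolding P_def il R_neg R_add by simp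
  next
    fix i j ts ds
    assume w: "is_word {..<n} ?k i j ts ds" "i = Min ({..<n} - set ts)" "sorted ts" "sorted ds"
    let ?x = "(j, set ts)"
    have x: "?x \<in> ?X" by (rule normal_value_of_word(1)[OF w])
    have "R (\<lambda>x. psi x (word_value C (g x) i j (interleave ts ds)))
      = (\<Oplus>\<^bsub>A\<^esub>x\<in>?X. (psi x (normal_value C (g x) n ?x) / ?e x) \<odot>\<^bsub>A\<^esub> normal_value A a n x)"
      unfolding R_def normal_value_of_word(2)[OF w] ..
    also have "\<dots> = (psi ?x (normal_value C (g ?x) n ?x) / ?e ?x) \<odot>\<^bsub>A\<^esub> normal_value A a n ?x"
      by (rule A.finsum_one[OF fin x]) (use off[OF _ x] NA x in auto)
    also have "\<dots> = normal_value A a n ?x" using diag[OF x] NA[OF x] by simp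
    also have "\<dots> = word_value A a i j (interleave ts ds)" by (rule normal_value_of_word(2)[OF w])
    finally show "P i j ts ds" unfolding P_def by (rule sym)
  qed
  have fw: "distinct (leaves w)" "vars w = {..<n}" "w \<noteq> Var v" if "f w \<noteq> 0" for w v
  proof -
    show "distinct (leaves w)" "vars w = {..<n}" using f that unfolding multilinear_def by blast+
    then have "card (vars w) = n" by simp
    then show "w \<noteq> Var v" using n by auto
  qed
  have mono: "eval_monomial A a w = R (\<lambda>x. psi x (eval_monomial C (g x) w))" if fn: "f w \<noteq> 0" for w
  proof -
    have ea: "eval_monomial A a w = (case leftnorm w of None \<Rightarrow> \<zero>\<^bsub>A\<^esub> | Some (i, j, cs) \<Rightarrow> word_value A a i j cs)"
      by (rule A.eval_leftnorm) (use fw[OF fn] a in auto)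
    have ec: "eval_monomial C (g x) w = (case leftnorm w of None \<Rightarrow> \<zero>\<^bsub>C\<^esub> | Some (i, j, cs) \<Rightarrow> word_value C (g x) i j cs)"
      if "x \<in> ?X" for x
      by (rule C.eval_leftnorm) (use fw[OF fn] g[OF that] in auto)
    show ?thesis
    proof (cases "leftnorm w")
      case None
      have "R (\<lambda>x. psi x (eval_monomial C (g x) w)) = R (\<lambda>x. 0)"
        by (rule R_cong) (simp add: ec None psi_zero)
      then show ?thesis using ea None R_zero by simp
    next
      case (Some r)
      obtain i j cs where r: "r = (i, j, cs)" by (cases r)
      obtain ts ds where w: "cs = interleave ts ds" "is_word {..<n} ?k i j ts ds"
        using is_word_of_monomial[OF fw(1,2)[OF fn]] Some r by metis
      have "R (\<lambda>x. psi x (eval_monomial C (g x) w)) = R (\<lambda>x. psi x (word_value C (g x) i j cs))"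
        by (rule R_cong) (simp add: ec Some r)
      then show ?thesis using P[OF w(2)] unfolding P_def by (simp add: ea Some r w(1))
    qed
  qed
  let ?F = "{w. f w \<noteq> 0}"
  have finF: "finite ?F" using f by (simp add: multilinear_def)
  have emC: "eval_monomial C (g x) w \<in> carrier C" if "x \<in> ?X" "f w \<noteq> 0" for x w
    using fw(2)[OF that(2)] g[OF that(1)] by (intro C.eval_monomial_closed) auto
  have psi_sum: "psi x (\<Oplus>\<^bsub>C\<^esub>w\<in>S. f w \<odot>\<^bsub>C\<^esub> eval_monomial C (g x) w) = (\<Sum>w\<in>S. f w * psi x (eval_monomial C (g x) w))"
    if "S \<subseteq> ?F" "x \<in> ?X" for S x
  proof -
    have "finite S" using that(1) finF finite_subset by blast
    then show ?thesis using that(1)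
    proof (induct S)
      case empty then show ?case using psi_zero[OF that(2)] by simp
    next
      case (insert w S)
      have "(\<lambda>w. f w \<odot>\<^bsub>C\<^esub> eval_monomial C (g x) w) \<in> S \<rightarrow> carrier C" "f w \<odot>\<^bsub>C\<^esub> eval_monomial C (g x) w \<in> carrier C"
        using insert(4) emC[OF that(2)] by auto
      then show ?case using insert emC[OF that(2), of w]
        by (simp add: psi_add[OF that(2)] psi_smult[OF that(2)] C.finsum_closed)
    qed
  qed
  have R_sum: "(\<Oplus>\<^bsub>A\<^esub>w\<in>S. f w \<odot>\<^bsub>A\<^esub> R (c w)) = R (\<lambda>x. \<Sum>w\<in>S. f w * c w x)" if "finite S" for S and c :: "nat monomial \<Rightarrow> nat \<times> nat set \<Rightarrow> 'f"
    using that
  proof (induct S)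
    case empty show ?case using R_zero by simp
  next
    case (insert w S)
    have "(\<lambda>w. f w \<odot>\<^bsub>A\<^esub> R (c w)) \<in> S \<rightarrow> carrier A" using Rc by auto
    then show ?case using insert Rc by (simp add: R_add R_smult)
  qed
  have "eval_polynomial A a f = (\<Oplus>\<^bsub>A\<^esub>w\<in>?F. f w \<odot>\<^bsub>A\<^esub> R (\<lambda>x. psi x (eval_monomial C (g x) w)))"
    unfolding eval_polynomial_def by (rule A.M.add.finprod_cong') (use mono Rc in auto)
  also have "\<dots> = R (\<lambda>x. \<Sum>w\<in>?F. f w * psi x (eval_monomial C (g x) w))" by (rule R_sum[OF finF])
  also have "\<dots> = R (\<lambda>x. 0)"
  proof (rule R_cong)
    fix x assume x: "x \<in> ?X"
    show "(\<Sum>w\<in>?F. f w * psi x (eval_monomial C (g x) w)) = 0"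
      using zero[OF x] psi_sum[OF order_refl x] unfolding eval_polynomial_def by simp
  qed
  finally show ?thesis using R_zero by simp
qed

section \<open>Two odd generators suffice\<close>

definition unit_vector :: "nat \<Rightarrow> nat \<Rightarrow> 'f::field_char_0" where
  "unit_vector l = (\<lambda>i. if i = l then 1 else 0)"

lemma act_unit_vector: "l < d \<Longrightarrow> act d (unit_vector l) u cs = u (l # cs)"
proof -
  assume "l < d"
  have "act d (unit_vector l) u cs = (\<Sum>i<d. if i = l then u (i # cs) else 0)"
    unfolding act_def unit_vector_def by (rule sum.cong) auto
  then show ?thesis using \<open>l < d\<close> by simp
qed

lemma split_mult_right:
  "(\<lambda>i. 0, u) \<otimes>\<^bsub>split_extension p d k\<^esub> (z, u') = (\<lambda>i. 0, act d z u)"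
  by (simp add: split_simps signed_act_linear)

lemma split_rmul_letters:
  assumes "\<And>c. c \<in> set cs \<Longrightarrow> fst (a c) = unit_vector (lab c)" "\<And>c. c \<in> set cs \<Longrightarrow> lab c < d"
  shows "rmul (split_extension p d k) (\<lambda>i. 0, u) (map a cs) = (\<lambda>i. 0, \<lambda>ds. u (map lab cs @ ds))"
  using assms
proof (induct cs arbitrary: u)
  case (Cons c cs)
  obtain v where "a c = (unit_vector (lab c), v)" using Cons(2)[of c] by (cases "a c") auto
  then have "(\<lambda>i. 0, u) \<otimes>\<^bsub>split_extension p d k\<^esub> a c = (\<lambda>i. 0, \<lambda>ds. u (lab c # ds))"
    using Cons(3)[of c] by (simp add: split_mult_right act_unit_vector fun_eq_iff)
  then show ?case using Cons by simp
qed simp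

lemma split_rmul_null:
  assumes "c \<in> set cs" "fst (a c) = (\<lambda>i. 0)"
  shows "rmul (split_extension p d k) (\<lambda>i. 0, u) (map a cs) = (\<lambda>i. 0, \<lambda>cs. 0)"
proof -
  have step: "\<exists>w. (\<lambda>i. 0, v) \<otimes>\<^bsub>split_extension p d k\<^esub> e = (\<lambda>i. 0, w)" for v e
    by (cases e) (simp add: split_mult_right)
  have zero: "(\<lambda>i. 0, \<lambda>cs. 0) \<otimes>\<^bsub>split_extension p d k\<^esub> e = (\<lambda>i. 0, \<lambda>cs. 0)" for e
    by (cases e) (simp add: split_mult_right act_linear fun_eq_iff)
  have zeros: "rmul (split_extension p d k) (\<lambda>i. 0, \<lambda>cs. 0) (map a cs) = (\<lambda>i. 0, \<lambda>cs. 0)" for cs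
    by (induct cs) (auto simp: zero)
  show ?thesis using assms(1)
  proof (induct cs arbitrary: u)
    case (Cons b cs)
    show ?case
    proof (cases "b = c")
      case True
      obtain u' where "a c = (\<lambda>i. 0, u')" using assms(2) by (cases "a c") auto
      then have "(\<lambda>i. 0, u) \<otimes>\<^bsub>split_extension p d k\<^esub> a c = (\<lambda>i. 0, \<lambda>cs. 0)"
        by (simp add: split_mult_right act_linear fun_eq_iff)
      then show ?thesis using True zeros by simp
    next
      case False
      then have "c \<in> set cs" using Cons(2) by simp
      obtain w where "(\<lambda>i. 0, u) \<otimes>\<^bsub>split_extension p d k\<^esub> a b = (\<lambda>i. 0, w)" using step by blast
      then show ?thesis using Cons(1)[OF \<open>c \<in> set cs\<close>] by simp
    qed
  qed simp
qed

primrec alternating :: "nat \<Rightarrow> nat list \<Rightarrow> bool" where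
  "alternating l [] \<longleftrightarrow> True"
| "alternating l (c # cs) \<longleftrightarrow> c = l \<and> alternating (1 - l) cs"

lemma alternating_swap:
  "l \<le> 1 \<Longrightarrow> alternating l (xs @ [a, b, c] @ ys) \<longleftrightarrow> alternating l (xs @ [c, b, a] @ ys)"
  by (induct xs arbitrary: l) auto

lemma alternating_interleave:
  "\<lbrakk>l \<le> 1; length ds \<le> length ts; length ts \<le> Suc (length ds)\<rbrakk> \<Longrightarrow>
    alternating l (interleave ts ds) \<longleftrightarrow> (\<forall>t\<in>set ts. t = l) \<and> (\<forall>d\<in>set ds. d = 1 - l)"
proof (induct ts ds arbitrary: l rule: interleave.induct)
  case (2 t ts ds)
  have "1 - (1 - l) = l" using 2(2) by simp
  then show ?case using 2 by auto
qed auto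

text \<open>This detects the words \<open>0, 1, 0, 1, \<dots>\<close> of length \<open>n\<close>. It is symmetric under the exchange of two
  letters of positions with the same parity, which for odd letters is skew-symmetry in the super sense.\<close>

definition alternating_fun :: "nat \<Rightarrow> nat list \<Rightarrow> 'f::field_char_0" where
  "alternating_fun n cs = (if length cs = n \<and> alternating 0 cs then 1 else 0)"

lemma super_skew_alternating_fun: "super_skew (\<lambda>_. 1) (alternating_fun n)"
  unfolding super_skew_def
proof (intro allI)
  fix xs a b c ys
  have "alternating_fun n (xs @ [a, b, c] @ ys) = (alternating_fun n (xs @ [c, b, a] @ ys) :: 'a)"
    using alternating_swap[of 0 xs a b c ys] by (simp add: alternating_fun_def)
  then show "alternating_fun n (xs @ [a, b, c] @ ys) = - (koszul_factor 1 1 * koszul_factor 1 1 *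
    koszul_factor 1 1 * (alternating_fun n (xs @ [c, b, a] @ ys) :: 'a))"
    by (simp add: koszul_factor_def)
qed

lemma weight_all_odd: "weight (\<lambda>_. 1) cs = of_nat (length cs)"
  by (induct cs) auto

lemma (in nonassoc_algebra) eval_polynomial_monom:
  "eval_monomial A b w \<in> carrier A \<Longrightarrow> eval_polynomial A b (monom w) = eval_monomial A b w"
proof -
  assume "eval_monomial A b w \<in> carrier A"
  moreover have "{v. monom w v \<noteq> (0::'f)} = {w}" by (auto simp: monom_def)
  ultimately show ?thesis by (simp add: eval_polynomial_def monom_def)
qed

lemma odd_vars_cong: "set us = set vs \<Longrightarrow> odd_vars p us = odd_vars p vs"
  by (rule fset_eqI) simp

text \<open>The letters \<open>x = e\<^sub>0\<close> and \<open>y = (e\<^sub>1, alternating_fun n)\<close> of a split null extension are odd, and \<open>y x\<close>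
  is the functional that expects the rest of an alternating word. Substituting \<open>y x\<close> for \<open>b\<close> kills a word unless \<open>b\<close> is in
  its initial product, since products annihilate each other. Otherwise the word survives only if \<open>x\<close>
  stands exactly at the odd positions and \<open>y\<close> at all others, so that its set of odd positions is \<open>T\<close>. This gives the
  functionals for \<open>multilinear_vanishes\<close>.\<close>

lemma odd_generated_satisfies:
  fixes f :: "('f::field_char_0, nat) polynomial"
  assumes f: "multilinear n f" and n: "2 \<le> n"
    and sat: "free_satisfies 0 2 f"
    and A: "jordan_metabelian A" and a: "\<And>v. v < n \<Longrightarrow> a v \<in> carrier A"
  shows "eval_polynomial A a f = \<zero>\<^bsub>A\<^esub>"
proof -
  \<comment> \<open>The function takes nonzero values on words of \<open>n\<close> odd letters; with this shift it is odd.\<close>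
  define k :: bit where "k = 1 + of_nat n"
  let ?M = "split_extension (\<lambda>_. 1) 2 k :: ('f, 'f split_element) superalgebra"
  interpret M: superalgebra ?M by (rule split_superalgebra)
  have jM: "jordan_metabelian_superalgebra ?M" by (rule split_jordan_metabelian)
  then have jC: "jordan_metabelian M.G" by (simp add: jordan_metabelian_superalgebra_def)
  interpret C: jordan_metabelian M.G by (rule jC)
  let ?X = "(unit_vector 0, \<lambda>_. 0) :: 'f split_element" and ?Y = "(unit_vector 1, alternating_fun n) :: 'f split_element"
  define gen where "gen v = (case v of Inl _ \<Rightarrow> \<zero>\<^bsub>?M\<^esub> | Inr j \<Rightarrow> if j = (0::nat) then ?X else ?Y)" for v :: "nat + nat"
  have XY: "?X \<in> grade ?M 1" "?Y \<in> grade ?M 1"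
  proof -
    show "?X \<in> grade ?M 1" by (auto simp: split_simps unit_vector_def super_skew_linear)
    have "k + weight (\<lambda>_. 1) cs = 1" if "alternating_fun n cs \<noteq> (0::'f)" for cs
    proof -
      have "length cs = n" using that by (simp add: alternating_fun_def split: if_splits)
      then show ?thesis unfolding weight_all_odd k_def by (simp only: add.assoc bit_add_self add_0_right)
    qed
    then show "?Y \<in> grade ?M 1"
      unfolding split_simps using super_skew_alternating_fun by (auto simp: unit_vector_def)
  qed
  have gen: "gen v \<in> grade ?M (generator_parity v)" if "v \<in> gens 0 2" for v
    using that XY by (cases v) (auto simp: gen_def gens_def)
  define lab where "lab T i = (if i \<in> T then 0 else 1 :: nat)" for T :: "nat set" and i :: nat
  define elt :: "nat \<times> nat set \<Rightarrow> nat \<Rightarrow> (nat + nat) monomial"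
    where "elt x i = (if i = fst x then Mul (Var (Inr 1)) (Var (Inr 0)) else Var (Inr (lab (snd x) i)))" for x i
  define par where "par x i = (monomial_parity (elt x i))" for x i
  have vars_elt: "vars (elt x i) \<subseteq> gens 0 2" for x i
    by (auto simp: elt_def lab_def gens_def)
  define el where "el x i = eval_monomial ?M gen (elt x i)" for x i
  have el_grade: "el x i \<in> grade ?M (par x i)" for x i
    using XY M.grade_mult[OF XY(2,1)] by (auto simp: el_def par_def elt_def lab_def gen_def)
  have el_sat: "eval_polynomial ?M (el x) (superization (par x) f) = \<zero>\<^bsub>?M\<^esub>" for x
  proof -
    have "eval_polynomial ?M (\<lambda>i. eval_polynomial ?M gen (monom (elt x i))) (superization (par x) f) = \<zero>\<^bsub>?M\<^esub>"
      by (rule free_satisfies_transfer[OF sat jM gen]) (simp_all add: par_def monom_grade[OF vars_elt])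
    moreover have "eval_polynomial ?M gen (monom (elt x i)) = el x i" for i
      unfolding el_def by (rule M.eval_polynomial_monom) (use el_grade[of x i] M.grade_carrier in \<open>auto simp: el_def\<close>)
    ultimately show ?thesis by simp
  qed
  have el_special: "el (b, T) b = (\<lambda>i. 0, \<lambda>cs. alternating_fun n (0 # cs))" for b T
    by (simp add: el_def elt_def gen_def split_simps act_unit_vector signed_act_linear)
  have el_letter: "fst (el (b, T) i) = unit_vector (lab T i)" if "i \<noteq> b" for b T i
    using that by (simp add: el_def elt_def gen_def lab_def)
  define g where "g x i = pure_tensor ?M (odd_vars (par x) [i]) (el x i)" for x i
  have gc: "g x v \<in> carrier M.G" for x v unfolding g_def by (rule M.pure_odd_var_closed) (rule el_grade)
  \<comment> \<open>The coefficient of the common Grassmann monomial, a function on words, is evaluated at the empty word: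
    nothing is left to be read when all letters have acted.\<close>
  define psi where "psi x c = snd (c (odd_vars (par x) [0..<n])) []" for x and c :: "nat fset \<Rightarrow> 'f split_element"
  have add_snd: "snd (y \<oplus>\<^bsub>?M\<^esub> z) cs = snd y cs + snd z cs" for y z cs
    by (cases y, cases z) (simp add: split_simps)
  have smult_snd: "snd (c \<odot>\<^bsub>?M\<^esub> y) cs = c * snd y cs" for y c cs
    by (cases y) (simp add: split_simps)
  have zero_snd: "snd \<zero>\<^bsub>?M\<^esub> cs = 0" for cs by (simp add: split_simps)
  have psi_word: "psi x (word_value M.G (g x) i j (interleave ts ds)) =
      koszul_sign (par x) (i # j # interleave ts ds) * snd (word_value ?M (el x) i j (interleave ts ds)) []"
    if "is_word {..<n} ((n - 1) div 2) i j ts ds" for x i j ts ds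
  proof -
    let ?w = "word_monomial i j (interleave ts ds)"
    have m: "mset (leaves ?w) = mset (i # j # ts @ ds)" by (simp add: leaves_word_monomial)
    have d: "distinct (i # j # ts @ ds)" "set (i # j # ts @ ds) = {..<n}" using that unfolding is_word_def by blast+
    have dl: "distinct (leaves ?w)" using d(1) mset_eq_imp_distinct_iff[OF m] by blast
    have "odd_vars (par x) (leaves ?w) = odd_vars (par x) [0..<n]"
    proof -
      have "set (leaves ?w) = {..<n}" using mset_eq_setD[OF m] d(2) by (simp only:)
      moreover have "set [0..<n] = {..<n}" by auto
      ultimately show ?thesis by (intro odd_vars_cong) (simp only:)
    qed
    moreover have "eval_monomial M.G (g x) ?w = pure_tensor ?M (odd_vars (par x) (leaves ?w))
        (koszul_sign (par x) (leaves ?w) \<odot>\<^bsub>?M\<^esub> eval_monomial ?M (el x) ?w)"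
      unfolding g_def by (rule M.envelope_eval_monomial[OF dl el_grade])
    ultimately show ?thesis
      by (simp add: eval_word_monomial leaves_word_monomial psi_def pure_tensor_def smult_snd)
  qed
  have value_special: "snd (word_value ?M (el (b, T)) b j cs) [] = alternating_fun n (0 # lab T j # map (lab T) cs)"
    if "b \<notin> set (j # cs)" for b T j cs
  proof -
    have "\<exists>v. el (b, T) j = (unit_vector (lab T j), v)" using el_letter[of j b T] that by (cases "el (b, T) j") auto
    then have "el (b, T) b \<otimes>\<^bsub>?M\<^esub> el (b, T) j = (\<lambda>i. 0, \<lambda>cs. alternating_fun n (0 # lab T j # cs))"
      using that by (auto simp: el_special split_mult_right act_unit_vector lab_def fun_eq_iff)
    moreover have "rmul ?M (\<lambda>i. 0, \<lambda>cs. alternating_fun n (0 # lab T j # cs)) (map (el (b, T)) cs)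
        = (\<lambda>i. 0, \<lambda>ds. alternating_fun n (0 # lab T j # map (lab T) cs @ ds))"
      using that by (intro split_rmul_letters el_letter) (auto simp: lab_def)
    ultimately show ?thesis by (simp add: word_value_def)
  qed
  have value_null: "snd (word_value ?M (el (b, T)) i j cs) [] = 0" if "b \<in> set cs" for b T i j cs
  proof -
    obtain u where "el (b, T) i \<otimes>\<^bsub>?M\<^esub> el (b, T) j = (\<lambda>i. 0, u)"
      by (cases "el (b, T) i", cases "el (b, T) j") (auto simp: split_simps)
    then have "word_value ?M (el (b, T)) i j cs = (\<lambda>i. 0, \<lambda>cs. 0)"
      unfolding word_value_def using that by (simp add: split_rmul_null[of b] el_special)
    then show ?thesis by simp
  qed
  have alt: "alternating_fun n (0 # lab T j # map (lab T) (interleave ts ds)) =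
      (if j \<notin> T \<and> set ts \<subseteq> T \<and> set ds \<inter> T = {} then 1 else (0::'f))"
    if w: "is_word {..<n} ((n - 1) div 2) i j ts ds" for i j ts ds T
  proof -
    have d: "distinct (i # j # ts @ ds)" "set (i # j # ts @ ds) = {..<n}" "length ts = (n - 1) div 2"
      using w unfolding is_word_def by blast+
    have "length (i # j # ts @ ds) = n" using distinct_card[OF d(1)] unfolding d(2) by simp
    then have l: "length (0 # lab T j # map (lab T) (interleave ts ds)) = n"
      "length ds \<le> length ts" "length ts \<le> Suc (length ds)" using d(3) by auto
    have "alternating 0 (map (lab T) (interleave ts ds)) \<longleftrightarrow> set ts \<subseteq> T \<and> set ds \<inter> T = {}"
      unfolding map_interleave using l(2,3) by (subst alternating_interleave) (auto simp: lab_def)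
    then show ?thesis using l(1) by (simp add: alternating_fun_def lab_def)
  qed
  have special: "psi (b, T) (word_value M.G (g (b, T)) b j (interleave ts ds)) \<noteq> 0 \<longleftrightarrow>
      j \<notin> T \<and> set ts \<subseteq> T \<and> set ds \<inter> T = {}" if w: "is_word {..<n} ((n - 1) div 2) b j ts ds" for b T j ts ds
  proof -
    have "b \<notin> set (j # interleave ts ds)" using w unfolding is_word_def by auto
    then show ?thesis unfolding psi_word[OF w] by (simp add: value_special alt[OF w])
  qed
  have T_eq: "T' = T" if "(b, T) \<in> normal_indices n" "(b', T') \<in> normal_indices n" "T' \<subseteq> T" for b b' T T'
  proof -
    have "finite T" "card T' = card T" using that(1,2) finite_subset unfolding normal_indices_def by auto
    then show ?thesis using that(3) by (intro card_subset_eq) auto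
  qed
  show ?thesis
  proof (rule multilinear_vanishes[where g = g and psi = psi, OF A jC f n a gc])
    show "psi x (c \<oplus>\<^bsub>M.G\<^esub> c') = psi x c + psi x c'" for x c c'
      by (simp add: psi_def envelope_simps add_snd)
    show "psi x (l \<odot>\<^bsub>M.G\<^esub> c) = l * psi x c" for x c l
      by (simp add: psi_def envelope_simps smult_snd)
    show "psi x (eval_polynomial M.G (g x) f) = 0" for x
      unfolding g_def M.envelope_eval_polynomial[OF f el_grade] el_sat
      by (simp add: psi_def envelope_simps zero_snd)
  next
    fix x assume x: "x \<in> normal_indices n"
    obtain b T where e: "x = (b, T)" by (cases x)
    let ?m = "Min ({..<n} - T)"
    let ?ds = "sorted_list_of_set ({..<n} - T - {?m, b})"
    have w: "is_word {..<n} ((n - 1) div 2) ?m b (sorted_list_of_set T) ?ds"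
      by (rule normal_index_word[OF x[unfolded e]])
    then have w': "is_word {..<n} ((n - 1) div 2) b ?m (sorted_list_of_set T) ?ds"
      unfolding is_word_def by auto
    have fin: "finite T" using x finite_subset unfolding e normal_indices_def by auto
    have mT: "?m \<notin> T" using w fin unfolding is_word_def by auto
    have "psi x (word_value M.G (g x) b ?m (interleave (sorted_list_of_set T) ?ds)) \<noteq> 0"
      unfolding e special[OF w'] using fin mT by auto
    then show "psi x (normal_value M.G (g x) n x) \<noteq> 0"
      using C.word_value_sym[OF gc gc] by (simp add: e normal_value_def)
  next
    fix x y assume x: "x \<in> normal_indices n" and y: "y \<in> normal_indices n" and xy: "x \<noteq> y"
    obtain b T b' T' where e: "x = (b, T)" "y = (b', T')" by (cases x, cases y)
    let ?m = "Min ({..<n} - T')"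
    let ?ts = "sorted_list_of_set T'" and ?ds = "sorted_list_of_set ({..<n} - T' - {?m, b'})"
    have w: "is_word {..<n} ((n - 1) div 2) ?m b' ?ts ?ds"
      by (rule normal_index_word[OF y[unfolded e]])
    then have w': "is_word {..<n} ((n - 1) div 2) b' ?m ?ts ?ds"
      unfolding is_word_def by auto
    have finT': "finite T'" using y finite_subset unfolding e normal_indices_def by auto
    have val: "normal_value M.G (g x) n y = word_value M.G (g x) ?m b' (interleave ?ts ?ds)"
      by (simp add: e normal_value_def)
    have bn: "b \<in> {..<n} - T" "b \<noteq> Min ({..<n} - T)" using x unfolding e normal_indices_def by blast+
    consider "b = b'" | "b = ?m" | "b \<in> set (interleave ?ts ?ds)"
    proof -
      have "b \<in> set (?m # b' # ?ts @ ?ds)" using w bn unfolding is_word_def by auto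
      then show ?thesis using that unfolding set_interleave by auto
    qed
    then show "psi x (normal_value M.G (g x) n y) = 0"
    proof cases
      case 1
      show ?thesis
      proof (rule ccontr)
        assume nz: "psi x (normal_value M.G (g x) n y) \<noteq> 0"
        have "normal_value M.G (g x) n y = word_value M.G (g x) b' ?m (interleave ?ts ?ds)"
          unfolding val by (rule C.word_value_sym[OF gc gc])
        then have "psi (b', T) (word_value M.G (g (b', T)) b' ?m (interleave ?ts ?ds)) \<noteq> 0"
          using nz by (simp only: e(1) 1) simp
        then have "set ?ts \<subseteq> T" unfolding special[OF w'] by blast
        then have "T' \<subseteq> T" using finT' by simp
        then have "T' = T" using T_eq x y unfolding e by blast
        then show False using xy 1 unfolding e by blast
      qed
    next
      case 2
      show ?thesis
      proof (rule ccontr)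
        assume "psi x (normal_value M.G (g x) n y) \<noteq> 0"
        then have "psi (?m, T) (word_value M.G (g (?m, T)) ?m b' (interleave ?ts ?ds)) \<noteq> 0"
          using e(1) 2 val by simp
        then have "set ?ts \<subseteq> T" unfolding special[OF w] by blast
        then have "T' \<subseteq> T" using finT' by simp
        then have "T' = T" using T_eq x y unfolding e by blast
        then show False using bn(2) 2 by blast
      qed
    next
      case 3
      then show ?thesis unfolding val psi_word[OF w] by (simp add: e(1) value_null del: set_interleave)
    qed
  qed
qed

text \<open>For \<open>n < 2\<close> the only monomial of a multilinear polynomial is \<open>Var 0\<close>, and its coefficient vanishes because there are
  Jordan metabelian superalgebras with a nonzero odd element.\<close>

lemma two_odd_generators_universal:
  fixes f :: "('f::field_char_0, nat) polynomial"
  assumes f: "multilinear n f"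
    and sat: "free_satisfies 0 2 f"
    and B: "jordan_metabelian_superalgebra B"
  shows "satisfies_superidentity B f"
proof -
  interpret B: superalgebra B using B by (simp add: jordan_metabelian_superalgebra_def)
  have jG: "jordan_metabelian B.G" using B by (simp add: jordan_metabelian_superalgebra_def)
  show ?thesis
  proof (cases "2 \<le> n")
    case True
    show ?thesis
      by (rule B.satisfies_superidentity_if_envelope[OF f odd_generated_satisfies[OF f True sat jG]])
  next
    case False
    have fw: "w = Var 0" if "f w \<noteq> 0" for w
    proof (cases w)
      case (Var v)
      have "vars w = {..<n}" using f that unfolding multilinear_def by blast
      then have "v < n" using Var by auto
      then show ?thesis using Var False by simp
    next
      case (Mul u v)
      have d: "distinct (leaves w)" "vars w = {..<n}" using f that unfolding multilinear_def by blast+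
      have "length (leaves w) = n" using distinct_card[OF d(1)] d(2) by simp
      moreover have "leaves u \<noteq> []" "leaves v \<noteq> []" for u v :: "nat monomial" by (induct u, auto, induct v, auto)
      then have "0 < length (leaves u)" "0 < length (leaves v)" by auto
      ultimately show ?thesis using False Mul by simp
    qed
    have "f (Var 0) = 0"
    proof (rule ccontr)
      assume nz: "f (Var 0) \<noteq> 0"
      let ?M = "split_extension (\<lambda>_. 1) 2 0 :: ('f, 'f split_element) superalgebra"
      interpret M: superalgebra ?M by (rule split_superalgebra)
      let ?X = "(unit_vector 0, \<lambda>_. 0) :: 'f split_element"
      let ?b = "\<lambda>g. case g of Inl _ \<Rightarrow> \<zero>\<^bsub>?M\<^esub> | Inr _ \<Rightarrow> ?X"
      have X: "?X \<in> grade ?M 1" by (auto simp: split_simps unit_vector_def super_skew_linear)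
      then have Xc: "?X \<in> carrier ?M" by (rule M.grade_carrier)
      let ?x = "monom (Var (Inr 0)) :: ('f, nat + nat) polynomial"
      have "eval_polynomial ?M (\<lambda>i. eval_polynomial ?M ?b ?x) (superization (\<lambda>_. 1) f) = \<zero>\<^bsub>?M\<^esub>"
        by (rule free_satisfies_transfer[OF sat split_jordan_metabelian])
          (use X monom_grade[of "Var (Inr 0)" 0 2] in \<open>auto simp: gens_def\<close>)
      moreover have "eval_polynomial ?M ?b ?x = ?X"
        using M.eval_polynomial_monom[of ?b "Var (Inr 0)"] Xc by simp
      moreover have "{w. superization (\<lambda>_. 1) f w \<noteq> 0} = {Var 0}"
        unfolding superization_support using fw nz by blast
      ultimately have "superization (\<lambda>_. 1) f (Var 0) \<odot>\<^bsub>?M\<^esub> ?X = \<zero>\<^bsub>?M\<^esub>"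
        using Xc by (simp add: eval_polynomial_def)
      then have "?X = \<zero>\<^bsub>?M\<^esub>" using M.smult_eq_zero[OF Xc] nz superization_support[of "\<lambda>_. 1" f "Var 0"] by blast
      then have "unit_vector 0 = (\<lambda>i. 0 :: 'f)" by (simp add: split_simps)
      then have "unit_vector 0 0 = (0 :: 'f)" by (rule fun_cong)
      then show False by (simp add: unit_vector_def)
    qed
    then have "{w. superization p f w \<noteq> 0} = {}" for p unfolding superization_support using fw by blast
    then show ?thesis unfolding satisfies_superidentity_def eval_polynomial_def by simp
  qed
qed

section \<open>Identities with few generators\<close>

lemma (in superalgebra) pure_product_sq_ann:
  assumes jG: "jordan_metabelian G" and xy: "x \<in> grade A i" "y \<in> grade A j" and S: "of_nat (fcard S) = i + j"
  shows "pure_tensor A S (x \<otimes> y) \<in> jordan_metabelian.sq_ann G"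
proof -
  interpret G: jordan_metabelian G by (rule jG)
  have c: "x \<otimes> y \<in> grade A (of_nat (fcard S))" unfolding S by (rule grade_mult[OF xy])
  then have cG: "pure_tensor A S (x \<otimes> y) \<in> carrier G" by (rule pure_closed)
  have pure: "(pure_tensor A P a \<otimes>\<^bsub>G\<^esub> pure_tensor A R b) \<otimes>\<^bsub>G\<^esub> pure_tensor A S (x \<otimes> y) = \<zero>\<^bsub>G\<^esub>"
    if ab: "a \<in> grade A (of_nat (fcard P))" "b \<in> grade A (of_nat (fcard R))" for P R a b
  proof -
    have z: "(a \<otimes> b) \<otimes> (x \<otimes> y) = \<zero>" by (rule metabelian_if_envelope[OF jG ab xy])
    have cc: "a \<in> carrier A" "b \<in> carrier A" "x \<otimes> y \<in> carrier A" using ab c grade_carrier by auto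
    then show ?thesis using z cG
      by (cases "P |\<inter>| R = {||}") (auto simp: pure_mult mult_closed smult_mult_left)
  qed
  have "(g \<otimes>\<^bsub>G\<^esub> h) \<otimes>\<^bsub>G\<^esub> pure_tensor A S (x \<otimes> y) = \<zero>\<^bsub>G\<^esub>" if "g \<in> carrier G" "h \<in> carrier G" for g h
    using that
  proof (induct g rule: envelope_induct)
    case zero
    then show ?case using cG by simp
  next
    case (add P a g')
    note A1 = add
    from A1(4) have "(pure_tensor A P a \<otimes>\<^bsub>G\<^esub> h) \<otimes>\<^bsub>G\<^esub> pure_tensor A S (x \<otimes> y) = \<zero>\<^bsub>G\<^esub>"
    proof (induct h rule: envelope_induct)
      case zero
      then show ?case using cG A1(1) by simp
    next
      case (add R b h')
      then show ?case using A1(1) cG pure[OF A1(1) add(1)]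
        by (simp add: G.distrib_left G.distrib_right G.mult_closed)
    qed
    then show ?case using A1 cG by (simp add: G.distrib_right G.mult_closed)
  qed
  then show ?thesis using cG by (simp add: G.sq_ann_def)
qed

text \<open>The Grassmann generators attached to the two copies of \<open>x\<close> anticommute, while \<open>(c x) x\<close> is the same in
  both summands.\<close>

lemma (in superalgebra) pure_odd_anticommute:
  assumes x: "x \<in> grade A 1" and w: "w \<in> carrier G"
  shows "sym_pair G w (pure_tensor A {|i|} x, pure_tensor A {|j|} x) = \<zero>\<^bsub>G\<^esub>"
proof -
  interpret G: nonassoc_algebra G by (rule envelope_nonassoc_algebra)
  have xc: "x \<in> carrier A" using x by (rule grade_carrier)
  have h: "pure_tensor A {|i|} x \<in> carrier G" for i using x by simp
  show ?thesis using w
  proof (induct w rule: envelope_induct)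
    case zero show ?case using h by (simp add: G.sym_pair_zero)
  next
    case (add P c w)
    have cc: "c \<in> carrier A" using add(1) by (rule grade_carrier)
    have t: "(pure_tensor A P c \<otimes>\<^bsub>G\<^esub> pure_tensor A {|i|} x) \<otimes>\<^bsub>G\<^esub> pure_tensor A {|j|} x =
      (if i |\<notin>| P \<and> j |\<notin>| P \<and> i \<noteq> j then pure_tensor A (P |\<union>| {|i, j|})
        ((grassmann_sign P {|i|} * grassmann_sign P {|j|} * grassmann_sign {|i|} {|j|}) \<odot> ((c \<otimes> x) \<otimes> x)) else \<zero>\<^bsub>G\<^esub>)"
      for i j
    proof -
      have s: "(P |\<union>| {|i|}) |\<union>| {|j|} = P |\<union>| {|i, j|}" by auto
      have "grassmann_sign (P |\<union>| {|i|}) {|j|} = (grassmann_sign P {|j|} * grassmann_sign {|i|} {|j|} :: 'f)"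
        if "i |\<notin>| P" by (rule grassmann_sign_union_left) (use that in auto)
      then show ?thesis using cc xc h
        by (auto simp: pure_mult mult_closed smult_mult_left smult_smult s[simplified] mult_ac)
    qed
    have "sym_pair G (pure_tensor A P c) (pure_tensor A {|i|} x, pure_tensor A {|j|} x) = \<zero>\<^bsub>G\<^esub>"
    proof (cases "i |\<notin>| P \<and> j |\<notin>| P \<and> i \<noteq> j")
      case True
      let ?y = "(c \<otimes> x) \<otimes> x" and ?s = "grassmann_sign P {|i|} * grassmann_sign P {|j|} * grassmann_sign {|i|} {|j|} :: 'f"
      have yc: "?y \<in> carrier A" using cc xc by (simp add: mult_closed)
      have "grassmann_sign {|j|} {|i|} = - (grassmann_sign {|i|} {|j|} :: 'f)"
        using True by (subst grassmann_sign_swap) auto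
      then have "grassmann_sign P {|j|} * grassmann_sign P {|i|} * grassmann_sign {|j|} {|i|} = - ?s" by simp
      moreover have "{|j, i|} = {|i, j|}" by auto
      ultimately have "sym_pair G (pure_tensor A P c) (pure_tensor A {|i|} x, pure_tensor A {|j|} x)
        = pure_tensor A (P |\<union>| {|i, j|}) (?s \<odot> ?y) \<oplus>\<^bsub>G\<^esub> pure_tensor A (P |\<union>| {|i, j|}) ((- ?s) \<odot> ?y)"
        using True unfolding sym_pair_def fst_conv snd_conv t by simp
      also have "\<dots> = pure_tensor A (P |\<union>| {|i, j|}) ((?s + - ?s) \<odot> ?y)"
        using yc by (simp only: pure_add[symmetric] smult_closed_alg smult_add_left[symmetric])
      finally show ?thesis using yc by simp
    next
      case False
      then show ?thesis unfolding sym_pair_def fst_conv snd_conv t using G.M.l_zero by auto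
    qed
    then show ?case using add h by (simp add: G.sym_pair_add)
  qed
qed

text \<open>The images in the envelope of the generators of a quotient of the free superalgebra: finitely many even ones, and
  for each odd generator one copy for every Grassmann generator.\<close>

definition even_letters :: "('f::field_char_0, nat + nat) polynomial set \<Rightarrow> nat \<Rightarrow> nat \<Rightarrow> (nat fset \<Rightarrow> 'f free_element) list" where
  "even_letters I r s = map (\<lambda>j. pure_tensor (quotient_superalgebra (free_nonassoc_superalgebra r s) I) {||}
     (I +>\<^bsub>free_nonassoc_superalgebra r s\<^esub> monom (Var (Inl j)))) [0..<r]"

definition odd_letters :: "('f::field_char_0, nat + nat) polynomial set \<Rightarrow> nat \<Rightarrow> nat \<Rightarrow> (nat fset \<Rightarrow> 'f free_element) set" where
  "odd_letters I r s = {pure_tensor (quotient_superalgebra (free_nonassoc_superalgebra r s) I) {|v|}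
     (I +>\<^bsub>free_nonassoc_superalgebra r s\<^esub> monom (Var (Inr j))) | v j. j < s}"

text \<open>A monomial is a generator or a product, and products belong to \<open>sq_ann\<close>.\<close>

lemma pure_in_span_of_letters:
  fixes I :: "('f::field_char_0, nat + nat) polynomial set"
  assumes I: "admissible r s I"
    and y: "y \<in> grade (quotient_superalgebra (free_nonassoc_superalgebra r s) I) (p v)"
  defines "Q \<equiv> quotient_superalgebra (free_nonassoc_superalgebra r s) I"
  shows "pure_tensor Q (odd_vars p [v]) y \<in> nonassoc_algebra.lin_span (grassmann_envelope Q)
      (set (even_letters I r s) \<union> odd_letters I r s \<union> jordan_metabelian.sq_ann (grassmann_envelope Q))"
proof -
  let ?N = "free_nonassoc_superalgebra r s :: ('f, ('f, nat + nat) polynomial) superalgebra"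
  interpret N: superalgebra ?N by (rule free_superalgebra)
  have gi: "graded_ideal ?N I" and jQ: "jordan_metabelian_superalgebra Q"
    using I by (auto simp: admissible_def Q_def)
  interpret Q: superalgebra Q using jQ by (simp add: jordan_metabelian_superalgebra_def)
  have jG: "jordan_metabelian Q.G" using jQ by (simp add: jordan_metabelian_superalgebra_def)
  interpret G: jordan_metabelian Q.G by (rule jG)
  let ?S = "odd_vars p [v]"
  let ?X = "set (even_letters I r s) \<union> odd_letters I r s \<union> G.sq_ann"
  let ?b = "\<lambda>g. I +>\<^bsub>?N\<^esub> monom (Var g)"
  have S: "of_nat (fcard ?S) = p v" "p v = 0 \<Longrightarrow> ?S = {||}" "p v = 1 \<Longrightarrow> ?S = {|v|}"
    by (cases "p v", auto simp: odd_vars_def)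
  obtain n where n: "n \<in> grade ?N (p v)" "y = I +>\<^bsub>?N\<^esub> n" using y by (auto simp: quotient_simps(6))
  have nc: "n \<in> carrier ?N" using n(1) by (rule N.grade_carrier)
  have yn: "y = eval_polynomial Q ?b n" unfolding n(2) Q_def by (rule quotient_eval_generators[OF gi nc, symmetric])
  have bg: "?b g \<in> grade Q (generator_parity g)" if "g \<in> gens r s" for g
    unfolding Q_def quotient_simps(6) using monom_grade[of "Var g" r s] that by (intro imageI) auto
  have w: "monomial_parity w = p v" "vars w \<subseteq> gens r s" if "n w \<noteq> 0" for w
    using n(1) that by (auto simp: free_nonassoc_simps(6) free_nonassoc_simps(1))
  have eg: "eval_monomial Q ?b w \<in> grade Q (monomial_parity w)" if "vars w \<subseteq> gens r s" for w
    using that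
  proof (induct w)
    case (Var g) then show ?case using bg by simp
  next
    case (Mul u w)
    then show ?case using Q.grade_mult unfolding eval_monomial.simps monomial_parity.simps by auto
  qed
  have in_letters: "pure_tensor Q ?S (eval_monomial Q ?b w) \<in> ?X" if "n w \<noteq> 0" for w
  proof (cases w)
    case (Var g)
    show ?thesis
    proof (cases g)
      case (Inl j)
      then have "j < r" "p v = 0" using w[OF that] Var by (auto simp: gens_def)
      then show ?thesis using Var Inl S(2) by (auto simp: even_letters_def Q_def)
    next
      case (Inr j)
      then have "j < s" "p v = 1" using w[OF that] Var by (auto simp: gens_def)
      then show ?thesis using Var Inr S(3) by (auto simp: odd_letters_def Q_def)
    qed
  next
    case (Mul u u')
    have g: "eval_monomial Q ?b u \<in> grade Q (monomial_parity u)" "eval_monomial Q ?b u' \<in> grade Q (monomial_parity u')"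
      using w(2)[OF that] Mul by (auto intro: eg)
    have "of_nat (fcard ?S) = monomial_parity u + monomial_parity u'"
      unfolding S(1) w(1)[OF that, symmetric] Mul by (simp only: monomial_parity.simps)
    then have "pure_tensor Q ?S (eval_monomial Q ?b u \<otimes>\<^bsub>Q\<^esub> eval_monomial Q ?b u') \<in> G.sq_ann"
      by (rule Q.pure_product_sq_ann[OF jG g])
    then show ?thesis unfolding Mul eval_monomial.simps by blast
  qed
  have egS: "eval_monomial Q ?b w \<in> grade Q (of_nat (fcard ?S))" if "n w \<noteq> 0" for w
    using eg[OF w(2)[OF that]] w(1)[OF that] S(1) by simp
  have Xc: "?X \<subseteq> carrier Q.G"
  proof -
    have "x \<in> carrier Q.G" if "x \<in> set (even_letters I r s)" for x
      using that bg[of "Inl _"] by (auto simp: even_letters_def Q_def[symmetric] gens_def intro!: Q.pure_closed)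
    moreover have "x \<in> carrier Q.G" if "x \<in> odd_letters I r s" for x
      using that bg[of "Inr _"] by (auto simp: odd_letters_def Q_def[symmetric] gens_def intro!: Q.pure_closed)
    ultimately show ?thesis using G.sq_ann_carrier by blast
  qed
  have "pure_tensor Q ?S y = (\<Oplus>\<^bsub>Q.G\<^esub>w\<in>{w. n w \<noteq> 0}. pure_tensor Q ?S (n w \<odot>\<^bsub>Q\<^esub> eval_monomial Q ?b w))"
    unfolding yn eval_polynomial_def by (rule Q.pure_finsum) (use egS Q.grade_smult in auto)
  also have "\<dots> \<in> G.lin_span ?X"
  proof (rule G.finsum_in)
    show "G.lin_span ?X \<subseteq> carrier Q.G" by (rule G.lin_span_carrier[OF Xc])
    fix w assume "w \<in> {w. n w \<noteq> 0}"
    then have nz: "n w \<noteq> 0" by simp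
    show "pure_tensor Q ?S (n w \<odot>\<^bsub>Q\<^esub> eval_monomial Q ?b w) \<in> G.lin_span ?X"
      unfolding Q.pure_smult[OF Q.grade_carrier[OF egS[OF nz]]]
      by (rule G.span_smult[OF G.span_base[OF in_letters[OF nz]]])
  qed (auto intro: G.span_zero G.span_add)
  finally show ?thesis .
qed

lemma letters_carrier:
  fixes I :: "('f::field_char_0, nat + nat) polynomial set"
  assumes I: "admissible r s I"
  defines "Q \<equiv> quotient_superalgebra (free_nonassoc_superalgebra r s) I"
  shows "set (even_letters I r s) \<union> odd_letters I r s \<subseteq> carrier (grassmann_envelope Q)"
    "\<And>j. j < s \<Longrightarrow> I +>\<^bsub>free_nonassoc_superalgebra r s\<^esub> monom (Var (Inr j)) \<in> grade Q 1"
proof -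
  have jQ: "jordan_metabelian_superalgebra Q"
    using I by (auto simp: admissible_def Q_def)
  interpret Q: superalgebra Q using jQ by (simp add: jordan_metabelian_superalgebra_def)
  let ?b = "\<lambda>g. I +>\<^bsub>free_nonassoc_superalgebra r s\<^esub> monom (Var g)"
  have bg: "?b g \<in> grade Q (generator_parity g)" if "g \<in> gens r s" for g
    unfolding Q_def quotient_simps(6) using monom_grade[of "Var g" r s] that by (intro imageI) auto
  have b0: "?b (Inl j) \<in> grade Q 0" if "j < r" for j using bg[of "Inl j"] that by (simp add: gens_def)
  show b1: "?b (Inr j) \<in> grade Q 1" if "j < s" for j using bg[of "Inr j"] that by (simp add: gens_def)
  have "x \<in> carrier Q.G" if "x \<in> set (even_letters I r s)" for x
    using that b0 by (auto simp: even_letters_def Q_def[symmetric])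
  moreover have "x \<in> carrier Q.G" if "x \<in> odd_letters I r s" for x
    using that b1 by (auto simp: odd_letters_def Q_def[symmetric])
  ultimately show "set (even_letters I r s) \<union> odd_letters I r s \<subseteq> carrier Q.G" by blast
qed

section \<open>The separating identities\<close>

lemma monom_multilinear:
  assumes "distinct (leaves w)" "vars w = {..<n}"
  shows "multilinear n (monom w)"
proof -
  have "{v. monom w v \<noteq> (0::'a)} = {w}" by (auto simp: monom_def)
  then show ?thesis using assms by (auto simp: multilinear_def monom_apply split: if_splits)
qed

text \<open>The left-normed word with \<open>2 r + 1\<close> right multiplications after the initial product.\<close>

definition long_word :: "nat \<Rightarrow> nat monomial" where
  "long_word r = word_monomial 0 1 [2..<2 * r + 3]"

lemma upt_first_two: "2 \<le> n \<Longrightarrow> 0 # 1 # [2..<n] = [0..<n]"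
  using upt_conv_Cons[of 0 n] upt_conv_Cons[of 1 n] by (simp add: numeral_2_eq_2)

lemma leaves_long_word: "leaves (long_word r) = [0..<2 * r + 3]"
  using upt_first_two[of "2 * r + 3"] by (simp add: long_word_def leaves_word_monomial)

lemma long_word_multilinear: "multilinear (2 * r + 3) (monom (long_word r))"
proof (rule monom_multilinear)
  show "distinct (leaves (long_word r))" by (simp add: leaves_long_word)
  have "set (leaves (long_word r)) = {..<2 * r + 3}" unfolding leaves_long_word by auto
  then show "vars (long_word r) = {..<2 * r + 3}" by (simp only: set_leaves)
qed

text \<open>The monomials in the expansion of \<open>m\<close> symmetrized pairs applied to \<open>Mul (Var 0) (Var 1)\<close>.\<close>

primrec pair_words :: "nat \<Rightarrow> nat monomial set" where
  "pair_words 0 = {Mul (Var 0) (Var 1)}"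
| "pair_words (Suc m) =
    (\<lambda>w. Mul (Mul w (Var (2 * m + 2))) (Var (2 * m + 3))) ` pair_words m \<union>
    (\<lambda>w. Mul (Mul w (Var (2 * m + 3))) (Var (2 * m + 2))) ` pair_words m"

definition pair_polynomial :: "nat \<Rightarrow> ('f::field_char_0, nat) polynomial" where
  "pair_polynomial m = (\<lambda>w. if w \<in> pair_words m then 1 else 0)"

lemma finite_pair_words: "finite (pair_words m)"
  by (induct m) auto

lemma pair_words_leaves: "w \<in> pair_words m \<Longrightarrow> distinct (leaves w) \<and> vars w = {..<2 * m + 2}"
proof (induct m arbitrary: w)
  case 0
  then show ?case by auto
next
  case (Suc m)
  have s: "{..<2 * Suc m + 2} = {..<2 * m + 2} \<union> {2 * m + 2, 2 * m + 3}" by auto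
  from Suc(2) obtain u where u: "u \<in> pair_words m"
    "w = Mul (Mul u (Var (2 * m + 2))) (Var (2 * m + 3)) \<or> w = Mul (Mul u (Var (2 * m + 3))) (Var (2 * m + 2))"
    by auto
  have h: "distinct (leaves u)" "vars u = {..<2 * m + 2}" using Suc(1)[OF u(1)] by blast+
  then have n: "2 * m + 2 \<notin> set (leaves u)" "2 * m + 3 \<notin> set (leaves u)" by simp_all
  from u(2) show ?case
    by (elim disjE; hypsubst) (use h n in \<open>simp_all only: s leaves.simps monomial.set distinct_append, auto\<close>)
qed

lemma pair_polynomial_multilinear: "multilinear (2 * m + 2) (pair_polynomial m)"
proof -
  have "{w. pair_polynomial m w \<noteq> (0::'a)} = pair_words m" by (auto simp: pair_polynomial_def)
  then show ?thesis using finite_pair_words pair_words_leaves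
    by (auto simp: multilinear_def pair_polynomial_def split: if_splits)
qed

lemma (in nonassoc_algebra) eval_pair_polynomial:
  assumes a: "\<And>v. v < 2 * m + 2 \<Longrightarrow> a v \<in> carrier A"
  shows "eval_polynomial A a (pair_polynomial m) =
    sym_pairs A (a 0 \<otimes> a 1) (map (\<lambda>k. (a (2 * k + 2), a (2 * k + 3))) [0..<m])"
proof -
  have ec: "eval_monomial A a w \<in> carrier A" if "w \<in> pair_words k" "k \<le> m" for w k
    using pair_words_leaves[OF that(1)] that(2) a by (intro eval_monomial_closed) auto
  have sum: "(\<Oplus>w\<in>pair_words k. eval_monomial A a w) =
      sym_pairs A (a 0 \<otimes> a 1) (map (\<lambda>k. (a (2 * k + 2), a (2 * k + 3))) [0..<k])" if "k \<le> m" for k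
    using that
  proof (induct k)
    case 0
    have "a 0 \<in> carrier A" "a 1 \<in> carrier A" using a by auto
    then show ?case by (simp add: mult_closed)
  next
    case (Suc k)
    let ?b = "a (2 * k + 2)" and ?c = "a (2 * k + 3)"
    have bc: "?b \<in> carrier A" "?c \<in> carrier A" using a Suc(2) by auto
    define l where "l w = Mul (Mul w (Var (2 * k + 2))) (Var (2 * k + 3))" for w :: "nat monomial"
    define r where "r w = Mul (Mul w (Var (2 * k + 3))) (Var (2 * k + 2))" for w :: "nat monomial"
    let ?W = "pair_words k" and ?e = "eval_monomial A a"
    have e: "?e w \<in> carrier A" if "w \<in> ?W" for w using ec[OF that] Suc(2) by simp
    have el: "?e (l w) = (?e w \<otimes> ?b) \<otimes> ?c" and er: "?e (r w) = (?e w \<otimes> ?c) \<otimes> ?b" for w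
      by (simp_all add: l_def r_def)
    have cl: "?e (l w) \<in> carrier A" "?e (r w) \<in> carrier A" if "w \<in> ?W" for w
      unfolding el er using e[OF that] bc by (simp_all add: mult_closed)
    have dis: "l ` ?W \<inter> r ` ?W = {}" by (auto simp: l_def r_def)
    have inj: "inj_on l ?W" "inj_on r ?W" by (auto simp: l_def r_def inj_on_def)
    have W: "pair_words (Suc k) = l ` ?W \<union> r ` ?W" by (simp add: l_def[abs_def] r_def[abs_def])
    have "(\<Oplus>w\<in>pair_words (Suc k). ?e w) = (\<Oplus>w\<in>l ` ?W. ?e w) \<oplus> (\<Oplus>w\<in>r ` ?W. ?e w)"
      unfolding W by (rule finsum_Un_disjoint[OF _ _ dis]) (use cl finite_pair_words in blast)+
    also have "(\<Oplus>w\<in>l ` ?W. ?e w) = (\<Oplus>w\<in>?W. ?e (l w))"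
      by (rule finsum_reindex[OF _ inj(1)]) (use cl in blast)
    also have "\<dots> = ((\<Oplus>w\<in>?W. ?e w) \<otimes> ?b) \<otimes> ?c"
      unfolding el using e bc by (simp add: finsum_mult_right Pi_def mult_closed)
    also have "(\<Oplus>w\<in>r ` ?W. ?e w) = (\<Oplus>w\<in>?W. ?e (r w))"
      by (rule finsum_reindex[OF _ inj(2)]) (use cl in blast)
    also have "\<dots> = ((\<Oplus>w\<in>?W. ?e w) \<otimes> ?c) \<otimes> ?b"
      unfolding er using e bc by (simp add: finsum_mult_right Pi_def mult_closed)
    finally show ?case using Suc by (simp add: sym_pair_def)
  qed
  have supp: "{w. pair_polynomial m w \<noteq> (0::'f)} = pair_words m" by (auto simp: pair_polynomial_def)
  have "eval_polynomial A a (pair_polynomial m) = (\<Oplus>w\<in>pair_words m. eval_monomial A a w)"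
    unfolding eval_polynomial_def supp
    by (rule M.add.finprod_cong') (use ec in \<open>auto simp: pair_polynomial_def\<close>)
  then show ?thesis using sum[of m] by simp
qed

text \<open>A multilinear identity of the envelope has to be checked only for letters and for elements of \<open>sq_ann\<close>,
  the latter being almost harmless since they annihilate the products.\<close>

lemma free_satisfies_if_envelopes:
  fixes f :: "('f::field_char_0, nat) polynomial"
  assumes f: "multilinear n f"
    and van: "\<And>(I :: ('f, nat + nat) polynomial set) a. \<lbrakk>admissible r s I; \<And>v. v < n \<Longrightarrow>
        a v \<in> nonassoc_algebra.lin_span (grassmann_envelope (quotient_superalgebra (free_nonassoc_superalgebra r s) I))
      (set (even_letters I r s) \<union> odd_letters I r s \<union>
        jordan_metabelian.sq_ann (grassmann_envelope (quotient_superalgebra (free_nonassoc_superalgebra r s) I)))\<rbrakk>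
      \<Longrightarrow> eval_polynomial (grassmann_envelope (quotient_superalgebra (free_nonassoc_superalgebra r s) I)) a f
        = \<zero>\<^bsub>grassmann_envelope (quotient_superalgebra (free_nonassoc_superalgebra r s) I)\<^esub>"
  shows "free_satisfies r s f"
  unfolding free_satisfies_iff
proof (intro allI impI)
  fix I :: "('f, nat + nat) polynomial set" assume I: "admissible r s I"
  let ?Q = "quotient_superalgebra (free_nonassoc_superalgebra r s) I"
  interpret Q: superalgebra ?Q using I by (simp add: admissible_def jordan_metabelian_superalgebra_def)
  show "satisfies_superidentity ?Q f"
    unfolding satisfies_superidentity_def
  proof (intro allI impI)
    fix p :: "nat \<Rightarrow> bit" and a assume a: "\<forall>i. a i \<in> grade ?Q (p i)"
    have "eval_polynomial Q.G (\<lambda>v. pure_tensor ?Q (odd_vars p [v]) (a v)) f = \<zero>\<^bsub>Q.G\<^esub>"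
      by (rule van[OF I]) (rule pure_in_span_of_letters[OF I], use a in blast)
    then show "eval_polynomial ?Q a (superization p f) = \<zero>\<^bsub>?Q\<^esub>"
      using Q.envelope_eval_polynomial[OF f, of a p] a by (simp add: Q.pure_eq_zero_iff)
  qed
qed

lemma (in jordan_metabelian) sym_pair_ann:
  assumes w: "w \<in> sq_closure" and h: "h \<in> sq_ann" "h' \<in> carrier A"
  shows "sym_pair A w (h, h') = \<zero>"
proof -
  have c: "w \<in> carrier A" "h \<in> carrier A" using w h sq_closure_carrier sq_ann_carrier by auto
  have "w \<otimes> h = \<zero>" using w h by (auto simp: sq_closure_def)
  moreover have "(w \<otimes> h') \<otimes> h = \<zero>" using h c by (auto simp: sq_ann_def)
  ultimately show ?thesis using h by (simp add: sym_pair_def)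
qed

text \<open>The \<open>r + 1\<close> pairs outnumber the \<open>r\<close> even letters, while copies of the odd generator and elements of \<open>sq_ann\<close> form only
  zero pairs.\<close>

lemma one_odd_generator_satisfies:
  "free_satisfies r 1 (pair_polynomial (Suc r) :: ('f::field_char_0, nat) polynomial)"
proof (rule free_satisfies_if_envelopes[OF pair_polynomial_multilinear])
  fix I :: "('f, nat + nat) polynomial set" and a
  assume I: "admissible r 1 I"
  let ?Q = "quotient_superalgebra (free_nonassoc_superalgebra r 1) I"
  have jQ: "jordan_metabelian_superalgebra ?Q" using I by (simp add: admissible_def)
  interpret Q: superalgebra ?Q using jQ by (simp add: jordan_metabelian_superalgebra_def)
  interpret G: jordan_metabelian Q.G using jQ by (simp add: jordan_metabelian_superalgebra_def)
  let ?zs = "even_letters I r 1" and ?H = "odd_letters I r 1 \<union> G.sq_ann"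
  let ?X = "set ?zs \<union> odd_letters I r 1 \<union> G.sq_ann"
  assume a: "\<And>v. v < 2 * Suc r + 2 \<Longrightarrow> a v \<in> G.lin_span ?X"
  note lc = letters_carrier[OF I]
  have Xc: "?X \<subseteq> carrier Q.G" using lc(1) G.sq_ann_carrier by blast
  then have ac: "a v \<in> carrier Q.G" if "v < 2 * Suc r + 2" for v
    using a[OF that] G.lin_span_carrier by blast
  have H: "sym_pair Q.G w (h, h') = \<zero>\<^bsub>Q.G\<^esub>" if w: "w \<in> G.sq_closure" and h: "h \<in> ?H" "h' \<in> ?H" for w h h'
  proof -
    have wc: "w \<in> carrier Q.G" using w by (rule G.sq_closure_carrier)
    have hc: "h \<in> carrier Q.G" "h' \<in> carrier Q.G" using h Xc by auto
    consider "h \<in> G.sq_ann" | "h' \<in> G.sq_ann" | "h \<in> odd_letters I r 1" "h' \<in> odd_letters I r 1" using h by blast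
    then show ?thesis
    proof cases
      case 1 show ?thesis by (rule G.sym_pair_ann[OF w 1 hc(2)])
    next
      case 2 show ?thesis using G.sym_pair_ann[OF w 2 hc(1)] G.sym_pair_commute[OF wc hc] by argo
    next
      case 3
      then obtain v v' where
        "h = pure_tensor ?Q {|v|} (I +>\<^bsub>free_nonassoc_superalgebra r 1\<^esub> monom (Var (Inr 0)))"
        "h' = pure_tensor ?Q {|v'|} (I +>\<^bsub>free_nonassoc_superalgebra r 1\<^esub> monom (Var (Inr 0)))"
        by (auto simp: odd_letters_def)
      then show ?thesis using Q.pure_odd_anticommute[OF lc(2) wc] by simp
    qed
  qed
  have van: "sym_pairs Q.G w rs = \<zero>\<^bsub>Q.G\<^esub>"
    if w: "w \<in> G.sq_closure" and rs: "set rs \<subseteq> ?X \<times> ?X" "length rs = Suc r" for w rs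
  proof (rule G.sym_pairs_vanish[where H = ?H and zs = ?zs])
    show "?H \<subseteq> carrier Q.G" "set ?zs \<subseteq> carrier Q.G" using Xc by auto
    show "set rs \<subseteq> (set ?zs \<union> ?H) \<times> (set ?zs \<union> ?H)" using rs(1) by (simp add: Un_assoc)
    show "length ?zs < length rs" using rs(2) by (simp add: even_letters_def)
  qed (use H w in auto)
  have "eval_polynomial Q.G a (pair_polynomial (Suc r)) =
      sym_pairs Q.G (a 0 \<otimes>\<^bsub>Q.G\<^esub> a 1) (map (\<lambda>k. (a (2 * k + 2), a (2 * k + 3))) [0..<Suc r])"
    by (rule G.eval_pair_polynomial) (rule ac)
  also have "\<dots> = \<zero>\<^bsub>Q.G\<^esub>"
  proof (rule G.sym_pairs_vanish_span[OF Xc van])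
    show "a 0 \<otimes>\<^bsub>Q.G\<^esub> a 1 \<in> G.sq_closure" by (rule G.mult_in_sq_closure) (use ac in auto)
    show "set (map (\<lambda>k. (a (2 * k + 2), a (2 * k + 3))) [0..<Suc r]) \<subseteq> G.lin_span ?X \<times> G.lin_span ?X"
      using a by auto
  qed simp_all
  finally show "eval_polynomial Q.G a (pair_polynomial (Suc r)) = \<zero>\<^bsub>Q.G\<^esub>" .
qed

lemma no_odd_generator_satisfies:
  "free_satisfies r 0 (monom (long_word r) :: ('f::field_char_0, nat) polynomial)"
proof (rule free_satisfies_if_envelopes[OF long_word_multilinear])
  fix I :: "('f, nat + nat) polynomial set" and a
  assume I: "admissible r 0 I"
  let ?Q = "quotient_superalgebra (free_nonassoc_superalgebra r 0) I"
  have jQ: "jordan_metabelian_superalgebra ?Q" using I by (simp add: admissible_def)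
  interpret Q: superalgebra ?Q using jQ by (simp add: jordan_metabelian_superalgebra_def)
  interpret G: jordan_metabelian Q.G using jQ by (simp add: jordan_metabelian_superalgebra_def)
  let ?zs = "even_letters I r 0"
  have no: "odd_letters I r 0 = {}" by (simp add: odd_letters_def)
  let ?X = "set ?zs \<union> G.sq_ann"
  assume "\<And>v. v < 2 * r + 3 \<Longrightarrow> a v \<in> G.lin_span (set ?zs \<union> odd_letters I r 0 \<union> G.sq_ann)"
  then have a: "\<And>v. v < 2 * r + 3 \<Longrightarrow> a v \<in> G.lin_span ?X" unfolding no by simp
  note lc = letters_carrier[OF I]
  have zc: "set ?zs \<subseteq> carrier Q.G" using lc(1) by blast
  then have Xc: "?X \<subseteq> carrier Q.G" using G.sq_ann_carrier by blast
  then have ac: "a v \<in> carrier Q.G" if "v < 2 * r + 3" for v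
    using a[OF that] G.lin_span_carrier by blast
  have card: "card (set ?zs) \<le> r" using card_length[of ?zs] by (simp add: even_letters_def)
  have van: "rmul Q.G w cs = \<zero>\<^bsub>Q.G\<^esub>"
    if w: "w \<in> G.sq_closure" and cs: "set cs \<subseteq> ?X" "length cs = 2 * r + 1" for w cs
    by (rule G.rmul_vanish[OF _ zc w cs(1)]) (use card cs(2) in auto)
  have "eval_polynomial Q.G a (monom (long_word r)) = eval_monomial Q.G a (long_word r)"
  proof (rule G.eval_polynomial_monom, rule G.eval_monomial_closed)
    fix v assume "v \<in> vars (long_word r)"
    then have "v \<in> set (leaves (long_word r))" by simp
    then show "a v \<in> carrier Q.G" unfolding leaves_long_word by (intro ac) auto
  qed
  also have "\<dots> = rmul Q.G (a 0 \<otimes>\<^bsub>Q.G\<^esub> a 1) (map a [2..<2 * r + 3])"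
    by (simp add: long_word_def eval_word_monomial word_value_def)
  also have "\<dots> = \<zero>\<^bsub>Q.G\<^esub>"
  proof (rule G.rmul_vanish_span[OF Xc van])
    show "a 0 \<otimes>\<^bsub>Q.G\<^esub> a 1 \<in> G.sq_closure" by (rule G.mult_in_sq_closure) (use ac in auto)
    show "set (map a [2..<2 * r + 3]) \<subseteq> G.lin_span ?X" using a by auto
  qed simp_all
  finally show "eval_polynomial Q.G a (monom (long_word r)) = \<zero>\<^bsub>Q.G\<^esub>" .
qed

section \<open>Failure of the separating identities\<close>

text \<open>The sign of the Vandermonde product of the list: an alternating function that is nonzero on lists without
  repetition.\<close>

primrec sign_vandermonde :: "nat list \<Rightarrow> 'f::field_char_0" where
  "sign_vandermonde [] = 1"
| "sign_vandermonde (x # xs) = (\<Prod>y\<leftarrow>xs. if x < y then 1 else if y < x then - 1 else 0) * sign_vandermonde xs"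

lemma sign_vandermonde_swap:
  "sign_vandermonde (xs @ b # a # ys) = - (sign_vandermonde (xs @ a # b # ys) :: 'f::field_char_0)"
  by (induct xs) (auto simp: mult_ac)

lemma sign_vandermonde_nonzero: "distinct xs \<Longrightarrow> sign_vandermonde xs \<noteq> (0 :: 'f::field_char_0)"
  by (induct xs) (auto simp: prod_list_zero_iff)

text \<open>The letters at odd and at even positions; the inverse of \<open>interleave\<close>.\<close>

fun deal :: "'v list \<Rightarrow> 'v list \<times> 'v list" where
  "deal [] = ([], [])"
| "deal (x # xs) = (x # snd (deal xs), fst (deal xs))"

lemma deal_swap:
  "\<exists>P Q R S. (\<forall>a c. deal (xs @ [a, b, c] @ ys) = (P @ a # c # Q, R @ b # S)) \<or>
     (\<forall>a c. deal (xs @ [a, b, c] @ ys) = (R @ b # S, P @ a # c # Q))"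
proof (induct xs)
  case Nil
  show ?case by (rule exI[of _ "[]"], rule exI[of _ "snd (deal ys)"], rule exI[of _ "[]"], rule exI[of _ "fst (deal ys)"]) simp
next
  case (Cons x xs)
  then obtain P Q R S where "(\<forall>a c. deal (xs @ [a, b, c] @ ys) = (P @ a # c # Q, R @ b # S)) \<or>
     (\<forall>a c. deal (xs @ [a, b, c] @ ys) = (R @ b # S, P @ a # c # Q))" by blast
  then show ?case
  proof
    assume "\<forall>a c. deal (xs @ [a, b, c] @ ys) = (P @ a # c # Q, R @ b # S)"
    then have "\<forall>a c. deal ((x # xs) @ [a, b, c] @ ys) = ((x # R) @ b # S, P @ a # c # Q)" by simp
    then show ?thesis by blast
  next
    assume "\<forall>a c. deal (xs @ [a, b, c] @ ys) = (R @ b # S, P @ a # c # Q)"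
    then have "\<forall>a c. deal ((x # xs) @ [a, b, c] @ ys) = ((x # P) @ a # c # Q, R @ b # S)" by simp
    then show ?thesis by blast
  qed
qed

definition dup :: "'v list \<Rightarrow> 'v list" where
  "dup l = concat (map (\<lambda>j. [j, j]) l)"

lemma dup_simps [simp]: "dup [] = []" "dup (x # l) = x # x # dup l" "dup (k @ l) = dup k @ dup l"
  by (simp_all add: dup_def)

lemma deal_dup: "deal (dup l) = (l, l)"
  by (induct l) auto

definition first_odd :: "nat \<Rightarrow> bit" where
  "first_odd i = (if i = 0 then 1 else 0)"

text \<open>This function alternates both in the letters at odd positions and in those at even positions. It is supported on
  words with \<open>m\<close> odd letters, where \<open>0\<close> is the only odd letter. For \<open>m \<le> 1\<close> odd letters are never exchanged, so
  that ordinary skew-symmetry is enough.\<close>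

definition double_sign :: "nat \<Rightarrow> nat list \<Rightarrow> 'f::field_char_0" where
  "double_sign m cs = (if count_list cs 0 = m
     then sign_vandermonde (fst (deal cs)) * sign_vandermonde (snd (deal cs)) else 0)"

lemma super_skew_double_sign:
  assumes m: "m \<le> 1"
  shows "super_skew first_odd (double_sign m :: nat list \<Rightarrow> 'f::field_char_0)"
  unfolding super_skew_def
proof (intro allI)
  fix xs ys :: "nat list" and a b c
  let ?l = "xs @ [a, b, c] @ ys" and ?r = "xs @ [c, b, a] @ ys"
  let ?k = "koszul_factor (first_odd a) (first_odd b) * koszul_factor (first_odd b) (first_odd c) *
    koszul_factor (first_odd a) (first_odd c) :: 'f"
  have cnt: "count_list ?l 0 = count_list ?r 0" by simp
  show "double_sign m ?l = - (?k * double_sign m ?r)"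
  proof (cases "count_list ?l 0 = m")
    case False
    then show ?thesis using cnt by (simp add: double_sign_def)
  next
    case True
    then have "count_list [a, b, c] 0 \<le> 1" using m unfolding count_list_append by linarith
    then have "a \<noteq> 0 \<and> b \<noteq> 0 \<or> b \<noteq> 0 \<and> c \<noteq> 0 \<or> a \<noteq> 0 \<and> c \<noteq> 0" by (auto split: if_splits)
    then have k: "?k = 1" by (auto simp: first_odd_def koszul_factor_def)
    obtain P Q R S where "(\<forall>a c. deal (xs @ [a, b, c] @ ys) = (P @ a # c # Q, R @ b # S)) \<or>
     (\<forall>a c. deal (xs @ [a, b, c] @ ys) = (R @ b # S, P @ a # c # Q))" using deal_swap[of xs b ys] by (elim exE) (rule that)
    then have "sign_vandermonde (fst (deal ?l)) * sign_vandermonde (snd (deal ?l)) =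
      - (sign_vandermonde (fst (deal ?r)) * sign_vandermonde (snd (deal ?r)) :: 'f)"
      using sign_vandermonde_swap[of P a c Q, where 'f='f] by auto
    then show ?thesis unfolding k using True cnt by (simp add: double_sign_def)
  qed
qed

lemma weight_first_odd: "weight first_odd cs = of_nat (count_list cs 0)"
  by (induct cs) (auto simp: first_odd_def)

lemma koszul_sign_few_odd:
  assumes "\<And>i j. \<lbrakk>p i = 1; p j = 1\<rbrakk> \<Longrightarrow> i = j"
  shows "koszul_sign p vs = (1 :: 'f::field_char_0)"
proof -
  have "\<not> (vs ! l < vs ! k \<and> p (vs ! k) * p (vs ! l) = 1)" for k l
  proof
    assume h: "vs ! l < vs ! k \<and> p (vs ! k) * p (vs ! l) = 1"
    then have "p (vs ! k) = 1" "p (vs ! l) = 1" by auto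
    then show False using assms[of "vs ! k" "vs ! l"] h by simp
  qed
  then have "{(k, l). k < l \<and> l < length vs \<and> vs ! l < vs ! k \<and> p (vs ! k) * p (vs ! l) = 1} = {}" by blast
  then show ?thesis unfolding koszul_sign_def by (simp only: card.empty power_0)
qed

lemma (in superalgebra) superized_monom:
  assumes "\<And>v. v \<in> vars w \<Longrightarrow> a v \<in> carrier A" "eval_polynomial A a (superization p (monom w)) = \<zero>"
  shows "eval_monomial A a w = \<zero>"
proof -
  have c: "eval_monomial A a w \<in> carrier A" using assms(1) by (rule eval_monomial_closed)
  have "{v. superization p (monom w :: ('f, nat) polynomial) v \<noteq> 0} = {w}"
    by (auto simp: superization_support monom_def)
  then have "eval_polynomial A a (superization p (monom w)) = koszul_sign p (leaves w) \<odot> eval_monomial A a w"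
    using c by (simp add: eval_polynomial_def superization_def monom_apply)
  then show ?thesis using smult_eq_zero[OF c] assms(2) by simp
qed

text \<open>Substituting generators only.\<close>

lemma free_satisfies_generators:
  fixes f :: "('f::field_char_0, nat) polynomial"
  assumes f: "free_satisfies r s f"
    and B: "jordan_metabelian_superalgebra B"
    and b: "\<And>g. g \<in> gens r s \<Longrightarrow> b g \<in> grade B (generator_parity g)"
    and q: "\<And>i. q i \<in> gens r s"
  shows "eval_polynomial B (\<lambda>i. b (q i)) (superization (\<lambda>i. generator_parity (q i)) f) = \<zero>\<^bsub>B\<^esub>"
proof -
  interpret B: superalgebra B using B by (simp add: jordan_metabelian_superalgebra_def)
  have "eval_polynomial B (\<lambda>i. eval_polynomial B b (monom (Var (q i)))) (superization (\<lambda>i. generator_parity (q i)) f) = \<zero>\<^bsub>B\<^esub>"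
    by (rule free_satisfies_transfer[OF f B b]) (use monom_grade[of "Var (q _)" r s] q in \<open>auto\<close>)
  moreover have "eval_polynomial B b (monom (Var (q i))) = b (q i)" for i
    using B.eval_polynomial_monom[of b "Var (q i)"] B.grade_carrier[OF b[OF q]] by simp
  ultimately show ?thesis by simp
qed

lemma map_lab_upt: "map (\<lambda>i. (i - 1) div 2 + 1) [1..<2 * r + 3] = dup [1..<r + 2]"
proof (induct r)
  case 0
  have "[1..<3] = [1, 2::nat]" "[1..<2] = [1::nat]" by (simp_all add: upt_rec)
  then show ?case by simp
next
  case (Suc r)
  have "[1..<2 * Suc r + 3] = [1..<2 * r + 3] @ [2 * r + 3, 2 * r + 4]" 
    using upt_Suc_append[of 1 "2 * r + 3"] upt_Suc_append[of 1 "Suc (2 * r + 3)"] by (simp add: numeral_3_eq_3)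
  moreover have "[1..<Suc r + 2] = [1..<r + 2] @ [r + 2]" by simp
  ultimately show ?case using Suc by simp
qed

lemma double_sign_dup: "double_sign 0 (dup [1..<n]) \<noteq> (0 :: 'f::field_char_0)"
  "double_sign 1 (0 # dup [1..<n]) \<noteq> (0 :: 'f::field_char_0)"
proof -
  have "count_list (dup l) 0 = 2 * count_list l 0" for l :: "nat list" by (induct l) auto
  moreover have "count_list [1..<n] 0 = 0" by (simp add: count_list_0_iff)
  ultimately have c: "count_list (dup [1..<n]) 0 = 0" by simp
  show "double_sign 0 (dup [1..<n]) \<noteq> (0 :: 'f)"
    using c by (simp add: double_sign_def deal_dup sign_vandermonde_nonzero)
  have "sign_vandermonde (0 # [1..<n]) \<noteq> (0 :: 'f)" by (rule sign_vandermonde_nonzero) auto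
  then show "double_sign 1 (0 # dup [1..<n]) \<noteq> (0 :: 'f)"
    using c by (simp add: double_sign_def deal_dup sign_vandermonde_nonzero)
qed

text \<open>The even generators are mapped to the letters from \<open>1\<close> on and the odd generator to the letter \<open>0\<close>. The first even
  generator also carries the function that detects the surviving word.\<close>

definition even_model_generator :: "nat \<Rightarrow> nat + nat \<Rightarrow> 'f::field_char_0 split_element" where
  "even_model_generator m g = (case g of
     Inl j \<Rightarrow> (unit_vector (Suc j), if j = 0 then double_sign m else (\<lambda>_. 0))
   | Inr j \<Rightarrow> (unit_vector 0, \<lambda>_. 0))"

lemma even_model_generator_grade:
  assumes "m \<le> 1" "g \<in> gens (r + 1) 1"
  shows "even_model_generator m g \<in> grade (split_extension first_odd (r + 2) (of_nat m)) (generator_parity g)"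
proof -
  have "of_nat m + weight first_odd cs = 0" if "double_sign m cs \<noteq> (0::'a)" for cs
  proof -
    have "count_list cs 0 = m" using that by (simp add: double_sign_def split: if_splits)
    then show ?thesis unfolding weight_first_odd by (simp only: bit_add_self)
  qed
  then show ?thesis using assms super_skew_double_sign[OF assms(1)]
    by (cases g) (auto simp: even_model_generator_def split_simps gens_def unit_vector_def first_odd_def super_skew_linear split: if_splits)
qed

text \<open>The word \<open>((z\<^sub>1 z\<^sub>1) z\<^sub>1) z\<^sub>2 z\<^sub>2 \<dots> z\<^sub>r\<^sub>+\<^sub>1 z\<^sub>r\<^sub>+\<^sub>1\<close> is nonzero: read by the function carried by one of the first two
  factors, it has the letters \<open>1, \<dots>, r + 1\<close> in both classes of positions.\<close>

lemma even_generators_not_satisfies: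
  "\<not> free_satisfies (r + 1) 0 (monom (long_word r) :: ('f::field_char_0, nat) polynomial)"
proof
  assume f: "free_satisfies (r + 1) 0 (monom (long_word r) :: ('f, nat) polynomial)"
  let ?M = "split_extension first_odd (r + 2) (of_nat 0) :: ('f, 'f split_element) superalgebra"
  interpret M: superalgebra ?M by (rule split_superalgebra)
  let ?g = "even_model_generator 0 :: nat + nat \<Rightarrow> 'f split_element"
  have g: "?g g \<in> grade ?M (generator_parity g)" if "g \<in> gens (r + 1) 0" for g
    by (rule even_model_generator_grade) (use that in \<open>auto simp: gens_def\<close>)
  define q :: "nat \<Rightarrow> nat + nat" where "q i = Inl (if i < 2 * r + 3 then (i - 1) div 2 else 0)" for i
  have q: "q i \<in> gens (r + 1) 0" for i by (auto simp: q_def gens_def)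
  let ?a = "\<lambda>i. ?g (q i)"
  have ac: "?a i \<in> carrier ?M" for i by (rule M.grade_carrier[OF g[OF q]])
  have "eval_polynomial ?M ?a (superization (\<lambda>i. generator_parity (q i)) (monom (long_word r))) = \<zero>\<^bsub>?M\<^esub>"
    by (rule free_satisfies_generators[OF f split_jordan_metabelian g q])
  then have z: "eval_monomial ?M ?a (long_word r) = \<zero>\<^bsub>?M\<^esub>" by (rule M.superized_monom[OF ac])
  let ?lab = "\<lambda>i. (i - 1) div 2 + 1"
  have "signed_act first_odd (r + 2) 0 (unit_vector 1) u cs = act (r + 2) (unit_vector 1) u cs" for u :: "nat list \<Rightarrow> 'f" and cs
    unfolding signed_act_def act_def unit_vector_def
    by (rule sum.cong) (auto simp: first_odd_def koszul_factor_def)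
  then have "?a 0 \<otimes>\<^bsub>?M\<^esub> ?a 1 = (\<lambda>i. 0, \<lambda>cs. 2 * double_sign 0 (1 # cs))"
    by (simp add: q_def even_model_generator_def split_simps act_unit_vector)
  moreover have "rmul ?M (\<lambda>i. 0, \<lambda>cs. 2 * double_sign 0 (1 # cs)) (map ?a [2..<2 * r + 3])
      = (\<lambda>i. 0, \<lambda>ds. 2 * double_sign 0 (1 # map ?lab [2..<2 * r + 3] @ ds))"
    by (rule split_rmul_letters) (auto simp: q_def even_model_generator_def)
  ultimately have "eval_monomial ?M ?a (long_word r) = (\<lambda>i. 0, \<lambda>ds. 2 * double_sign 0 (1 # map ?lab [2..<2 * r + 3] @ ds))"
    by (simp add: long_word_def eval_word_monomial word_value_def)
  then have "(\<lambda>ds. 2 * double_sign 0 (1 # map ?lab [2..<2 * r + 3] @ ds)) = (\<lambda>ds. 0 :: 'f)"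
    using z by (simp add: split_simps(2))
  then have "2 * double_sign 0 (1 # map ?lab [2..<2 * r + 3] @ []) = (0 :: 'f)" by (rule fun_cong)
  moreover have "1 # map ?lab [2..<2 * r + 3] = dup [1..<r + 2]"
  proof -
    have "[1..<2 * r + 3] = 1 # [2..<2 * r + 3]" using upt_conv_Cons[of 1 "2 * r + 3", unfolded Suc_1] by simp
    then show ?thesis using map_lab_upt[of r] by (simp del: One_nat_def)
  qed
  ultimately show False using double_sign_dup(1)[of "r + 2", where 'f='f] by simp
qed

text \<open>Let \<open>z\<^sub>1, \<dots>, z\<^sub>r\<^sub>+\<^sub>1\<close> be the even generators and \<open>x\<close> the odd one. The pairs \<open>(z\<^sub>1, z\<^sub>1), \<dots>, (z\<^sub>r\<^sub>+\<^sub>1, z\<^sub>r\<^sub>+\<^sub>1)\<close> applied to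
  \<open>z\<^sub>1 x\<close> give a nonzero multiple of a word. After the letter \<open>0\<close> for \<open>x\<close> the first class of positions has the letters
  \<open>0, \<dots>, r + 1\<close> and the second \<open>1, \<dots>, r + 1\<close>.\<close>

lemma one_odd_generator_not_satisfies_pairs:
  "\<not> free_satisfies (r + 1) 1 (pair_polynomial (Suc r) :: ('f::field_char_0, nat) polynomial)"
proof
  assume f: "free_satisfies (r + 1) 1 (pair_polynomial (Suc r) :: ('f, nat) polynomial)"
  let ?M = "split_extension first_odd (r + 2) (of_nat 1) :: ('f, 'f split_element) superalgebra"
  interpret M: superalgebra ?M by (rule split_superalgebra)
  let ?g = "even_model_generator 1 :: nat + nat \<Rightarrow> 'f split_element"
  have g: "?g g \<in> grade ?M (generator_parity g)" if "g \<in> gens (r + 1) 1" for g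
    by (rule even_model_generator_grade[OF order_refl that])
  define q :: "nat \<Rightarrow> nat + nat" where
    "q i = (if i = 1 then Inr 0 else Inl (if i < 2 * r + 4 then (i - 2) div 2 else 0))" for i
  have q: "q i \<in> gens (r + 1) 1" for i by (auto simp: q_def gens_def)
  let ?a = "\<lambda>i. ?g (q i)"
  have ac: "?a i \<in> carrier ?M" for i by (rule M.grade_carrier[OF g[OF q]])
  have z: "eval_polynomial ?M ?a (superization (\<lambda>i. generator_parity (q i)) (pair_polynomial (Suc r))) = \<zero>\<^bsub>?M\<^esub>"
    by (rule free_satisfies_generators[OF f split_jordan_metabelian g q])
  have sup: "superization (\<lambda>i. generator_parity (q i)) (pair_polynomial (Suc r)) = (pair_polynomial (Suc r) :: ('f, nat) polynomial)"
  proof -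
    have "i = j" if "generator_parity (q i) = 1" "generator_parity (q j) = 1" for i j
      using that by (auto simp: q_def split: if_splits)
    then have "koszul_sign (\<lambda>i. generator_parity (q i)) vs = (1::'f)" for vs by (rule koszul_sign_few_odd)
    then show ?thesis by (simp add: superization_def)
  qed
  have step: "sym_pair ?M (\<lambda>i. 0, u) (b, b) = (\<lambda>i. 0, \<lambda>cs. 2 * u (l # l # cs))"
    if b1: "fst b = unit_vector l" and l: "l < r + 2" for u l b
  proof -
    obtain v where b: "b = (unit_vector l, v)" using b1 by (cases b) auto
    have e: "act (r + 2) (unit_vector l) w = (\<lambda>cs. w (l # cs))" for w :: "nat list \<Rightarrow> 'f"
      using l by (simp add: act_unit_vector fun_eq_iff)
    show ?thesis unfolding sym_pair_def b fst_conv snd_conv split_mult_right e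
      by (simp add: split_simps(3))
  qed
  have fold: "sym_pairs ?M (\<lambda>i. 0, u) (map (\<lambda>k. (?a (2 * k + 2), ?a (2 * k + 3))) [0..<n])
      = (\<lambda>i. 0, \<lambda>cs. 2 ^ n * u (dup [1..<Suc n] @ cs))" if "n \<le> Suc r" for n u
    using that
  proof (induct n)
    case (Suc n)
    have "?a (2 * n + 3) = ?a (2 * n + 2)" "fst (?a (2 * n + 2)) = unit_vector (Suc n)" "Suc n < r + 2"
      using Suc(2) by (auto simp: q_def even_model_generator_def)
    then have s: "sym_pair ?M (\<lambda>i. 0, v) (?a (2 * n + 2), ?a (2 * n + 3)) = (\<lambda>i. 0, \<lambda>cs. 2 * v (Suc n # Suc n # cs))" for v
      using step[of "?a (2 * n + 2)" "Suc n" v] by (simp only:)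
    define D where "D = dup [1..<Suc n]"
    have d: "dup [1..<Suc (Suc n)] @ cs = D @ Suc n # Suc n # cs" for cs by (simp add: D_def)
    have m: "map (\<lambda>k. (?a (2 * k + 2), ?a (2 * k + 3))) [0..<Suc n] =
      map (\<lambda>k. (?a (2 * k + 2), ?a (2 * k + 3))) [0..<n] @ [(?a (2 * n + 2), ?a (2 * n + 3))]" by simp
    have "sym_pairs ?M (\<lambda>i. 0, u) (map (\<lambda>k. (?a (2 * k + 2), ?a (2 * k + 3))) [0..<n]) = (\<lambda>i. 0, \<lambda>cs. 2 ^ n * u (D @ cs))"
      using Suc unfolding D_def by simp
    then show ?case unfolding m d by (simp only: sym_pairs_simps s power_Suc mult.assoc)
  qed simp
  have "?a 0 \<otimes>\<^bsub>?M\<^esub> ?a 1 = (\<lambda>i. 0, \<lambda>cs. double_sign 1 (0 # cs))"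
    by (simp add: q_def even_model_generator_def split_simps act_unit_vector signed_act_linear)
  then have "eval_polynomial ?M ?a (pair_polynomial (Suc r)) =
      (\<lambda>i. 0, \<lambda>cs. 2 ^ Suc r * double_sign 1 (0 # dup [1..<Suc (Suc r)] @ cs))"
    unfolding M.eval_pair_polynomial[OF ac] by (simp only: fold[OF order_refl])
  then have "(\<lambda>cs. 2 ^ Suc r * double_sign 1 (0 # dup [1..<Suc (Suc r)] @ cs)) = (\<lambda>cs. 0 :: 'f)"
    using z unfolding sup by (simp only: split_simps(2) prod.inject)
  then have "2 ^ Suc r * double_sign 1 (0 # dup [1..<Suc (Suc r)] @ []) = (0 :: 'f)" by (rule fun_cong)
  then show False using double_sign_dup(2)[of "Suc (Suc r)", where 'f='f] by (simp del: upt_Suc)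
qed

text \<open>In an odd letter alone, skew-symmetry in the super sense is no restriction, so there is an even element \<open>z\<close> such that
  \<open>z x \<dots> x \<noteq> 0\<close> for any even number of factors \<open>x\<close>.\<close>

lemma one_odd_generator_not_satisfies_word:
  assumes r: "1 \<le> r"
  shows "\<not> free_satisfies r 1 (monom (long_word r) :: ('f::field_char_0, nat) polynomial)"
proof
  assume f: "free_satisfies r 1 (monom (long_word r) :: ('f, nat) polynomial)"
  let ?M = "split_extension (\<lambda>_. 1) 1 0 :: ('f, 'f split_element) superalgebra"
  interpret M: superalgebra ?M by (rule split_superalgebra)
  let ?u = "\<lambda>cs :: nat list. if length cs = 2 * r + 2 then 1 else 0 :: 'f"
  let ?g = "\<lambda>g :: nat + nat. case g of Inl _ \<Rightarrow> (\<lambda>_. 0, ?u) | Inr _ \<Rightarrow> (unit_vector 0, \<lambda>_. 0)"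
  have u: "super_skew (\<lambda>_. 1) ?u" by (simp add: super_skew_def koszul_factor_def)
  have uw: "0 + weight (\<lambda>_. 1) cs = 0" if "?u cs \<noteq> 0" for cs
  proof -
    have "length cs = (r + 1) + (r + 1)" using that by (simp split: if_splits)
    then show ?thesis unfolding weight_all_odd by (simp only: of_nat_add bit_add_self add_0_right)
  qed
  have g: "?g g \<in> grade ?M (generator_parity g)" for g
  proof (cases g)
    case (Inl j)
    have "(\<lambda>_. 0, ?u) \<in> grade ?M 0" unfolding split_simps using u uw by blast
    then show ?thesis using Inl by simp
  next
    case (Inr j)
    have "(unit_vector 0, \<lambda>_. 0) \<in> grade ?M 1" by (auto simp: split_simps unit_vector_def super_skew_linear)
    then show ?thesis using Inr by simp
  qed
  define q :: "nat \<Rightarrow> nat + nat" where "q i = (if i = 0 then Inl 0 else Inr 0)" for i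
  have q: "q i \<in> gens r 1" for i using r by (auto simp: q_def gens_def)
  let ?a = "\<lambda>i. ?g (q i)"
  have ac: "?a i \<in> carrier ?M" for i by (rule M.grade_carrier[OF g])
  have "eval_polynomial ?M ?a (superization (\<lambda>i. generator_parity (q i)) (monom (long_word r))) = \<zero>\<^bsub>?M\<^esub>"
    by (rule free_satisfies_generators[OF f split_jordan_metabelian g q])
  then have z: "eval_monomial ?M ?a (long_word r) = \<zero>\<^bsub>?M\<^esub>" by (rule M.superized_monom[OF ac])
  have "?a 0 \<otimes>\<^bsub>?M\<^esub> ?a 1 = (\<lambda>i. 0, \<lambda>cs. ?u (0 # cs))"
    by (simp add: q_def split_mult_right act_unit_vector fun_eq_iff)
  moreover have "rmul ?M (\<lambda>i. 0, \<lambda>cs. ?u (0 # cs)) (map ?a [2..<2 * r + 3])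
      = (\<lambda>i. 0, \<lambda>ds. ?u (0 # map (\<lambda>_. 0) [2..<2 * r + 3] @ ds))"
    by (rule split_rmul_letters) (auto simp: q_def)
  ultimately have "eval_monomial ?M ?a (long_word r) = (\<lambda>i. 0, \<lambda>ds. ?u (0 # map (\<lambda>_. 0) [2..<2 * r + 3] @ ds))"
    by (simp add: long_word_def eval_word_monomial word_value_def)
  then have "(\<lambda>ds. ?u (0 # map (\<lambda>_. 0) [2..<2 * r + 3] @ ds)) = (\<lambda>ds. 0 :: 'f)"
    using z by (simp only: split_simps(2) prod.inject)
  then have "?u (0 # map (\<lambda>_. 0) [2..<2 * r + 3] @ []) = 0" by (rule fun_cong)
  then show False by simp
qed

section \<open>Inclusions of supervarieties\<close>

lemma supervariety_V_mono:
  assumes "r \<le> r'" "s \<le> s'"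
  shows "(supervariety_V r s :: ('f::field_char_0, 'a) superalgebra set) \<subseteq> supervariety_V r' s'"
  using free_satisfies_mono[OF assms]
  unfolding supervariety_V_def supervariety_generated_def by blast

text \<open>The larger free superalgebra itself separates the supervarieties.\<close>

lemma supervariety_V_strict:
  fixes f :: "('f::field_char_0, nat) polynomial"
  assumes "r \<le> r'" "s \<le> s'" "multilinear n f"
    and "free_satisfies r s f"
    and "\<not> free_satisfies r' s' f"
  shows "(supervariety_V r s :: ('f, 'f free_element) superalgebra set) \<subset> supervariety_V r' s'"
proof -
  let ?F = "free_jordan_metabelian_superalgebra r' s' :: ('f, 'f free_element) superalgebra"
  have "?F \<in> supervariety_V r' s'"
    by (simp add: supervariety_V_def supervariety_generated_def free_jordan_metabelian_is_superalgebra)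
  moreover have "?F \<notin> supervariety_V r s"
    using assms(3-5) unfolding supervariety_V_def supervariety_generated_def by blast
  ultimately show ?thesis using supervariety_V_mono[OF assms(1,2)] by blast
qed

lemma supervariety_V_two_odd:
  assumes "2 \<le> s" "2 \<le> s'"
  shows "(supervariety_V r s :: ('f::field_char_0, 'a) superalgebra set) \<subseteq> supervariety_V r' s'"
proof -
  have "free_satisfies r s f"
    if f: "multilinear n f" and sat: "free_satisfies r' s' f"
    for n f
  proof -
    have two: "free_satisfies 0 2 f"
      by (rule free_satisfies_mono[OF _ assms(2) sat]) simp
    show ?thesis
      unfolding free_satisfies_iff admissible_def using two_odd_generators_universal[OF f two] by blast
  qed
  then show ?thesis unfolding supervariety_V_def supervariety_generated_def by blast
qed

theorem theorem3:
  shows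
    "(\<forall>r\<ge>1.
        (supervariety_V r 0 :: ('f::field_char_0, 'a) superalgebra set) \<subseteq> supervariety_V (r + 1) 0 \<and>
        (supervariety_V r 0 :: ('f, 'f free_element) superalgebra set) \<subset> supervariety_V (r + 1) 0 \<and>
        (supervariety_V r 0 :: ('f, 'a) superalgebra set) \<subseteq> supervariety_V r 1 \<and>
        (supervariety_V r 0 :: ('f, 'f free_element) superalgebra set) \<subset> supervariety_V r 1) \<and>
     (\<forall>r\<ge>0.
        (supervariety_V r 1 :: ('f, 'a) superalgebra set) \<subseteq> supervariety_V (r + 1) 1 \<and>
        (supervariety_V r 1 :: ('f, 'f free_element) superalgebra set) \<subset> supervariety_V (r + 1) 1 \<and>
        (supervariety_V r 1 :: ('f, 'a) superalgebra set) \<subseteq> supervariety_V r 2 \<and>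
        (supervariety_V r 1 :: ('f, 'f free_element) superalgebra set) \<subset> supervariety_V r 2) \<and>
     (\<forall>r\<ge>0. \<forall>s\<ge>2.
        (supervariety_V r s :: ('f, 'a) superalgebra set) = supervariety_V (r + 1) s \<and>
        (supervariety_V r s :: ('f, 'a) superalgebra set) = supervariety_V r (s + 1))"
proof -
  have 1: "(supervariety_V r 0 :: ('f, 'f free_element) superalgebra set) \<subset> supervariety_V (r + 1) 0" for r
    by (rule supervariety_V_strict[OF _ _ long_word_multilinear no_odd_generator_satisfies even_generators_not_satisfies]) auto
  have 2: "(supervariety_V r 0 :: ('f, 'f free_element) superalgebra set) \<subset> supervariety_V r 1" if "1 \<le> r" for r
    by (rule supervariety_V_strict[OF _ _ long_word_multilinear no_odd_generator_satisfies one_odd_generator_not_satisfies_word[OF that]]) auto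
  have 3: "(supervariety_V r 1 :: ('f, 'f free_element) superalgebra set) \<subset> supervariety_V (r + 1) 1" for r
    by (rule supervariety_V_strict[OF _ _ pair_polynomial_multilinear one_odd_generator_satisfies one_odd_generator_not_satisfies_pairs]) auto
  \<comment> \<open>One more even generator is a proper enlargement, and it is superfluous beside two odd ones.\<close>
  have 4: "(supervariety_V r 1 :: ('f, 'f free_element) superalgebra set) \<subset> supervariety_V r 2" for r
  proof -
    have "(supervariety_V (r + 1) 1 :: ('f, 'f free_element) superalgebra set) \<subseteq> supervariety_V (r + 1) 2"
      by (rule supervariety_V_mono) auto
    also have "\<dots> \<subseteq> supervariety_V r 2" by (rule supervariety_V_two_odd) auto
    finally show ?thesis using 3[of r] by blast
  qed
  have 5: "(supervariety_V r s :: ('f, 'a) superalgebra set) = supervariety_V (r + 1) s"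
    "(supervariety_V r s :: ('f, 'a) superalgebra set) = supervariety_V r (s + 1)" if "2 \<le> s" for r s
    using that by (auto intro!: equalityI supervariety_V_two_odd del: subsetI)
  have 6: "(supervariety_V r s :: ('f, 'a) superalgebra set) \<subseteq> supervariety_V r' s'" if "r \<le> r'" "s \<le> s'" for r s r' s'
    using that by (rule supervariety_V_mono)
  show ?thesis by (intro conjI allI impI; rule 1 2 3 4 5 6) simp_all
qed

end
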